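(* For each $n$ let $(x_i,y_i)_{i=1}^n$ be i.i.d. with $x_i\in\mathbb{R}^p$, $y_i\in\mathbb{R}$, $p=p_n$, let $\beta^0\in\mathbb{R}^p$, $S=\{j:\beta_j^0\ne0\}$, $s_0=|S|$, and let $b:\mathbb{R}\to\mathbb{R}$ be twice differentiable. Assume: (1) $\max_{i\le n}\|x_i\|_\infty\le L$ and $\|\beta^0\|_1\le B$; (2) for a constant $a>1$ and $\gamma_1=\frac{a}{a-1}$, $\gamma_2=\frac{\sqrt{s_0}}{a-1}$, $\inf_{|J|\le s_0}\inf_{0\ne z\in\Lambda(J,\gamma_1,\gamma_2)}\frac{z^T\mathbb{E}(x_1x_1^T)z}{\|z\|_2^2}>\kappa^*>0$; (3) conditionally on the covariates, $y_i-\mathbb{E}(y_i\mid x_i)$, $i\le n$, are independent, non-degenerate, sub-Gaussian with variance proxies $\sigma_i^2(x_i^T\beta^0)$, with $0<C_b^2:=\max_{i\le n}\sigma_i^2(x_i^T\beta^0)<\infty$; $\mathbb{E}(y_i\mid x_i)=\dot b(x_i^T\beta^0)$ and $0<\mathrm{Var}(y_i\mid x_i)=\ddot b(x_i^T\beta^0)<\infty$; (4) there is $R>0$ with $\sup_{|u-\tilde u|\le R}\frac{|\ddot b(u)-\ddot b(\tilde u)|}{|u-\tilde u|}\le C_R$; (5) $n=o(p)$, $p=o(e^{n^r})$ for some $0<r<1/5$, and $s_0=o\big(\frac{n^{1/4}}{\log p}\big)$; (6) $\liminf_{n\to\infty}\|\Theta\|_{\mathrm{op},1}>0$ and $\|\Theta\|_{\mathrm{op},1}^2\max_{j\in[p]}r_j=O(\sqrt{\log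 p})$, where $\Theta=\Sigma^{-1}$ and $r_j=\#\{i\in[p]:\Theta_{ij}\neq0\}$; (7) there are constants $\gamma>1/2$ and $\rho\in(0,1/3)$ with $|\mathcal A(\gamma)|=o(p^{1+\rho})$ and $|\mathcal B(\rho)|=O(p)$, where $\Theta^0_{jk}=\Theta_{jk}/\sqrt{\Theta_{jj}\Theta_{kk}}$, $\mathcal A(\gamma)=\{(j,k)\in[p]^2:|\Theta^0_{jk}|\ge(\log p)^{-2-\gamma}\}$, $\mathcal B(\rho)=\{(j,k)\in[p]^2:|\Theta^0_{jk}|>\frac{1-\rho}{1+\rho}\}$; (8) there are constants $c_1,c_2$ with $0<c_1\le\sigma_{\min}(\Sigma)\le\sigma_{\max}(\Sigma)\le c_2$; (9) for every $j\in S$, $|\beta_j^0|>\sqrt{\frac{8\Theta_{jj}\log(p/s_0)}{n}}$; (10) with $\beta_{\min}=\min_{j\in S}|\beta_j^0|$ and $\alpha\in(0,1)$ the target level, $$\frac{\sqrt n\,\beta_{\min}}{\sqrt{\max_{j\in[p]}\Theta_{jj}}}-\sqrt{2\log\Big(\frac{2p}{\alpha s_0}\Big)}\to\infty\quad\text{as }n,p\to\infty.$$ Then for the GMT procedure (see context) at target level $\alpha$, $\mathrm{Power}_d\to1$ as $n,p\to\infty$.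
   Context: All quantities (data distribution, $p$, $\beta^0$, $s_0$, $\Sigma$) may depend on $n$; $L,B,\kappa^*,C_b,R,C_R,a,\gamma,\rho,c_1,c_2$ are constants not depending on $n$. $[p]=\{1,\dots,p\}$. $\ell(\beta)=\frac1n\sum_{i=1}^n[y_ix_i^T\beta-b(x_i^T\beta)]$, with gradient $\dot\ell(\beta)=\frac1n\sum_i x_i[y_i-\dot b(x_i^T\beta)]$. $\Sigma=\mathbb{E}[x_1x_1^T\ddot b(x_1^T\beta^0)]$ and $\Sigma_n=\frac1n\sum_i x_ix_i^T\ddot b(x_i^T\widehat\beta)$. $\sigma_{\min},\sigma_{\max}$ are the smallest and largest singular values. Lasso: $\widehat\beta\in\arg\min_{\beta\in\mathbb{R}^p}\{-\ell(\beta)+\lambda\|\beta\|_1\}$ with $\lambda\asymp\sqrt{\log(p/s_0)/n}$. CLIME: $\widehat\Theta=(\widehat\Theta_1,\dots,\widehat\Theta_p)^T$ with $\widehat\Theta_j\in\arg\min_{\omega\in\mathbb{R}^p}\{\|\omega\|_1:\|\Sigma_n\omega-e_j\|_\infty\le\lambda_n\}$, $\lambda_n\asymp\|\Sigma^{-1}\|_{\mathrm{op},1}s_0\sqrt{\log p/n}$. Debiased estimator: $\widehat\beta^d=\widehat\beta+\widehat\Theta\dot\ell(\widehat\beta)$. Test statistics: $T_j=\sqrt n\,\widehat\beta^d_j/\sqrt{\widehat\Theta_{jj}}$. GMT procedure at level $\alpha$: let $G(t)=2-2\Phi(t)$ ($\Phi$ the standard normal distribution function), $t_p=\sqrt{2\log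 p-2\log\log p}$, and $$t_0=\inf\Big\{0\le t\le t_p:\frac{pG(t)}{\big(\sum_{j=1}^p\mathbf 1\{|T_j|\ge t\}\big)\vee1}\le\alpha\Big\},$$ with $t_0=\sqrt{2\log p}$ if no such $t$ exists. The selected set is $\widehat S=\{j\in[p]:|T_j|\ge t_0\}$, and $\widehat{\mathrm{sign}}_j=\mathrm{sign}(T_j)$ for $j\in\widehat S$. The directional power is $$\mathrm{Power}_d=\mathbb{E}\left[\frac{|\{j\in\widehat S:\widehat{\mathrm{sign}}_j=\mathrm{sign}(\beta_j^0)\}|}{|S|\vee1}\right].$$ $\|A\|_{\mathrm{op},1}=\sup_{v\ne0}\|Av\|_1/\|v\|_1$. $\Lambda(J,\gamma_1,\gamma_2)=\{z\in\mathbb{R}^p:\|z_{J^c}\|_1\le\gamma_1\|z_J\|_1+\gamma_2\|z_J\|_2\}$ for $J\subseteq[p]$. A zero-mean $Z$ is sub-Gaussian with variance proxy $\sigma^2$ if $\mathbb{E}e^{sZ}\le e^{\sigma^2s^2/2}$ for all $s$. $a_n\asymp b_n$ means each is bounded by a constant multiple of the other.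
   Formalization: The function b is additionally assumed convex (without this the Lasso may not exist or may miss the signal), and λ ≍ …, λ_n ≍ … are read as being of these orders with sufficiently large constants, that for λ_n allowed to depend on λ. *)

theory Defs
  imports
    "HOL-Probability.Probability"
    "HOL-Library.Landau_Symbols"
    "Jordan_Normal_Form.Matrix"
    "Jordan_Normal_Form.Char_Poly"
    "Jordan_Normal_Form.Gauss_Jordan_Elimination"
begin

unbundle no vec_syntax
unbundle no inner_syntax

type_synonym rvec = "real Matrix.vec"
type_synonym rmat = "real Matrix.mat"

text \<open>
  The dimension varies with the sample size, so vectors and matrices are those of
  \<^theory>\<open>Jordan_Normal_Form.Matrix\<close>, with explicit carriers. Coordinates, observations and
  matrix entries are indexed from \<open>0\<close>: \<open>[p]\<close> is \<open>{..<p}\<close> and the first observation has index \<open>0\<close>.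
\<close>

definition l1_norm :: "rvec \<Rightarrow> real" where
  "l1_norm v = (\<Sum>j<dim_vec v. \<bar>v $ j\<bar>)"

definition l2_norm :: "rvec \<Rightarrow> real" where
  "l2_norm v = sqrt (\<Sum>j<dim_vec v. (v $ j)\<^sup>2)"

definition linf_norm :: "rvec \<Rightarrow> real" where
  "linf_norm v = Max ((\<lambda>j. \<bar>v $ j\<bar>) ` {..<dim_vec v})"

definition op1_norm :: "rmat \<Rightarrow> real" where
  "op1_norm A = (SUP v\<in>{v \<in> carrier_vec (dim_col A). v \<noteq> 0\<^sub>v (dim_col A)}.
                   l1_norm (A *\<^sub>v v) / l1_norm v)"

definition restrict_vec :: "nat set \<Rightarrow> rvec \<Rightarrow> rvec" where
  "restrict_vec J z = Matrix.vec (dim_vec z) (\<lambda>j. if j \<in> J then z $ j else 0)"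

definition re_cone :: "nat \<Rightarrow> nat set \<Rightarrow> real \<Rightarrow> real \<Rightarrow> rvec set" where
  "re_cone p J g1 g2 = {z \<in> carrier_vec p.
     l1_norm (restrict_vec (- J) z)
       \<le> g1 * l1_norm (restrict_vec J z) + g2 * l2_norm (restrict_vec J z)}"

text \<open>
  For a square matrix this is the set of all its singular values. It is only applied to square
  matrices; for a matrix with more columns than rows it could contain a spurious \<open>0\<close>.
\<close>
definition singular_values :: "rmat \<Rightarrow> real set" where
  "singular_values A = {s. 0 \<le> s \<and> eigenvalue (transpose_mat A * A) (s\<^sup>2)}"

definition sigma_min :: "rmat \<Rightarrow> real" where
  "sigma_min A = Min (singular_values A)"

definition sigma_max :: "rmat \<Rightarrow> real" where
  "sigma_max A = Max (singular_values A)"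

definition normalize_mat :: "rmat \<Rightarrow> nat \<Rightarrow> nat \<Rightarrow> real" where
  "normalize_mat A j k = A $$ (j, k) / sqrt (A $$ (j, j) * A $$ (k, k))"

definition data_space :: "nat \<Rightarrow> ((nat \<Rightarrow> real) \<times> real) measure" where
  "data_space p = (\<Pi>\<^sub>M j\<in>{..<p}. borel) \<Otimes>\<^sub>M borel"

text \<open>\<^term>\<open>indep_vars\<close> includes the measurability of the data.\<close>
definition iid_data ::
  "'w measure \<Rightarrow> nat \<Rightarrow> nat \<Rightarrow> (nat \<Rightarrow> 'w \<Rightarrow> rvec) \<Rightarrow> (nat \<Rightarrow> 'w \<Rightarrow> real) \<Rightarrow> bool" where
  "iid_data M p n X Y \<longleftrightarrow>
     prob_space M \<and>
     (\<forall>i<n. \<forall>\<omega>\<in>space M. X i \<omega> \<in> carrier_vec p) \<and>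
     (let D = (\<lambda>i \<omega>. (\<lambda>j\<in>{..<p}. X i \<omega> $ j, Y i \<omega>)) in
        prob_space.indep_vars M (\<lambda>_. data_space p) D {..<n} \<and>
        (\<forall>i<n. distr M (data_space p) (D i) = distr M (data_space p) (D 0)))"

definition covariate_algebra ::
  "'w measure \<Rightarrow> nat \<Rightarrow> (nat \<Rightarrow> 'w \<Rightarrow> rvec) \<Rightarrow> nat set \<Rightarrow> 'w measure" where
  "covariate_algebra M p X I =
     vimage_algebra (space M) (\<lambda>\<omega>. \<lambda>i\<in>I. \<lambda>j\<in>{..<p}. X i \<omega> $ j)
       (\<Pi>\<^sub>M i\<in>I. \<Pi>\<^sub>M j\<in>{..<p}. borel)"

definition second_moment_mat :: "'w measure \<Rightarrow> nat \<Rightarrow> ('w \<Rightarrow> rvec) \<Rightarrow> rmat" where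
  "second_moment_mat M p X = Matrix.mat p p (\<lambda>(j, k). \<integral>\<omega>. X \<omega> $ j * X \<omega> $ k \<partial>M)"

definition information_mat ::
  "(real \<Rightarrow> real) \<Rightarrow> 'w measure \<Rightarrow> nat \<Rightarrow> ('w \<Rightarrow> rvec) \<Rightarrow> rvec \<Rightarrow> rmat" where
  "information_mat b M p X \<beta> =
     Matrix.mat p p (\<lambda>(j, k). \<integral>\<omega>. X \<omega> $ j * X \<omega> $ k * deriv (deriv b) (X \<omega> \<bullet> \<beta>) \<partial>M)"

text \<open>
  The moments of nonnegative variables are taken with \<^const>\<open>nn_cond_exp\<close>: \<^const>\<open>real_cond_exp\<close>
  collapses an infinite conditional expectation to \<open>0\<close>.
\<close>

definition cond_variance :: "'w measure \<Rightarrow> 'w measure \<Rightarrow> ('w \<Rightarrow> real) \<Rightarrow> 'w \<Rightarrow> ennreal" where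
  "cond_variance M F Z = nn_cond_exp M F (\<lambda>\<omega>. ennreal ((Z \<omega> - real_cond_exp M F Z \<omega>)\<^sup>2))"

definition cond_indep ::
  "'w measure \<Rightarrow> 'w measure \<Rightarrow> (nat \<Rightarrow> 'w \<Rightarrow> real) \<Rightarrow> nat set \<Rightarrow> bool" where
  "cond_indep M F Z I \<longleftrightarrow>
     (\<forall>A. (\<forall>i\<in>I. A i \<in> sets borel) \<longrightarrow>
        (AE \<omega> in M. real_cond_exp M F (\<lambda>\<omega>. \<Prod>i\<in>I. indicator (A i) (Z i \<omega>)) \<omega>
                   = (\<Prod>i\<in>I. real_cond_exp M F (\<lambda>\<omega>. indicator (A i) (Z i \<omega>)) \<omega>)))"

text \<open>The conditional law is almost surely not a point mass; its location may depend on the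
  conditioning.\<close>
definition cond_nondegenerate :: "'w measure \<Rightarrow> 'w measure \<Rightarrow> ('w \<Rightarrow> real) \<Rightarrow> bool" where
  "cond_nondegenerate M F Z \<longleftrightarrow>
     (\<forall>c \<in> borel_measurable F.
        AE \<omega> in M. real_cond_exp M F (\<lambda>\<omega>. if Z \<omega> = c \<omega> then 1 else 0) \<omega> < 1)"

definition cond_subgaussian ::
  "'w measure \<Rightarrow> 'w measure \<Rightarrow> ('w \<Rightarrow> real) \<Rightarrow> ('w \<Rightarrow> real) \<Rightarrow> bool" where
  "cond_subgaussian M F Z v \<longleftrightarrow>
     integrable M Z \<and> (AE \<omega> in M. real_cond_exp M F Z \<omega> = 0) \<and>
     (\<forall>s. AE \<omega> in M. nn_cond_exp M F (\<lambda>\<omega>. ennreal (exp (s * Z \<omega>))) \<omega>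
                      \<le> ennreal (exp (v \<omega> * s\<^sup>2 / 2)))"

definition loglik ::
  "(real \<Rightarrow> real) \<Rightarrow> nat \<Rightarrow> (nat \<Rightarrow> rvec) \<Rightarrow> (nat \<Rightarrow> real) \<Rightarrow> rvec \<Rightarrow> real" where
  "loglik b n x y \<beta> = (\<Sum>i<n. y i * (x i \<bullet> \<beta>) - b (x i \<bullet> \<beta>)) / real n"

definition score ::
  "(real \<Rightarrow> real) \<Rightarrow> nat \<Rightarrow> nat \<Rightarrow> (nat \<Rightarrow> rvec) \<Rightarrow> (nat \<Rightarrow> real) \<Rightarrow> rvec \<Rightarrow> rvec" where
  "score b p n x y \<beta> =
     Matrix.vec p (\<lambda>j. (\<Sum>i<n. x i $ j * (y i - deriv b (x i \<bullet> \<beta>))) / real n)"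

definition sample_information_mat ::
  "(real \<Rightarrow> real) \<Rightarrow> nat \<Rightarrow> nat \<Rightarrow> (nat \<Rightarrow> rvec) \<Rightarrow> rvec \<Rightarrow> rmat" where
  "sample_information_mat b p n x \<beta> =
     Matrix.mat p p (\<lambda>(j, k). (\<Sum>i<n. x i $ j * x i $ k * deriv (deriv b) (x i \<bullet> \<beta>)) / real n)"

definition is_lasso ::
  "(real \<Rightarrow> real) \<Rightarrow> nat \<Rightarrow> nat \<Rightarrow> (nat \<Rightarrow> rvec) \<Rightarrow> (nat \<Rightarrow> real) \<Rightarrow> real \<Rightarrow> rvec \<Rightarrow> bool" where
  "is_lasso b p n x y lam \<beta> \<longleftrightarrow>
     is_arg_min (\<lambda>\<beta>'. - loglik b n x y \<beta>' + lam * l1_norm \<beta>') (\<lambda>\<beta>'. \<beta>' \<in> carrier_vec p) \<beta>"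

text \<open>The \<open>j\<close>-th minimiser is the \<open>j\<close>-th row of the matrix.\<close>
definition is_clime :: "nat \<Rightarrow> rmat \<Rightarrow> real \<Rightarrow> rmat \<Rightarrow> bool" where
  "is_clime p A mu T \<longleftrightarrow>
     T \<in> carrier_mat p p \<and>
     (\<forall>j<p. is_arg_min l1_norm
        (\<lambda>w. w \<in> carrier_vec p \<and> linf_norm (A *\<^sub>v w - unit_vec p j) \<le> mu) (Matrix.row T j))"

definition debiased ::
  "(real \<Rightarrow> real) \<Rightarrow> nat \<Rightarrow> nat \<Rightarrow> (nat \<Rightarrow> rvec) \<Rightarrow> (nat \<Rightarrow> real) \<Rightarrow> rvec \<Rightarrow> rmat \<Rightarrow> rvec" where
  "debiased b p n x y \<beta> T = \<beta> + T *\<^sub>v score b p n x y \<beta>"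

definition test_stat ::
  "(real \<Rightarrow> real) \<Rightarrow> nat \<Rightarrow> nat \<Rightarrow> (nat \<Rightarrow> rvec) \<Rightarrow> (nat \<Rightarrow> real) \<Rightarrow> rvec \<Rightarrow> rmat \<Rightarrow> nat \<Rightarrow> real" where
  "test_stat b p n x y \<beta> T j = sqrt (real n) * (debiased b p n x y \<beta> T $ j) / sqrt (T $$ (j, j))"

definition normal_tail :: "real \<Rightarrow> real" where
  "normal_tail t = 2 - 2 * cdf std_normal_distribution t"

definition gmt_cutoff :: "nat \<Rightarrow> real" where
  "gmt_cutoff p = sqrt (2 * ln (real p) - 2 * ln (ln (real p)))"

definition gmt_admissible :: "real \<Rightarrow> nat \<Rightarrow> (nat \<Rightarrow> real) \<Rightarrow> real set" where
  "gmt_admissible \<alpha> p T = {t. 0 \<le> t \<and> t \<le> gmt_cutoff p \<and>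
     real p * normal_tail t / real (max (card {j. j < p \<and> t \<le> \<bar>T j\<bar>}) 1) \<le> \<alpha>}"

definition gmt_threshold :: "real \<Rightarrow> nat \<Rightarrow> (nat \<Rightarrow> real) \<Rightarrow> real" where
  "gmt_threshold \<alpha> p T =
     (if gmt_admissible \<alpha> p T = {} then sqrt (2 * ln (real p)) else Inf (gmt_admissible \<alpha> p T))"

definition gmt_selected :: "real \<Rightarrow> nat \<Rightarrow> (nat \<Rightarrow> real) \<Rightarrow> nat set" where
  "gmt_selected \<alpha> p T = {j. j < p \<and> gmt_threshold \<alpha> p T \<le> \<bar>T j\<bar>}"

definition support :: "nat \<Rightarrow> rvec \<Rightarrow> nat set" where
  "support p \<beta> = {j. j < p \<and> \<beta> $ j \<noteq> 0}"

definition directional_power ::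
  "'w measure \<Rightarrow> real \<Rightarrow> nat \<Rightarrow> rvec \<Rightarrow> ('w \<Rightarrow> nat \<Rightarrow> real) \<Rightarrow> real" where
  "directional_power M \<alpha> p \<beta>0 T =
     (\<integral>\<omega>. real (card {j \<in> gmt_selected \<alpha> p (T \<omega>). sgn (T \<omega> j) = sgn (\<beta>0 $ j)})
            / real (max (card (support p \<beta>0)) 1) \<partial>M)"

end

theory Submission
  imports Defs "HOL-Real_Asymp.Real_Asymp"
begin

text \<open>
  No Gaussian approximation is needed: power only requires each single signal to be detected with
  probability tending to one, and Markov's inequality then controls the expected fraction of missed
  signals. With \<open>h = sqrt (log p / n)\<close>, on an event of probability at least \<open>1 - 4 / p\<close> the score
  and the sample information at the true parameter deviate from their means by \<open>O(h)\<close> in maximum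
  norm. On it the Lasso has \<open>\<ell>\<^sub>1\<close> error \<open>t = O(s\<^sub>0 h)\<close>: by convexity it suffices to exclude errors of
  norm exactly \<open>t\<close>, where the cubic Taylor remainder is negligible and the eigenvalue bound on the
  population information controls the curvature. The CLIME rows then have maximum-norm error
  \<open>2 \<parallel>\<Theta>\<parallel> \<mu>\<close>, and every remainder in \<open>T\<^sub>j\<close> is a constant multiple of
  \<open>q = s\<^sub>0\<^sup>2 (log p)\<^sup>3\<^sup>/\<^sup>2 / sqrt n\<close>, which tends to \<open>0\<close>. The remaining noise has variance one after
  studentization, so Chebyshev's inequality bounds it for each \<open>j\<close>. Finally, if half of the signals
  exceed \<open>u + 2\<close> with \<open>u = sqrt (2 log (2 p / (\<alpha> s\<^sub>0)))\<close>, then the threshold is at most \<open>u + 3\<close>, since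
  \<open>G(t) \<le> 2 exp (- t\<^sup>2 / 2)\<close> and the fallback value is at most \<open>1\<close> above the cutoff; and \<open>beta_min\<close>
  puts the signals arbitrarily far beyond \<open>u\<close>.
\<close>

section \<open>Smooth convex losses and the Lasso\<close>

text \<open>The rate \<open>q\<close> is \<open>sqrt n * sqrt (log p) * (s0 * h)\<^sup>2\<close>:
  the bias of the debiased estimator is a product of two errors of size \<open>s0 * h\<close>, the
  inverse matrix contributes at most a constant times \<open>sqrt (log p)\<close>, and the statistic
  is scaled by \<open>sqrt n\<close>. The growth condition on \<open>s0\<close> makes even
  \<open>s0\<^sup>2 * (log p)\<^sup>2 / sqrt n\<close> vanish, which leaves half a logarithm to
  spare. Two obstacles shape the development. First, \<open>b''\<close> is Lipschitz only between
  points at distance at most \<open>R\<close>, so the loss cannot be expanded at an arbitrary Lasso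
  solution; convexity has to confine the solution to a ball of radius \<open>t\<close> with
  \<open>L * t \<le> R\<close> beforehand. Second, the threshold is an infimum over uncountably many
  random levels, and its measurability has to be proved, since the Bochner integral of a
  nonmeasurable function is 0 by convention and the power would then say nothing. Accordingly
  \<open>glm_sample\<close> is purely deterministic and concerns one outcome,
  \<open>glm_data\<close> adds the probability at one sample size under numerical side conditions,
  and limits appear only at the very end.\<close>

locale glm_loss =
  fixes b :: "real \<Rightarrow> real" and R C :: real
  assumes diff1: "\<And>u. b differentiable at u"
    and diff2: "\<And>u. deriv b differentiable at u"
    and convex: "convex_on UNIV b"
    and R_pos: "R > 0"
    and lipschitz: "\<And>u u'. \<bar>u - u'\<bar> \<le> R \<Longrightarrow>
      \<bar>deriv (deriv b) u - deriv (deriv b) u'\<bar> \<le> C * \<bar>u - u'\<bar>"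
begin

abbreviation b'' :: "real \<Rightarrow> real" where "b'' \<equiv> deriv (deriv b)"

lemma C_nonneg: "0 \<le> C"
proof -
  have "0 \<le> \<bar>b'' R - b'' 0\<bar>" by simp
  also have "\<dots> \<le> C * \<bar>R - 0\<bar>" using lipschitz[of R 0] R_pos by simp
  finally show ?thesis using R_pos by (simp add: zero_le_mult_iff)
qed

lemma has_deriv1: "(b has_real_derivative deriv b u) (at u)"
  using diff1 by (metis DERIV_deriv_iff_real_differentiable)

lemma has_deriv2: "(deriv b has_real_derivative b'' u) (at u)"
  using diff2 by (metis DERIV_deriv_iff_real_differentiable)

lemma continuous_deriv1: "continuous_on A (deriv b)"
  by (meson DERIV_isCont continuous_at_imp_continuous_on has_deriv2)

lemma continuous_deriv2: "continuous_on A (b'')"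
proof -
  have "isCont (b'') u" for u
    unfolding isCont_def
  proof (rule metric_LIM_I)
    fix e :: real assume "0 < e"
    \<comment> \<open>\<open>C + 1\<close> instead of \<open>C\<close> keeps the quotient meaningful
      when \<open>C = 0\<close>; the cap \<open>R\<close> makes the local Lipschitz bound
      applicable.\<close>
    define s where "s = min R (e / (C + 1))"
    have "s > 0" using R_pos \<open>0 < e\<close> C_nonneg by (simp add: s_def)
    moreover have "dist (b'' v) (b'' u) < e"
      if "v \<noteq> u" "dist v u < s" for v
    proof -
      have "\<bar>v - u\<bar> \<le> R" "\<bar>v - u\<bar> < e / (C + 1)" using that by (auto simp: dist_real_def s_def)
      from lipschitz[OF this(1)]
      have "\<bar>b'' v - b'' u\<bar> \<le> (C + 1) * \<bar>v - u\<bar>"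
        by (simp add: algebra_simps)
      also have "\<dots> < (C + 1) * (e / (C + 1))"
        using \<open>\<bar>v - u\<bar> < e / (C + 1)\<close> C_nonneg by (intro mult_strict_left_mono) auto
      also have "\<dots> = e" using C_nonneg by simp
      finally show ?thesis by (simp add: dist_real_def)
    qed
    ultimately show "\<exists>s>0. \<forall>v. v \<noteq> u \<and> dist v u < s \<longrightarrow>
        dist (b'' v) (b'' u) < e" by blast
  qed
  then show ?thesis by (simp add: continuous_at_imp_continuous_on)
qed

lemma loss_measurable [measurable]:
  "b \<in> borel_measurable borel" "deriv b \<in> borel_measurable borel"
  "b'' \<in> borel_measurable borel"
proof -
  have "continuous_on UNIV b"
    by (meson DERIV_isCont continuous_at_imp_continuous_on has_deriv1)
  then show "b \<in> borel_measurable borel" by (rule borel_measurable_continuous_onI)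
qed (rule borel_measurable_continuous_onI continuous_deriv1 continuous_deriv2)+

text \<open>Continuity on a compact interval is the source of every bound on \<open>b''\<close>. It
  is used with \<open>A\<close> the range of the true linear predictors, so the resulting constant
  serves all sample sizes at once.\<close>

lemma deriv2_bounded:
  obtains D where "D > 0" "\<And>u. \<bar>u\<bar> \<le> A \<Longrightarrow> \<bar>b'' u\<bar> \<le> D"
proof -
  have "bounded (b'' ` {-A..A})"
    by (intro compact_imp_bounded compact_continuous_image continuous_deriv2) auto
  then obtain D where D: "D > 0" "\<forall>z\<in>b'' ` {-A..A}. norm z \<le> D"
    unfolding bounded_pos by blast
  show ?thesis by (rule that[OF D(1)]) (use D(2) in \<open>auto simp: abs_le_iff\<close>)
qed

text \<open>The Lagrange remainder evaluates \<open>b''\<close> at a point within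
  \<open>\<bar>h\<bar>\<close> of \<open>u\<close>, so replacing it by \<open>b'' u\<close> costs at
  most \<open>C * \<bar>h\<bar>\<close>. The lower side is what bounds the curvature of the loss
  around the true parameter.\<close>

lemma loss_remainder_lower:
  assumes "\<bar>h\<bar> \<le> R"
  shows "b'' u * h\<^sup>2 / 2 - C * \<bar>h\<bar> ^ 3 / 2 \<le> b (u + h) - b u - deriv b u * h"
proof (cases "h = 0")
  case False
  define dd where "dd = (\<lambda>m::nat. if m = 0 then b else if m = 1 then deriv b else b'')"
  have "\<exists>t. (if u + h < u then u + h < t \<and> t < u else u < t \<and> t < u + h) \<and>
      b (u + h) = (\<Sum>m<2. (dd m u / fact m) * (u + h - u)^m) + (dd 2 t / fact 2) * (u + h - u)^2"
    by (rule Taylor[where a = "min u (u + h)" and b = "max u (u + h)"])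
      (use False has_deriv1 has_deriv2 in \<open>auto simp: dd_def less_2_cases_iff\<close>)
  then obtain t where t: "if u + h < u then u + h < t \<and> t < u else u < t \<and> t < u + h"
    and eq: "b (u + h) = (\<Sum>m<2. (dd m u / fact m) * (u + h - u)^m) + (dd 2 t / fact 2) * (u + h - u)^2"
    by blast
  have eq': "b (u + h) = b u + deriv b u * h + b'' t * h\<^sup>2 / 2"
    using eq by (simp add: dd_def numeral_2_eq_2)
  have tu: "\<bar>t - u\<bar> \<le> \<bar>h\<bar>" using t by (auto split: if_splits)
  have "\<bar>b'' t - b'' u\<bar> \<le> C * \<bar>t - u\<bar>"
    using tu assms by (intro lipschitz) auto
  also have "\<dots> \<le> C * \<bar>h\<bar>" using tu C_nonneg by (intro mult_left_mono) auto
  finally have "b'' u - C * \<bar>h\<bar> \<le> b'' t" by linarith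
  then have "(b'' u - C * \<bar>h\<bar>) * h\<^sup>2 / 2 \<le> b'' t * h\<^sup>2 / 2"
    by (intro divide_right_mono mult_right_mono) auto
  moreover have "\<bar>h\<bar> * h\<^sup>2 = \<bar>h\<bar> ^ 3" by (simp add: power3_eq_cube power2_eq_square abs_mult_self_eq mult.assoc)
  ultimately show ?thesis unfolding eq' by (simp add: algebra_simps)
qed simp

lemma deriv_remainder:
  assumes "\<bar>h\<bar> \<le> R"
  shows "\<bar>deriv b (u + h) - deriv b u - b'' u * h\<bar> \<le> C * h\<^sup>2"
proof -
  \<comment> \<open>Here \<open>u\<close> is any point of the interval, so that \<open>h > 0\<close>
    (with \<open>u\<close> the left end) and \<open>h < 0\<close> (with \<open>u\<close> the right
    end) are instances of one claim.\<close>
  have main: "\<bar>deriv b w - deriv b v - b'' u * (w - v)\<bar> \<le> C * (w - v)\<^sup>2"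
    if "v < w" "w - v \<le> R" "v \<le> u" "u \<le> w" for v w
  proof -
    obtain z where z: "v < z" "z < w" "deriv b w - deriv b v = (w - v) * b'' z"
      using MVT2[OF \<open>v < w\<close>, of "deriv b" "b''"] has_deriv2 by blast
    have "\<bar>b'' z - b'' u\<bar> \<le> C * \<bar>z - u\<bar>"
      using that z by (intro lipschitz) auto
    also have "\<dots> \<le> C * (w - v)" using C_nonneg z that by (intro mult_left_mono) auto
    finally have "(w - v) * \<bar>b'' z - b'' u\<bar> \<le> (w - v) * (C * (w - v))"
      using that by (intro mult_left_mono) auto
    moreover have "deriv b w - deriv b v - b'' u * (w - v)
        = (w - v) * (b'' z - b'' u)"
      using z by (simp add: algebra_simps)
    ultimately have "\<bar>deriv b w - deriv b v - b'' u * (w - v)\<bar> \<le> (w - v) * (C * (w - v))"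
      using that by (simp add: abs_mult)
    then show ?thesis by (simp add: power2_eq_square mult_ac)
  qed
  consider "h = 0" | "h > 0" | "h < 0" by linarith
  then show ?thesis
  proof cases
    case 2 then show ?thesis using main[of u "u + h"] assms by simp
  next
    case 3
    have "\<bar>deriv b u - deriv b (u + h) - b'' u * (u - (u + h))\<bar> \<le> C * (u - (u + h))\<^sup>2"
      using main[of "u + h" u] assms 3 by simp
    moreover have "deriv b u - deriv b (u + h) - b'' u * (u - (u + h))
        = - (deriv b (u + h) - deriv b u - b'' u * h)" by (simp add: algebra_simps)
    ultimately show ?thesis by (simp only: abs_minus_cancel) simp
  qed simp
qed

lemma loss_tangent: "b u + deriv b u * h \<le> b (u + h)"
proof -
  have "b (u + h) - b u \<ge> deriv b u * (u + h - u)"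
    by (rule convex_on_imp_above_tangent[OF convex])
      (auto intro: has_deriv1)
  then show ?thesis by simp
qed

end

section \<open>Hoelder and Cauchy-Schwarz bounds for sums and quadratic forms\<close>

lemma abs_sum_mult_le:
  fixes f g :: "nat \<Rightarrow> real"
  assumes "\<And>j. j < p \<Longrightarrow> \<bar>f j\<bar> \<le> c"
  shows "\<bar>\<Sum>j<p. f j * g j\<bar> \<le> c * (\<Sum>j<p. \<bar>g j\<bar>)"
proof -
  have "\<bar>\<Sum>j<p. f j * g j\<bar> \<le> (\<Sum>j<p. \<bar>f j\<bar> * \<bar>g j\<bar>)"
    using sum_abs[of "\<lambda>j. f j * g j"] by (simp add: abs_mult)
  also have "\<dots> \<le> (\<Sum>j<p. c * \<bar>g j\<bar>)" using assms by (intro sum_mono mult_right_mono) auto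
  finally show ?thesis by (simp add: sum_distrib_left)
qed

lemma abs_quadratic_form_le:
  fixes A :: "nat \<Rightarrow> nat \<Rightarrow> real"
  assumes "\<And>j k. j < p \<Longrightarrow> k < p \<Longrightarrow> \<bar>A j k\<bar> \<le> c" "0 \<le> c"
  shows "\<bar>\<Sum>j<p. \<Sum>k<p. z j * A j k * z k\<bar> \<le> c * (\<Sum>j<p. \<bar>z j\<bar>)\<^sup>2"
proof -
  have "\<bar>\<Sum>j<p. \<Sum>k<p. z j * A j k * z k\<bar> = \<bar>\<Sum>j<p. (\<Sum>k<p. A j k * z k) * z j\<bar>"
    by (simp add: sum_distrib_left mult_ac)
  also have "\<dots> \<le> (c * (\<Sum>j<p. \<bar>z j\<bar>)) * (\<Sum>j<p. \<bar>z j\<bar>)"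
    by (intro abs_sum_mult_le) (use assms in auto)
  finally show ?thesis by (simp add: power2_eq_square)
qed

lemma sum_abs_le_sqrt_card:
  fixes z :: "'a \<Rightarrow> real"
  shows "(\<Sum>j\<in>J. \<bar>z j\<bar>)\<^sup>2 \<le> card J * (\<Sum>j\<in>J. (z j)\<^sup>2)"
  using Cauchy_Schwarz_ineq_sum[of "\<lambda>_. 1" "\<lambda>j. \<bar>z j\<bar>" J] by simp

text \<open>The data of one outcome are frozen here. Vectors are functions of which only the first
  \<open>p\<close> values count, so that no carrier conditions arise before the results are
  applied.\<close>

locale glm_sample = glm_loss +
  fixes p n :: nat and X :: "nat \<Rightarrow> nat \<Rightarrow> real" and y :: "nat \<Rightarrow> real" and L :: real
  assumes X_bounded: "\<And>i j. i < n \<Longrightarrow> j < p \<Longrightarrow> \<bar>X i j\<bar> \<le> L"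
    and n_pos: "n > 0" and L_pos: "L > 0"
begin

definition lin :: "nat \<Rightarrow> (nat \<Rightarrow> real) \<Rightarrow> real" where
  "lin i \<beta> = (\<Sum>j<p. X i j * \<beta> j)"

definition neg_loglik :: "(nat \<Rightarrow> real) \<Rightarrow> real" where
  "neg_loglik \<beta> = - ((\<Sum>i<n. y i * lin i \<beta> - b (lin i \<beta>)) / n)"

text \<open>The gradient of the log-likelihood, that is, minus the gradient of
  \<open>neg_loglik\<close>; hence the signs in \<open>neg_loglik_expansion\<close> and
  \<open>grad_linearization\<close>.\<close>

definition grad :: "(nat \<Rightarrow> real) \<Rightarrow> nat \<Rightarrow> real" where
  "grad \<beta> j = (\<Sum>i<n. X i j * (y i - deriv b (lin i \<beta>))) / n"

text \<open>The Hessian of \<open>neg_loglik\<close>: the responses enter the loss linearly and drop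
  out, so it is a function of the covariates alone.\<close>

definition hess :: "(nat \<Rightarrow> real) \<Rightarrow> nat \<Rightarrow> nat \<Rightarrow> real" where
  "hess \<beta> j k = (\<Sum>i<n. X i j * X i k * b'' (lin i \<beta>)) / n"

lemma lin_add: "lin i (\<lambda>j. \<beta> j + \<delta> j) = lin i \<beta> + lin i \<delta>"
  by (simp add: lin_def distrib_left sum.distrib)

lemma abs_lin_le: "i < n \<Longrightarrow> \<bar>lin i \<delta>\<bar> \<le> L * (\<Sum>j<p. \<bar>\<delta> j\<bar>)"
  unfolding lin_def by (intro abs_sum_mult_le X_bounded) auto

lemma hess_quadratic_form:
  "(\<Sum>j<p. \<Sum>k<p. z j * hess \<beta> j k * z k) = (\<Sum>i<n. b'' (lin i \<beta>) * (lin i z)\<^sup>2) / n"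
proof -
  have "(\<Sum>i<n. b'' (lin i \<beta>) * (lin i z)\<^sup>2)
      = (\<Sum>i<n. \<Sum>j<p. \<Sum>k<p. z j * (X i j * X i k * b'' (lin i \<beta>)) * z k)"
    by (simp add: lin_def power2_eq_square sum_product sum_distrib_left mult_ac)
  also have "\<dots> = (\<Sum>j<p. \<Sum>k<p. \<Sum>i<n. z j * (X i j * X i k * b'' (lin i \<beta>)) * z k)"
    by (subst sum.swap) (intro sum.cong refl sum.swap)
  finally show ?thesis
    by (simp add: hess_def sum_distrib_left sum_distrib_right sum_divide_distrib mult_ac)
qed

lemma grad_sum: "(\<Sum>j<p. z j * grad \<beta> j) = (\<Sum>i<n. lin i z * (y i - deriv b (lin i \<beta>))) / n"
proof -
  have "(\<Sum>i<n. lin i z * (y i - deriv b (lin i \<beta>)))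
      = (\<Sum>i<n. \<Sum>j<p. z j * (X i j * (y i - deriv b (lin i \<beta>))))"
    by (simp add: lin_def sum_distrib_right mult_ac)
  also have "\<dots> = (\<Sum>j<p. \<Sum>i<n. z j * (X i j * (y i - deriv b (lin i \<beta>))))"
    by (rule sum.swap)
  finally show ?thesis by (simp add: grad_def sum_distrib_left sum_divide_distrib)
qed

definition bregman :: "(nat \<Rightarrow> real) \<Rightarrow> (nat \<Rightarrow> real) \<Rightarrow> real" where
  "bregman \<beta> \<delta> = (\<Sum>i<n. b (lin i \<beta> + lin i \<delta>) - b (lin i \<beta>) - deriv b (lin i \<beta>) * lin i \<delta>) / n"

lemma neg_loglik_expansion:
  "neg_loglik (\<lambda>j. \<beta> j + \<delta> j) = neg_loglik \<beta> - (\<Sum>j<p. \<delta> j * grad \<beta> j) + bregman \<beta> \<delta>"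
  unfolding neg_loglik_def bregman_def grad_sum lin_add
  by (simp add: diff_divide_distrib add_divide_distrib sum_subtractf sum.distrib
      algebra_simps)

lemma bregman_nonneg: "0 \<le> bregman \<beta> \<delta>"
proof -
  have "0 \<le> b (lin i \<beta> + lin i \<delta>) - b (lin i \<beta>) - deriv b (lin i \<beta>) * lin i \<delta>" for i
    using loss_tangent[of "lin i \<beta>" "lin i \<delta>"] by linarith
  then show ?thesis unfolding bregman_def by (intro divide_nonneg_nonneg sum_nonneg) auto
qed

text \<open>An l1 error of at most \<open>t\<close> moves every linear predictor by at most
  \<open>L * t\<close>, so the cubic remainders of all observations share one bound, and averaging
  leaves the quadratic form of the Hessian.\<close>

lemma bregman_lower:
  assumes "L * t \<le> R" "(\<Sum>j<p. \<bar>\<delta> j\<bar>) \<le> t"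
  shows "(\<Sum>j<p. \<Sum>k<p. \<delta> j * hess \<beta> j k * \<delta> k) / 2 - C * (L * t) ^ 3 / 2 \<le> bregman \<beta> \<delta>"
proof -
  have h: "\<bar>lin i \<delta>\<bar> \<le> L * t" if "i < n" for i
    using abs_lin_le[OF that, of \<delta>] assms L_pos
    by (meson mult_left_mono order_trans less_imp_le)
  have "(\<Sum>i<n. b'' (lin i \<beta>) * (lin i \<delta>)\<^sup>2 / 2 - C * (L * t) ^ 3 / 2)
      \<le> (\<Sum>i<n. b (lin i \<beta> + lin i \<delta>) - b (lin i \<beta>) - deriv b (lin i \<beta>) * lin i \<delta>)"
  proof (rule sum_mono)
    fix i assume i: "i \<in> {..<n}"
    have "C * \<bar>lin i \<delta>\<bar> ^ 3 \<le> C * (L * t) ^ 3"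
      using h i C_nonneg by (intro mult_left_mono power_mono) auto
    then show "b'' (lin i \<beta>) * (lin i \<delta>)\<^sup>2 / 2 - C * (L * t) ^ 3 / 2
        \<le> b (lin i \<beta> + lin i \<delta>) - b (lin i \<beta>) - deriv b (lin i \<beta>) * lin i \<delta>"
      using loss_remainder_lower[of "lin i \<delta>" "lin i \<beta>"] h[of i] i assms by auto
  qed
  then have "(\<Sum>i<n. b'' (lin i \<beta>) * (lin i \<delta>)\<^sup>2 / 2 - C * (L * t) ^ 3 / 2) / n
      \<le> bregman \<beta> \<delta>"
    unfolding bregman_def by (intro divide_right_mono) auto
  moreover have "(\<Sum>i<n. b'' (lin i \<beta>) * (lin i \<delta>)\<^sup>2 / 2 - C * (L * t) ^ 3 / 2) / n
      = (\<Sum>j<p. \<Sum>k<p. \<delta> j * hess \<beta> j k * \<delta> k) / 2 - C * (L * t) ^ 3 / 2"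
    unfolding hess_quadratic_form using n_pos
    by (simp add: sum_subtractf diff_divide_distrib sum_divide_distrib[symmetric])
  ultimately show ?thesis by simp
qed

lemma neg_loglik_segment:
  assumes "0 \<le> \<theta>" "\<theta> \<le> 1"
  shows "neg_loglik (\<lambda>j. \<beta> j + \<theta> * \<delta> j)
    \<le> (1 - \<theta>) * neg_loglik \<beta> + \<theta> * neg_loglik (\<lambda>j. \<beta> j + \<delta> j)"
proof -
  have l: "lin i (\<lambda>j. \<beta> j + \<theta> * \<delta> j) = (1 - \<theta>) * lin i \<beta> + \<theta> * lin i (\<lambda>j. \<beta> j + \<delta> j)" for i
    unfolding lin_def
    by (simp add: sum_distrib_left sum.distrib[symmetric] algebra_simps)
  have bi: "b (lin i (\<lambda>j. \<beta> j + \<theta> * \<delta> j))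
      \<le> (1 - \<theta>) * b (lin i \<beta>) + \<theta> * b (lin i (\<lambda>j. \<beta> j + \<delta> j))" for i
    unfolding l using convex_onD[OF convex, of \<theta> "lin i \<beta>" "lin i (\<lambda>j. \<beta> j + \<delta> j)"] assms by simp
  have "(1 - \<theta>) * (\<Sum>i<n. y i * lin i \<beta> - b (lin i \<beta>))
      + \<theta> * (\<Sum>i<n. y i * lin i (\<lambda>j. \<beta> j + \<delta> j) - b (lin i (\<lambda>j. \<beta> j + \<delta> j)))
      = (\<Sum>i<n. (1 - \<theta>) * (y i * lin i \<beta> - b (lin i \<beta>))
        + \<theta> * (y i * lin i (\<lambda>j. \<beta> j + \<delta> j) - b (lin i (\<lambda>j. \<beta> j + \<delta> j))))"
    by (simp add: sum_distrib_left sum.distrib)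
  also have "\<dots> \<le> (\<Sum>i<n. y i * lin i (\<lambda>j. \<beta> j + \<theta> * \<delta> j) - b (lin i (\<lambda>j. \<beta> j + \<theta> * \<delta> j)))"
  proof (rule sum_mono)
    fix i
    show "(1 - \<theta>) * (y i * lin i \<beta> - b (lin i \<beta>))
        + \<theta> * (y i * lin i (\<lambda>j. \<beta> j + \<delta> j) - b (lin i (\<lambda>j. \<beta> j + \<delta> j)))
        \<le> y i * lin i (\<lambda>j. \<beta> j + \<theta> * \<delta> j) - b (lin i (\<lambda>j. \<beta> j + \<theta> * \<delta> j))"
      using bi[of i] by (simp add: l algebra_simps)
  qed
  finally have "((1 - \<theta>) * (\<Sum>i<n. y i * lin i \<beta> - b (lin i \<beta>))
      + \<theta> * (\<Sum>i<n. y i * lin i (\<lambda>j. \<beta> j + \<delta> j) - b (lin i (\<lambda>j. \<beta> j + \<delta> j)))) / n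
      \<le> (\<Sum>i<n. y i * lin i (\<lambda>j. \<beta> j + \<theta> * \<delta> j) - b (lin i (\<lambda>j. \<beta> j + \<theta> * \<delta> j))) / n"
    by (intro divide_right_mono) auto
  then show ?thesis unfolding neg_loglik_def by (simp add: add_divide_distrib)
qed

text \<open>At l1 distance exactly \<open>t\<close> from \<open>\<beta>\<close> the Bregman
  divergence is at most \<open>3 / 2 * lam * t\<close> by optimality and at least half of
  \<open>(c / (16 * s) - \<eta>) * t\<^sup>2 - C * (L * t) ^ 3\<close> by curvature;
  \<open>num\<close> says that the two are incompatible. The score bound \<open>lam / 2\<close>
  yields the cone constant 3, hence \<open>t \<le> 4 * dJ\<close>; squaring and Cauchy-Schwarz on at
  most \<open>s\<close> coordinates give \<open>16 * s\<close>.\<close>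

lemma lasso_l1_error:
  fixes Sig :: "nat \<Rightarrow> nat \<Rightarrow> real"
  assumes opt: "neg_loglik \<beta>h + lam * (\<Sum>j<p. \<bar>\<beta>h j\<bar>) \<le> neg_loglik \<beta> + lam * (\<Sum>j<p. \<bar>\<beta> j\<bar>)"
    and lam: "lam > 0" and score: "\<And>j. j < p \<Longrightarrow> \<bar>grad \<beta> j\<bar> \<le> lam / 2"
    and J: "J \<subseteq> {..<p}" "\<And>j. j < p \<Longrightarrow> j \<notin> J \<Longrightarrow> \<beta> j = 0" "card J \<le> s" "s > 0"
    and pd: "\<And>z. c * (\<Sum>j<p. (z j)\<^sup>2) \<le> (\<Sum>j<p. \<Sum>k<p. z j * Sig j k * z k)" and c: "c > 0"
    and close: "\<And>j k. j < p \<Longrightarrow> k < p \<Longrightarrow> \<bar>hess \<beta> j k - Sig j k\<bar> \<le> \<eta>"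
    and t: "t > 0" "L * t \<le> R"
    and num: "3 * lam * t < (c / (16 * s) - \<eta>) * t\<^sup>2 - C * (L * t) ^ 3"
  shows "(\<Sum>j<p. \<bar>\<beta>h j - \<beta> j\<bar>) \<le> t"
proof (rule ccontr)
  define dh where "dh = (\<lambda>j. \<beta>h j - \<beta> j)"
  define D where "D = (\<Sum>j<p. \<bar>dh j\<bar>)"
  assume "\<not> ?thesis"
  then have D: "D > t" by (simp add: D_def dh_def)
  \<comment> \<open>Selects the point of the segment from \<open>\<beta>\<close> to
    \<open>\<beta>h\<close> at distance exactly \<open>t\<close>; its penalised loss is at most that
    of \<open>\<beta>\<close>, because this is true of both ends.\<close>
  define \<theta> where "\<theta> = t / D"
  have th: "0 < \<theta>" "\<theta> \<le> 1" using D t by (auto simp: \<theta>_def)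
  define d where "d = (\<lambda>j. \<theta> * dh j)"
  have d1: "(\<Sum>j<p. \<bar>d j\<bar>) = t"
  proof -
    have "(\<Sum>j<p. \<bar>d j\<bar>) = \<theta> * D"
      using th by (simp add: d_def abs_mult sum_distrib_left D_def)
    then show ?thesis using D t by (simp add: \<theta>_def)
  qed
  have bh: "\<beta>h = (\<lambda>j. \<beta> j + dh j)" by (simp add: dh_def)
  have pen: "(\<Sum>j<p. \<bar>\<beta> j + d j\<bar>) \<le> (1 - \<theta>) * (\<Sum>j<p. \<bar>\<beta> j\<bar>) + \<theta> * (\<Sum>j<p. \<bar>\<beta>h j\<bar>)"
    unfolding sum_distrib_left sum.distrib[symmetric]
  proof (rule sum_mono)
    fix j
    have "\<beta> j + d j = (1 - \<theta>) * \<beta> j + \<theta> * \<beta>h j" by (simp add: d_def dh_def algebra_simps)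
    then show "\<bar>\<beta> j + d j\<bar> \<le> (1 - \<theta>) * \<bar>\<beta> j\<bar> + \<theta> * \<bar>\<beta>h j\<bar>"
      using abs_triangle_ineq[of "(1 - \<theta>) * \<beta> j" "\<theta> * \<beta>h j"] th by (simp add: abs_mult)
  qed
  have seg: "neg_loglik (\<lambda>j. \<beta> j + d j) \<le> (1 - \<theta>) * neg_loglik \<beta> + \<theta> * neg_loglik \<beta>h"
    unfolding d_def bh by (rule neg_loglik_segment) (use th in auto)
  have "neg_loglik (\<lambda>j. \<beta> j + d j) + lam * (\<Sum>j<p. \<bar>\<beta> j + d j\<bar>)
      \<le> (1 - \<theta>) * (neg_loglik \<beta> + lam * (\<Sum>j<p. \<bar>\<beta> j\<bar>)) + \<theta> * (neg_loglik \<beta>h + lam * (\<Sum>j<p. \<bar>\<beta>h j\<bar>))"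
    using seg mult_left_mono[OF pen, of lam] lam by (simp add: algebra_simps)
  also have "\<dots> \<le> neg_loglik \<beta> + lam * (\<Sum>j<p. \<bar>\<beta> j\<bar>)"
    using mult_left_mono[OF opt, of \<theta>] th by (simp add: algebra_simps)
  finally have basic: "bregman \<beta> d \<le> (\<Sum>j<p. d j * grad \<beta> j) + lam * ((\<Sum>j<p. \<bar>\<beta> j\<bar>) - (\<Sum>j<p. \<bar>\<beta> j + d j\<bar>))"
    unfolding neg_loglik_expansion by (simp add: algebra_simps)
  define dJ where "dJ = (\<Sum>j\<in>J. \<bar>d j\<bar>)"
  define dK where "dK = (\<Sum>j\<in>{..<p}-J. \<bar>d j\<bar>)"
  have split: "(\<Sum>j<p. f j) = (\<Sum>j\<in>J. f j) + (\<Sum>j\<in>{..<p}-J. f j)" for f :: "nat \<Rightarrow> real"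
    using J(1) by (metis add.commute finite_lessThan sum.subset_diff)
  have g: "(\<Sum>j<p. d j * grad \<beta> j) \<le> lam / 2 * (dJ + dK)"
    using abs_sum_mult_le[of p "grad \<beta>" "lam / 2" d] score split[of "\<lambda>j. \<bar>d j\<bar>"]
    by (simp add: dJ_def dK_def mult.commute)
  \<comment> \<open>Off \<open>J\<close> the true vector vanishes, so the penalty difference there
    is exactly \<open>- dK\<close>; on \<open>J\<close> the triangle inequality gives at most
    \<open>dJ\<close>.\<close>
  have "(\<Sum>j<p. \<bar>\<beta> j\<bar>) - (\<Sum>j<p. \<bar>\<beta> j + d j\<bar>) = (\<Sum>j<p. \<bar>\<beta> j\<bar> - \<bar>\<beta> j + d j\<bar>)"
    by (simp add: sum_subtractf)
  also have "\<dots> = (\<Sum>j\<in>J. \<bar>\<beta> j\<bar> - \<bar>\<beta> j + d j\<bar>) + (\<Sum>j\<in>{..<p}-J. \<bar>\<beta> j\<bar> - \<bar>\<beta> j + d j\<bar>)"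
    by (rule split)
  also have "(\<Sum>j\<in>{..<p}-J. \<bar>\<beta> j\<bar> - \<bar>\<beta> j + d j\<bar>) = - dK"
    unfolding dK_def sum_negf[symmetric] by (intro sum.cong) (use J in auto)
  also have "(\<Sum>j\<in>J. \<bar>\<beta> j\<bar> - \<bar>\<beta> j + d j\<bar>) \<le> dJ"
    unfolding dJ_def by (intro sum_mono) linarith
  finally have "lam * ((\<Sum>j<p. \<bar>\<beta> j\<bar>) - (\<Sum>j<p. \<bar>\<beta> j + d j\<bar>)) \<le> lam * (dJ - dK)"
    using lam by (intro mult_left_mono) auto
  with basic g have up: "bregman \<beta> d \<le> lam * (3 / 2 * dJ - dK / 2)" by (simp add: algebra_simps)
  \<comment> \<open>Nonnegativity of the divergence puts the error into the cone: its part off the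
    support is dominated by its part on the support.\<close>
  with bregman_nonneg[of \<beta> d] have "0 \<le> lam * (3 / 2 * dJ - dK / 2)" by linarith
  with lam have cone: "dK \<le> 3 * dJ" by (simp add: zero_le_mult_iff)
  have tJ: "t = dJ + dK" using d1 split[of "\<lambda>j. \<bar>d j\<bar>"] by (simp add: dJ_def dK_def)
  have "dK \<ge> 0" by (simp add: dK_def sum_nonneg)
  then have "lam * (3 / 2 * dJ - dK / 2) \<le> lam * (3 / 2 * t)"
    using lam tJ by (intro mult_left_mono) auto
  with up have up': "bregman \<beta> d \<le> 3 / 2 * lam * t" by simp
  have "t\<^sup>2 \<le> (4 * dJ)\<^sup>2" using cone tJ t by (intro power_mono) auto
  also have "\<dots> \<le> 16 * (card J * (\<Sum>j\<in>J. (d j)\<^sup>2))"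
    using sum_abs_le_sqrt_card[of d J] by (simp add: dJ_def power_mult_distrib)
  also have "\<dots> \<le> 16 * (s * (\<Sum>j<p. (d j)\<^sup>2))"
    using J by (intro mult_left_mono mult_mono sum_mono2) (auto intro: sum_nonneg)
  finally have "c / (16 * s) * t\<^sup>2 \<le> c * (\<Sum>j<p. (d j)\<^sup>2)"
    using c J by (simp add: field_simps)
  also have "\<dots> \<le> (\<Sum>j<p. \<Sum>k<p. d j * Sig j k * d k)" by (rule pd)
  finally have q1: "c / (16 * s) * t\<^sup>2 \<le> (\<Sum>j<p. \<Sum>k<p. d j * Sig j k * d k)" .
  have "0 \<le> \<eta>"
  proof -
    have "p > 0" using d1 t by (cases p) auto
    then show ?thesis using close[of 0 0] by linarith
  qed
  have "\<bar>\<Sum>j<p. \<Sum>k<p. d j * (hess \<beta> j k - Sig j k) * d k\<bar> \<le> \<eta> * t\<^sup>2"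
    using abs_quadratic_form_le[of p "\<lambda>j k. hess \<beta> j k - Sig j k" \<eta> d, OF close \<open>0 \<le> \<eta>\<close>] d1 by simp
  moreover have "(\<Sum>j<p. \<Sum>k<p. d j * (hess \<beta> j k - Sig j k) * d k)
      = (\<Sum>j<p. \<Sum>k<p. d j * hess \<beta> j k * d k) - (\<Sum>j<p. \<Sum>k<p. d j * Sig j k * d k)"
    by (simp add: sum_subtractf[symmetric] algebra_simps)
  ultimately have "(c / (16 * s) - \<eta>) * t\<^sup>2 \<le> (\<Sum>j<p. \<Sum>k<p. d j * hess \<beta> j k * d k)"
    using q1 by (simp add: algebra_simps)
  moreover have "(\<Sum>j<p. \<Sum>k<p. d j * hess \<beta> j k * d k) / 2 - C * (L * t) ^ 3 / 2 \<le> bregman \<beta> d"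
    by (rule bregman_lower) (use t d1 in auto)
  ultimately show False using up' num by linarith
qed

end

section \<open>CLIME and the debiased estimator\<close>

text \<open>\<open>Sig\<close> maps the row to a unit vector, so only \<open>A - Sig\<close> applied
  to the row remains. The true row is thus a competitor in the CLIME program, which bounds the l1
  norm of the minimiser.\<close>

lemma clime_feasible:
  fixes A Sig Th :: "nat \<Rightarrow> nat \<Rightarrow> real"
  assumes close: "\<And>i k. i < p \<Longrightarrow> k < p \<Longrightarrow> \<bar>A i k - Sig i k\<bar> \<le> \<eta>"
    and inv: "\<And>i j. i < p \<Longrightarrow> j < p \<Longrightarrow> (\<Sum>k<p. Sig i k * Th j k) = (if i = j then 1 else 0)"
    and row: "\<And>j. j < p \<Longrightarrow> (\<Sum>k<p. \<bar>Th j k\<bar>) \<le> N" and "0 \<le> \<eta>" "i < p" "j < p"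
  shows "\<bar>(\<Sum>k<p. A i k * Th j k) - (if i = j then 1 else 0)\<bar> \<le> \<eta> * N"
proof -
  have "\<bar>\<Sum>k<p. (A i k - Sig i k) * Th j k\<bar> \<le> \<eta> * (\<Sum>k<p. \<bar>Th j k\<bar>)"
    using close \<open>i < p\<close> by (intro abs_sum_mult_le) auto
  also have "\<dots> \<le> \<eta> * N" using assms by (intro mult_left_mono) auto
  finally show ?thesis using inv[OF \<open>i < p\<close> \<open>j < p\<close>]
    by (simp add: left_diff_distrib sum_subtractf)
qed

text \<open>Write \<open>w - Th j\<close> as \<open>Th\<close> applied to
  \<open>Sig (w - Th j)\<close>. The latter is \<open>(Sig - A) w\<close> plus the constraint
  residual \<open>A w - e_j\<close>, hence small in every coordinate, and a row of \<open>Th\<close>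
  amplifies it by at most \<open>N\<close>.\<close>

lemma clime_sup_error:
  fixes A Sig Th :: "nat \<Rightarrow> nat \<Rightarrow> real"
  assumes close: "\<And>i k. i < p \<Longrightarrow> k < p \<Longrightarrow> \<bar>A i k - Sig i k\<bar> \<le> \<eta>"
    and sym: "\<And>i k. i < p \<Longrightarrow> k < p \<Longrightarrow> Th i k = Th k i"
    and inv: "\<And>i j. i < p \<Longrightarrow> j < p \<Longrightarrow> (\<Sum>k<p. Sig i k * Th j k) = (if i = j then 1 else 0)"
    and sym_Sig: "\<And>i k. i < p \<Longrightarrow> k < p \<Longrightarrow> Sig i k = Sig k i"
    and row: "\<And>j. j < p \<Longrightarrow> (\<Sum>k<p. \<bar>Th j k\<bar>) \<le> N"
    and w: "(\<Sum>k<p. \<bar>w k\<bar>) \<le> N"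
    and feas: "\<And>i. i < p \<Longrightarrow> \<bar>(\<Sum>k<p. A i k * w k) - (if i = j then 1 else 0)\<bar> \<le> \<mu>"
    and "i < p" "j < p" "0 \<le> \<eta>" "0 \<le> \<mu>"
  shows "\<bar>w i - Th j i\<bar> \<le> N * (\<eta> * N + \<mu>)"
proof -
  define d where "d = (\<lambda>k. w k - Th j k)"
  have Sd: "\<bar>\<Sum>k<p. Sig l k * d k\<bar> \<le> \<eta> * N + \<mu>" if "l < p" for l
  proof -
    have "(\<Sum>k<p. Sig l k * d k)
        = (\<Sum>k<p. (Sig l k - A l k) * w k) + ((\<Sum>k<p. A l k * w k) - (if l = j then 1 else 0))"
      using inv[OF that \<open>j < p\<close>] by (simp add: d_def algebra_simps sum.distrib sum_subtractf)
    moreover have "\<bar>\<Sum>k<p. (Sig l k - A l k) * w k\<bar> \<le> \<eta> * (\<Sum>k<p. \<bar>w k\<bar>)"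
      using close that by (intro abs_sum_mult_le) (simp add: abs_minus_commute)
    moreover have "\<eta> * (\<Sum>k<p. \<bar>w k\<bar>) \<le> \<eta> * N" using w assms by (intro mult_left_mono) auto
    ultimately show ?thesis using feas[OF that] by linarith
  qed
  have "(\<Sum>l<p. (\<Sum>k<p. Sig l k * d k) * Th i l) = (\<Sum>k<p. \<Sum>l<p. Sig l k * d k * Th i l)"
    by (subst sum.swap) (simp add: sum_distrib_right)
  also have "\<dots> = (\<Sum>k<p. d k * (\<Sum>l<p. Sig k l * Th i l))"
    by (auto simp: sum_distrib_left mult_ac sym_Sig intro!: sum.cong)
  also have "\<dots> = (\<Sum>k<p. if k = i then d k else 0)"
    by (intro sum.cong refl) (simp add: inv \<open>i < p\<close>)
  also have "\<dots> = d i" using \<open>i < p\<close> by (simp add: sum.delta')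
  finally have "\<bar>d i\<bar> \<le> (\<eta> * N + \<mu>) * (\<Sum>l<p. \<bar>Th i l\<bar>)"
    using abs_sum_mult_le[of p "\<lambda>l. \<Sum>k<p. Sig l k * d k" "\<eta> * N + \<mu>" "Th i"] Sd by simp
  also have "\<dots> \<le> (\<eta> * N + \<mu>) * N"
  proof (rule mult_left_mono[OF row[OF \<open>i < p\<close>]])
    have "0 \<le> (\<Sum>k<p. \<bar>w k\<bar>)" by (simp add: sum_nonneg)
    then have "0 \<le> N" using w by linarith
    then show "0 \<le> \<eta> * N + \<mu>" using assms by simp
  qed
  finally show ?thesis by (simp add: d_def mult.commute)
qed

text \<open>Minimality of the l1 norm of \<open>w\<close> forces its mass off the support of
  \<open>v\<close> to be at most the error on that support. The l1 error is then at most twice a sum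
  of at most \<open>r\<close> terms.\<close>

lemma sparse_l1_error:
  fixes w v :: "nat \<Rightarrow> real"
  assumes min: "(\<Sum>k<p. \<bar>w k\<bar>) \<le> (\<Sum>k<p. \<bar>v k\<bar>)"
    and sup: "\<And>k. k < p \<Longrightarrow> \<bar>w k - v k\<bar> \<le> e"
    and r: "card {k. k < p \<and> v k \<noteq> 0} \<le> r" and e: "0 \<le> e"
  shows "(\<Sum>k<p. \<bar>w k - v k\<bar>) \<le> 2 * real r * e"
proof -
  define T where "T = {k. k < p \<and> v k \<noteq> 0}"
  have T: "T \<subseteq> {..<p}" by (auto simp: T_def)
  have split: "(\<Sum>j<p. f j) = (\<Sum>j\<in>T. f j) + (\<Sum>j\<in>{..<p}-T. f j)" for f :: "nat \<Rightarrow> real"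
    using T by (metis add.commute finite_lessThan sum.subset_diff)
  have z: "(\<Sum>k\<in>{..<p}-T. \<bar>v k\<bar>) = 0" "(\<Sum>k\<in>{..<p}-T. \<bar>w k - v k\<bar>) = (\<Sum>k\<in>{..<p}-T. \<bar>w k\<bar>)"
    by (auto simp: T_def intro: sum.cong)
  have "(\<Sum>k\<in>{..<p}-T. \<bar>w k\<bar>) \<le> (\<Sum>k\<in>T. \<bar>v k\<bar> - \<bar>w k\<bar>)"
    using min split[of "\<lambda>k. \<bar>w k\<bar>"] split[of "\<lambda>k. \<bar>v k\<bar>"] z by (simp add: sum_subtractf)
  also have "\<dots> \<le> (\<Sum>k\<in>T. \<bar>w k - v k\<bar>)" by (intro sum_mono) linarith
  finally have "(\<Sum>k<p. \<bar>w k - v k\<bar>) \<le> 2 * (\<Sum>k\<in>T. \<bar>w k - v k\<bar>)"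
    using split[of "\<lambda>k. \<bar>w k - v k\<bar>"] z by simp
  also have "(\<Sum>k\<in>T. \<bar>w k - v k\<bar>) \<le> (\<Sum>k\<in>T. e)" using T sup by (intro sum_mono) auto
  also have "\<dots> \<le> r * e" using r e by (simp add: T_def mult_right_mono)
  finally show ?thesis by simp
qed

section \<open>Second-order bias of the debiased estimator\<close>

context glm_sample
begin

lemma abs_average_le:
  assumes "\<And>i. i < n \<Longrightarrow> \<bar>f i\<bar> \<le> (c::real)"
  shows "\<bar>(\<Sum>i<n. f i) / n\<bar> \<le> c"
proof -
  have "\<bar>\<Sum>i<n. f i\<bar> \<le> (\<Sum>i<n. c)"
    by (rule order_trans[OF sum_abs]) (use assms in \<open>auto intro!: sum_mono simp del: sum_constant\<close>)
  then show ?thesis using n_pos by (simp add: field_simps)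
qed

lemma abs_lin_le':
  assumes "i < n" "(\<Sum>j<p. \<bar>\<delta> j\<bar>) \<le> t"
  shows "\<bar>lin i \<delta>\<bar> \<le> L * t"
  using abs_lin_le[OF assms(1), of \<delta>] mult_left_mono[OF assms(2), of L] L_pos by linarith

lemma hess_lipschitz:
  assumes "(\<Sum>j<p. \<bar>\<delta> j\<bar>) \<le> t" "L * t \<le> R" "j < p" "k < p"
  shows "\<bar>hess (\<lambda>j. \<beta> j + \<delta> j) j k - hess \<beta> j k\<bar> \<le> L\<^sup>2 * (C * (L * t))"
proof -
  have "hess (\<lambda>j. \<beta> j + \<delta> j) j k - hess \<beta> j k
      = (\<Sum>i<n. X i j * X i k *
          (b'' (lin i \<beta> + lin i \<delta>) - b'' (lin i \<beta>))) / n"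
    unfolding hess_def lin_add by (simp add: right_diff_distrib sum_subtractf diff_divide_distrib)
  also have "\<bar>\<dots>\<bar> \<le> L\<^sup>2 * (C * (L * t))"
  proof (rule abs_average_le)
    fix i assume i: "i < n"
    have h: "\<bar>lin i \<delta>\<bar> \<le> L * t" using assms i by (intro abs_lin_le')
    have "\<bar>b'' (lin i \<beta> + lin i \<delta>) - b'' (lin i \<beta>)\<bar> \<le> C * \<bar>lin i \<delta>\<bar>"
      using lipschitz[of "lin i \<beta> + lin i \<delta>" "lin i \<beta>"] h assms by simp
    also have "\<dots> \<le> C * (L * t)" using h C_nonneg by (intro mult_left_mono)
    finally have "\<bar>b'' (lin i \<beta> + lin i \<delta>) - b'' (lin i \<beta>)\<bar> \<le> C * (L * t)" .
    moreover have "\<bar>X i j\<bar> * \<bar>X i k\<bar> \<le> L\<^sup>2"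
      unfolding power2_eq_square using X_bounded i assms L_pos by (intro mult_mono) auto
    ultimately show "\<bar>X i j * X i k *
        (b'' (lin i \<beta> + lin i \<delta>) - b'' (lin i \<beta>))\<bar> \<le> L\<^sup>2 * (C * (L * t))"
      unfolding abs_mult by (intro mult_mono) auto
  qed
  finally show ?thesis .
qed

text \<open>Linearised with the Hessian at the estimate \<open>\<beta>'\<close> rather than at
  \<open>\<beta>\<close>, because that is the matrix which CLIME approximately inverts.\<close>

lemma grad_linearization:
  fixes \<beta> \<delta> :: "nat \<Rightarrow> real"
  assumes "(\<Sum>j<p. \<bar>\<delta> j\<bar>) \<le> t" "L * t \<le> R" "k < p"
  defines "\<beta>' \<equiv> \<lambda>j. \<beta> j + \<delta> j"
  shows "\<bar>grad \<beta>' k - grad \<beta> k + (\<Sum>l<p. hess \<beta>' k l * \<delta> l)\<bar> \<le> L * (C * (L * t)\<^sup>2)"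
proof -
  have "(\<Sum>l<p. hess \<beta>' k l * \<delta> l) = (\<Sum>l<p. \<Sum>i<n. X i k * (X i l * \<delta> l) * b'' (lin i \<beta>')) / n"
    unfolding hess_def sum_distrib_right sum_divide_distrib by (simp add: mult_ac)
  also have "\<dots> = (\<Sum>i<n. X i k * (b'' (lin i \<beta>') * lin i \<delta>)) / n"
    by (subst sum.swap) (simp add: lin_def[of _ \<delta>] sum_distrib_left sum_distrib_right mult_ac)
  finally have "grad \<beta>' k - grad \<beta> k + (\<Sum>l<p. hess \<beta>' k l * \<delta> l)
      = (\<Sum>i<n. X i k * (deriv b (lin i \<beta>) - deriv b (lin i \<beta>')
          + b'' (lin i \<beta>') * lin i \<delta>)) / n"
    unfolding grad_def
    by (simp add: add_divide_distrib[symmetric] diff_divide_distrib[symmetric]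
        sum.distrib[symmetric] sum_subtractf[symmetric] algebra_simps)
  also have "\<bar>\<dots>\<bar> \<le> L * (C * (L * t)\<^sup>2)"
  proof (rule abs_average_le)
    fix i assume i: "i < n"
    have h: "\<bar>lin i \<delta>\<bar> \<le> L * t" using assms i by (intro abs_lin_le')
    have "\<bar>deriv b (lin i \<beta>) - deriv b (lin i \<beta>') + b'' (lin i \<beta>') * lin i \<delta>\<bar>
        \<le> C * (lin i \<delta>)\<^sup>2"
      using deriv_remainder[of "- lin i \<delta>" "lin i \<beta>'"] h assms
      by (simp add: \<beta>'_def lin_add)
    also have "\<dots> \<le> C * (L * t)\<^sup>2"
      using h C_nonneg by (intro mult_left_mono) (auto simp: abs_le_square_iff[symmetric])
    finally show "\<bar>X i k * (deriv b (lin i \<beta>) - deriv b (lin i \<beta>')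
          + b'' (lin i \<beta>') * lin i \<delta>)\<bar> \<le> L * (C * (L * t)\<^sup>2)"
      unfolding abs_mult using X_bounded[OF i \<open>k < p\<close>] L_pos by (intro mult_mono) auto
  qed
  finally show ?thesis .
qed

lemma hess_sym: "hess \<beta> j k = hess \<beta> k j"
  by (simp add: hess_def mult_ac)

text \<open>After the score is linearised, the initial error \<open>\<delta>\<close> is cancelled by
  \<open>w\<close> times the Hessian times \<open>\<delta>\<close>, up to
  \<open>(w H - e_j) \<delta>\<close>. This is a product of the constraint residual and the l1
  error, and the linearisation error is quadratic in \<open>t\<close>; so no first-order bias is
  left.\<close>

lemma debiased_expansion:
  assumes t: "(\<Sum>j<p. \<bar>\<beta>h j - \<beta> j\<bar>) \<le> t" "L * t \<le> R"
    and w: "(\<Sum>k<p. \<bar>w k\<bar>) \<le> N" and j: "j < p" and "0 \<le> \<mu>"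
    and feas: "\<And>i. i < p \<Longrightarrow> \<bar>(\<Sum>k<p. hess \<beta>h i k * w k) - (if i = j then 1 else 0)\<bar> \<le> \<mu>"
  shows "\<bar>\<beta>h j + (\<Sum>k<p. w k * grad \<beta>h k) - \<beta> j - (\<Sum>k<p. w k * grad \<beta> k)\<bar>
    \<le> \<mu> * t + N * (L * (C * (L * t)\<^sup>2))"
proof -
  define \<delta> where "\<delta> = (\<lambda>j. \<beta>h j - \<beta> j)"
  have bh: "\<beta>h = (\<lambda>j. \<beta> j + \<delta> j)" by (simp add: \<delta>_def)
  define err where "err = (\<lambda>k. grad \<beta>h k - grad \<beta> k + (\<Sum>l<p. hess \<beta>h k l * \<delta> l))"
  have err: "\<bar>err k\<bar> \<le> L * (C * (L * t)\<^sup>2)" if "k < p" for k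
    unfolding err_def bh using t that by (intro grad_linearization) (auto simp: \<delta>_def)
  have "(\<Sum>k<p. w k * err k) = (\<Sum>k<p. w k * grad \<beta>h k) - (\<Sum>k<p. w k * grad \<beta> k)
      + (\<Sum>k<p. w k * (\<Sum>l<p. hess \<beta>h k l * \<delta> l))"
    by (simp add: err_def algebra_simps sum.distrib sum_subtractf)
  \<comment> \<open>Symmetry of the Hessian moves \<open>w\<close> to the other index, which is the
    form of the CLIME constraint.\<close>
  also have "(\<Sum>k<p. w k * (\<Sum>l<p. hess \<beta>h k l * \<delta> l)) = (\<Sum>l<p. (\<Sum>k<p. hess \<beta>h l k * w k) * \<delta> l)"
    unfolding sum_distrib_left sum_distrib_right
    by (subst sum.swap) (simp add: hess_sym[of \<beta>h] mult_ac)
  finally have 1: "(\<Sum>k<p. w k * err k) = (\<Sum>k<p. w k * grad \<beta>h k) - (\<Sum>k<p. w k * grad \<beta> k)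
      + (\<Sum>l<p. (\<Sum>k<p. hess \<beta>h l k * w k) * \<delta> l)" .
  have "(\<Sum>l<p. ((\<Sum>k<p. hess \<beta>h l k * w k) - (if l = j then 1 else 0)) * \<delta> l)
      = (\<Sum>l<p. (\<Sum>k<p. hess \<beta>h l k * w k) * \<delta> l) - (\<Sum>l<p. if l = j then \<delta> l else 0)"
    unfolding sum_subtractf[symmetric] by (intro sum.cong refl) (simp add: left_diff_distrib)
  also have "(\<Sum>l<p. if l = j then \<delta> l else 0) = \<delta> j" using j by (simp add: sum.delta')
  finally have 2: "\<beta>h j + (\<Sum>k<p. w k * grad \<beta>h k) - \<beta> j - (\<Sum>k<p. w k * grad \<beta> k)
      = (\<Sum>k<p. err k * w k)
        - (\<Sum>l<p. ((\<Sum>k<p. hess \<beta>h l k * w k) - (if l = j then 1 else 0)) * \<delta> l)"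
    using 1 by (simp add: \<delta>_def mult.commute[of "err _"])
  have "\<bar>\<Sum>k<p. err k * w k\<bar> \<le> L * (C * (L * t)\<^sup>2) * (\<Sum>k<p. \<bar>w k\<bar>)"
    using err by (intro abs_sum_mult_le)
  also have "\<dots> \<le> L * (C * (L * t)\<^sup>2) * N" using w L_pos C_nonneg by (intro mult_left_mono) auto
  finally have 3: "\<bar>\<Sum>k<p. err k * w k\<bar> \<le> N * (L * (C * (L * t)\<^sup>2))" by (simp add: mult_ac)
  have "\<bar>\<Sum>l<p. ((\<Sum>k<p. hess \<beta>h l k * w k) - (if l = j then 1 else 0)) * \<delta> l\<bar>
      \<le> \<mu> * (\<Sum>l<p. \<bar>\<delta> l\<bar>)"
    using feas by (intro abs_sum_mult_le)
  also have "\<dots> \<le> \<mu> * t" using t \<open>0 \<le> \<mu>\<close> by (intro mult_left_mono) (auto simp: \<delta>_def)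
  finally show ?thesis using 2 3 by linarith
qed

text \<open>The condition on \<open>\<mu>\<close> makes the true row feasible, so that its sparsity
  controls \<open>w\<close>. The first conclusion is for the denominator of the test statistic, the
  second for its numerator. In the last summand the score meets the l1 error of \<open>w\<close>;
  its 4 is the 2 of the maximum-norm bound times the 2 of \<open>sparse_l1_error\<close>.\<close>

lemma debiased_error:
  fixes Sig Th :: "nat \<Rightarrow> nat \<Rightarrow> real"
  assumes t: "(\<Sum>j<p. \<bar>\<beta>h j - \<beta> j\<bar>) \<le> t" "L * t \<le> R"
    and close: "\<And>j k. j < p \<Longrightarrow> k < p \<Longrightarrow> \<bar>hess \<beta> j k - Sig j k\<bar> \<le> \<eta>"
    and sym: "\<And>i k. i < p \<Longrightarrow> k < p \<Longrightarrow> Th i k = Th k i"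
    and inv: "\<And>i j. i < p \<Longrightarrow> j < p \<Longrightarrow> (\<Sum>k<p. Sig i k * Th j k) = (if i = j then 1 else 0)"
    and sym_Sig: "\<And>i k. i < p \<Longrightarrow> k < p \<Longrightarrow> Sig i k = Sig k i"
    and row: "\<And>j. j < p \<Longrightarrow> (\<Sum>k<p. \<bar>Th j k\<bar>) \<le> N"
    and \<mu>: "(\<eta> + L\<^sup>2 * (C * (L * t))) * N \<le> \<mu>"
    and j: "j < p"
    and feas: "\<And>i. i < p \<Longrightarrow> \<bar>(\<Sum>k<p. hess \<beta>h i k * w k) - (if i = j then 1 else 0)\<bar> \<le> \<mu>"
    and min: "\<And>v. (\<And>i. i < p \<Longrightarrow> \<bar>(\<Sum>k<p. hess \<beta>h i k * v k) - (if i = j then 1 else 0)\<bar> \<le> \<mu>)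
        \<Longrightarrow> (\<Sum>k<p. \<bar>w k\<bar>) \<le> (\<Sum>k<p. \<bar>v k\<bar>)"
    and r: "card {k. k < p \<and> Th j k \<noteq> 0} \<le> r"
    and score: "\<And>k. k < p \<Longrightarrow> \<bar>grad \<beta> k\<bar> \<le> \<sigma>"
  shows "\<bar>w j - Th j j\<bar> \<le> 2 * N * \<mu>"
    and "\<bar>\<beta>h j + (\<Sum>k<p. w k * grad \<beta>h k) - \<beta> j - (\<Sum>k<p. Th j k * grad \<beta> k)\<bar>
      \<le> \<mu> * t + N * (L * (C * (L * t)\<^sup>2)) + 4 * real r * N * \<mu> * \<sigma>"
proof -
  define \<eta>' where "\<eta>' = \<eta> + L\<^sup>2 * (C * (L * t))"
  have "0 \<le> (\<Sum>j<p. \<bar>\<beta>h j - \<beta> j\<bar>)" by (simp add: sum_nonneg)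
  with t have t0: "0 \<le> t" by linarith
  have "0 \<le> (\<Sum>k<p. \<bar>Th j k\<bar>)" by (simp add: sum_nonneg)
  with row[OF j] have N0: "0 \<le> N" by linarith
  have \<eta>0: "0 \<le> \<eta>" using close[OF j j] by linarith
  have \<eta>'0: "0 \<le> \<eta>'" using \<eta>0 t0 L_pos C_nonneg by (simp add: \<eta>'_def)
  have \<mu>0: "0 \<le> \<mu>" using feas[OF j] by linarith
  \<comment> \<open>Closeness to \<open>Sig\<close> is carried over from the true parameter to the
    estimate, at the Lipschitz price included in \<open>\<eta>'\<close>.\<close>
  have close': "\<bar>hess \<beta>h i k - Sig i k\<bar> \<le> \<eta>'" if "i < p" "k < p" for i k
    using hess_lipschitz[of "\<lambda>j. \<beta>h j - \<beta> j" t i k \<beta>] t close[OF that] that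
    by (simp add: \<eta>'_def)
  have feasT: "\<bar>(\<Sum>k<p. hess \<beta>h i k * Th j k) - (if i = j then 1 else 0)\<bar> \<le> \<mu>" if "i < p" for i
    using clime_feasible[of p "hess \<beta>h" Sig \<eta>' Th N i j, OF close' inv row \<eta>'0 that j] \<mu>
    by (simp add: \<eta>'_def)
  have wT: "(\<Sum>k<p. \<bar>w k\<bar>) \<le> (\<Sum>k<p. \<bar>Th j k\<bar>)" using feasT by (rule min)
  then have wN: "(\<Sum>k<p. \<bar>w k\<bar>) \<le> N" using row[OF j] by linarith
  have sup: "\<bar>w k - Th j k\<bar> \<le> 2 * N * \<mu>" if "k < p" for k
  proof -
    have "\<bar>w k - Th j k\<bar> \<le> N * (\<eta>' * N + \<mu>)"
      by (rule clime_sup_error[of p "hess \<beta>h" Sig \<eta>' Th N w j \<mu> k])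
        (use close' sym inv sym_Sig row wN feas that j \<eta>'0 \<mu>0 in auto)
    also have "\<dots> \<le> N * (\<mu> + \<mu>)" using \<mu> N0 by (intro mult_left_mono) (auto simp: \<eta>'_def)
    finally show ?thesis by simp
  qed
  show "\<bar>w j - Th j j\<bar> \<le> 2 * N * \<mu>" using j by (rule sup)
  have l1: "(\<Sum>k<p. \<bar>w k - Th j k\<bar>) \<le> 2 * real r * (2 * N * \<mu>)"
    using wT sup r N0 \<mu>0 by (intro sparse_l1_error) auto
  have \<sigma>0: "0 \<le> \<sigma>" using score[OF j] by linarith
  have "\<bar>\<Sum>k<p. grad \<beta> k * (w k - Th j k)\<bar> \<le> \<sigma> * (\<Sum>k<p. \<bar>w k - Th j k\<bar>)"
    using score by (intro abs_sum_mult_le)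
  also have "\<dots> \<le> \<sigma> * (2 * real r * (2 * N * \<mu>))" using l1 \<sigma>0 by (rule mult_left_mono)
  finally have "\<bar>(\<Sum>k<p. w k * grad \<beta> k) - (\<Sum>k<p. Th j k * grad \<beta> k)\<bar> \<le> 4 * real r * N * \<mu> * \<sigma>"
    by (simp add: left_diff_distrib sum_subtractf mult.commute mult.left_commute)
  moreover have "\<bar>\<beta>h j + (\<Sum>k<p. w k * grad \<beta>h k) - \<beta> j - (\<Sum>k<p. w k * grad \<beta> k)\<bar>
    \<le> \<mu> * t + N * (L * (C * (L * t)\<^sup>2))"
    using t wN j \<mu>0 feas by (rule debiased_expansion)
  ultimately show "\<bar>\<beta>h j + (\<Sum>k<p. w k * grad \<beta>h k) - \<beta> j - (\<Sum>k<p. Th j k * grad \<beta> k)\<bar>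
      \<le> \<mu> * t + N * (L * (C * (L * t)\<^sup>2)) + 4 * real r * N * \<mu> * \<sigma>"
    by linarith
qed

end

section \<open>The GMT threshold\<close>

text \<open>The density on \<open>A\<close> is compared with a translate of itself, and the
  translate integrates to 1 over the whole line. This gives a tail bound without evaluating a
  Gaussian integral.\<close>

lemma measure_std_normal_le:
  assumes "A \<in> sets borel" "\<And>x. x \<in> A \<Longrightarrow> std_normal_density x \<le> c * std_normal_density (x - t)" "0 \<le> c"
  shows "measure std_normal_distribution A \<le> c"
proof -
  interpret N: real_distribution std_normal_distribution by (rule real_dist_normal_dist)
  have "emeasure std_normal_distribution A = (\<integral>\<^sup>+x. ennreal (std_normal_density x) * indicator A x \<partial>lborel)"
    using assms(1) by (simp add: emeasure_density)
  also have "\<dots> \<le> (\<integral>\<^sup>+x. ennreal c * ennreal (std_normal_density (x - t)) \<partial>lborel)"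
    using assms by (intro nn_integral_mono) (auto simp: indicator_def ennreal_mult[symmetric] intro!: ennreal_leI)
  also have "\<dots> = ennreal c * (\<integral>\<^sup>+x. ennreal (std_normal_density (x - t)) \<partial>lborel)"
    by (rule nn_integral_cmult) simp
  also have "(\<integral>\<^sup>+x. ennreal (std_normal_density (x - t)) \<partial>lborel) = (\<integral>\<^sup>+x. ennreal (std_normal_density x) \<partial>lborel)"
    using nn_integral_real_affine[of "\<lambda>x. ennreal (std_normal_density x)" 1 "-t"] by (simp add: algebra_simps)
  also have "\<dots> = 1"
  proof -
    have "emeasure std_normal_distribution (space std_normal_distribution) = 1"
      by (rule N.emeasure_space_1)
    then show ?thesis by (simp add: emeasure_density)
  qed
  finally show ?thesis using assms(3) by (simp add: N.emeasure_eq_measure)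
qed

lemma normal_tail_eq: "normal_tail t = 2 * measure std_normal_distribution {t<..}"
proof -
  interpret N: real_distribution std_normal_distribution by (rule real_dist_normal_dist)
  have "measure std_normal_distribution {t<..} = 1 - measure std_normal_distribution {..t}"
    using N.prob_compl[of "{..t}"] by (simp add: Compl_eq_Diff_UNIV[symmetric] Compl_atMost)
  then show ?thesis by (simp add: normal_tail_def cdf_def)
qed

lemma normal_tail_nonneg: "0 \<le> normal_tail t"
  by (simp add: normal_tail_eq)

text \<open>For \<open>x \<ge> t \<ge> 0\<close> we have \<open>x\<^sup>2 \<ge> t\<^sup>2 + (x - t)\<^sup>2\<close>.\<close>
lemma normal_tail_le:
  assumes "0 \<le> t"
  shows "normal_tail t \<le> 2 * exp (- t\<^sup>2 / 2)"
proof -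
  have "measure std_normal_distribution {t<..} \<le> exp (- t\<^sup>2 / 2)"
  proof (rule measure_std_normal_le[where t = t])
    fix x assume "x \<in> {t<..}"
    then have "t * (t - x) \<le> 0" using assms by (intro mult_nonneg_nonpos) auto
    then have "- x\<^sup>2 / 2 \<le> - t\<^sup>2 / 2 + - (x - t)\<^sup>2 / 2" by (simp add: power2_eq_square algebra_simps)
    then have "exp (- x\<^sup>2 / 2) \<le> exp (- t\<^sup>2 / 2) * exp (- (x - t)\<^sup>2 / 2)"
      by (simp add: exp_add[symmetric])
    then show "std_normal_density x \<le> exp (- t\<^sup>2 / 2) * std_normal_density (x - t)"
      by (simp add: std_normal_density_def divide_right_mono)
  qed auto
  then show ?thesis by (simp add: normal_tail_eq)
qed

lemma measure_std_normal_singleton: "measure std_normal_distribution {x} = 0"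
proof -
  have "AE y in lborel. y \<noteq> x" by (rule AE_lborel_singleton)
  then have "emeasure std_normal_distribution {x} = 0"
    by (auto simp: emeasure_density nn_integral_0_iff_AE indicator_def elim: eventually_mono)
  then show ?thesis by (simp add: measure_def)
qed

text \<open>Reflection shows that both half lines carry the same mass. The value matters because
  \<open>\<alpha> < 1 \<le> normal_tail 0\<close> prevents levels near 0 from being
  admissible.\<close>

lemma normal_tail_0: "1 \<le> normal_tail 0"
proof -
  interpret N: real_distribution std_normal_distribution by (rule real_dist_normal_dist)
  have "emeasure std_normal_distribution {..0}
      = (\<integral>\<^sup>+x. ennreal (std_normal_density x) * indicator {..0} x \<partial>lborel)"
    by (simp add: emeasure_density)
  also have "\<dots> = (\<integral>\<^sup>+x. ennreal (std_normal_density (-x)) * indicator {..0} (-x) \<partial>lborel)"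
    using nn_integral_real_affine[of "\<lambda>x. ennreal (std_normal_density x) * indicator {..0} x" "-1" 0]
    by simp
  also have "\<dots> = (\<integral>\<^sup>+x. ennreal (std_normal_density x) * indicator {0..} x \<partial>lborel)"
    by (intro nn_integral_cong) (simp add: std_normal_density_def indicator_def)
  also have "\<dots> = emeasure std_normal_distribution {0..}" by (simp add: emeasure_density)
  finally have 1: "measure std_normal_distribution {..0} = measure std_normal_distribution {0..}"
    by (simp add: measure_def)
  have "({0..} :: real set) = {0} \<union> {0<..}" by auto
  moreover have "measure std_normal_distribution ({0} \<union> {0<..}) = measure std_normal_distribution {0}
      + measure std_normal_distribution {0<..}"
    by (rule N.finite_measure_Union) auto
  ultimately have "measure std_normal_distribution {0..} = measure std_normal_distribution {0}
      + measure std_normal_distribution {0<..}" by simp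
  moreover have "measure std_normal_distribution {..0} = 1 - measure std_normal_distribution {0<..}"
    using normal_tail_eq[of 0] by (simp add: normal_tail_def cdf_def)
  ultimately show ?thesis using 1 measure_std_normal_singleton[of 0] by (simp add: normal_tail_eq)
qed

lemma isCont_normal_tail: "isCont normal_tail t"
proof -
  interpret N: real_distribution std_normal_distribution by (rule real_dist_normal_dist)
  have "isCont (cdf std_normal_distribution) t"
    using N.isCont_cdf measure_std_normal_singleton by simp
  then have "isCont (\<lambda>t. 2 - 2 * cdf std_normal_distribution t) t" by (intro continuous_intros)
  then show ?thesis by (simp add: normal_tail_def[abs_def])
qed

section \<open>Bounds for the threshold\<close>

lemma card_below_le: "card {j. j < (p::nat) \<and> P j} \<le> p"
proof -
  have "card {j. j < p \<and> P j} \<le> card {..<p}" by (intro card_mono) auto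
  then show ?thesis by simp
qed

text \<open>At most \<open>p\<close> statistics exceed a level, so the ratio in the admissibility
  condition is at least \<open>normal_tail t\<close>, which exceeds \<open>\<alpha>\<close> near 0
  by continuity. Positivity matters because a selected coordinate then has a nonzero statistic, so
  that signs can agree on the support only.\<close>

lemma gmt_threshold_pos:
  assumes "\<alpha> < 1" "p \<ge> 2"
  shows "0 < gmt_threshold \<alpha> p T"
proof (cases "gmt_admissible \<alpha> p T = {}")
  case True
  then show ?thesis using assms by (simp add: gmt_threshold_def ln_gt_zero)
next
  case False
  have "\<forall>\<^sub>F t in at 0. normal_tail t > \<alpha>"
    using isCont_normal_tail[of 0] normal_tail_0 assms(1)
    unfolding isCont_def by (intro order_tendstoD(1)[where y = "normal_tail 0"]) auto
  then obtain d where d: "d > 0" "\<And>t. t \<noteq> 0 \<Longrightarrow> dist t 0 < d \<Longrightarrow> normal_tail t > \<alpha>"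
    by (auto simp: eventually_at)
  have "d \<le> t" if t: "t \<in> gmt_admissible \<alpha> p T" for t
  proof (rule ccontr)
    assume "\<not> d \<le> t"
    then have gt: "normal_tail t > \<alpha>"
      using d t normal_tail_0 assms(1) by (cases "t = 0") (auto simp: gmt_admissible_def dist_real_def)
    define N where "N = max (card {j. j < p \<and> t \<le> \<bar>T j\<bar>}) 1"
    have N: "1 \<le> N" "N \<le> p" using card_below_le[of p] assms by (auto simp: N_def)
    have "real p * normal_tail t / real N \<le> \<alpha>" using t by (simp add: gmt_admissible_def N_def)
    moreover have "real N * normal_tail t \<le> real p * normal_tail t"
      using N normal_tail_nonneg by (intro mult_right_mono) auto
    then have "normal_tail t \<le> real p * normal_tail t / real N" using N by (simp add: field_simps)
    ultimately show False using gt by linarith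
  qed
  then have "d \<le> Inf (gmt_admissible \<alpha> p T)" using False by (intro cInf_greatest)
  then show ?thesis using d False by (simp add: gmt_threshold_def)
qed

text \<open>The 2 in \<open>2 * real p / (\<alpha> * real s)\<close> absorbs the 2 of the tail
  bound, and the shift by 2 buys a factor \<open>exp (- 2) \<le> 1 / 2\<close>, which pays for
  counting only half of the signals. The final \<open>+ 1\<close> covers the case that
  \<open>\<tau>\<close> lies beyond the cutoff and the fallback value is taken.\<close>

lemma gmt_threshold_le:
  fixes s :: nat
  assumes \<alpha>: "0 < \<alpha>" "\<alpha> < 1" and s: "1 \<le> s" "s \<le> p"
    and cutoff: "sqrt (2 * ln (real p)) \<le> gmt_cutoff p + 1" "1 \<le> ln (real p)"
  defines "\<tau> \<equiv> sqrt (2 * ln (2 * real p / (\<alpha> * real s))) + 2"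
  assumes many: "real s \<le> 2 * real (card {j. j < p \<and> \<tau> \<le> \<bar>T j\<bar>})"
  shows "gmt_threshold \<alpha> p T \<le> \<tau> + 1"
proof -
  have "\<alpha> * real s \<le> 1 * real p" using \<alpha> s by (intro mult_mono) auto
  then have arg: "1 \<le> 2 * real p / (\<alpha> * real s)" using \<alpha> s by (simp add: field_simps)
  have \<tau>0: "2 \<le> \<tau>" using arg by (simp add: \<tau>_def)
  have bdd: "bdd_below (gmt_admissible \<alpha> p T)" by (rule bdd_belowI[of _ 0]) (auto simp: gmt_admissible_def)
  show ?thesis
  proof (cases "\<tau> \<le> gmt_cutoff p")
    case True
    define u where "u = sqrt (2 * ln (2 * real p / (\<alpha> * real s)))"
    have u: "0 \<le> u" "u\<^sup>2 = 2 * ln (2 * real p / (\<alpha> * real s))" using arg by (simp_all add: u_def)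
    have "normal_tail \<tau> \<le> 2 * exp (- \<tau>\<^sup>2 / 2)" using \<tau>0 by (intro normal_tail_le) auto
    also have "- \<tau>\<^sup>2 / 2 \<le> - 2 - u\<^sup>2 / 2" using u by (simp add: \<tau>_def u_def[symmetric] power2_sum)
    then have "2 * exp (- \<tau>\<^sup>2 / 2) \<le> 2 * (exp (- 2) * exp (- (u\<^sup>2 / 2)))"
      by (simp add: exp_add[symmetric])
    also have "exp (- (u\<^sup>2 / 2)) = \<alpha> * real s / (2 * real p)"
      using arg by (simp add: u exp_minus)
    also have "2 * (exp (- 2) * (\<alpha> * real s / (2 * real p))) \<le> \<alpha> * real s / (2 * real p)"
    proof -
      have "(2::real) \<le> exp 2" using exp_ge_add_one_self[of "2::real"] by linarith
      then have "2 * exp (- 2) \<le> (1::real)" by (simp add: exp_minus field_simps)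
      then have "2 * exp (- 2) * (\<alpha> * real s / (2 * real p)) \<le> 1 * (\<alpha> * real s / (2 * real p))"
        using \<alpha> by (intro mult_right_mono) auto
      then show ?thesis by simp
    qed
    finally have "real p * normal_tail \<tau> \<le> \<alpha> * (real s / 2)"
      using s by (simp add: field_simps)
    also have "\<dots> \<le> \<alpha> * real (max (card {j. j < p \<and> \<tau> \<le> \<bar>T j\<bar>}) 1)"
      using many \<alpha> by (intro mult_left_mono) auto
    finally have "\<tau> \<in> gmt_admissible \<alpha> p T"
      using True \<tau>0 by (simp add: gmt_admissible_def divide_le_eq)
    then show ?thesis using cInf_lower[OF _ bdd] by (force simp: gmt_threshold_def)
  next
    case False
    show ?thesis
    proof (cases "gmt_admissible \<alpha> p T = {}")
      case True
      then show ?thesis using False cutoff by (simp add: gmt_threshold_def)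
    next
      case ne: False
      then obtain t where t: "t \<in> gmt_admissible \<alpha> p T" by blast
      then have "Inf (gmt_admissible \<alpha> p T) \<le> t" using bdd by (rule cInf_lower)
      also have "t \<le> gmt_cutoff p" using t by (simp add: gmt_admissible_def)
      finally show ?thesis using False ne by (simp add: gmt_threshold_def)
    qed
  qed
qed

section \<open>Measurability of the threshold\<close>

lemma borel_up_closure:
  fixes C :: "real set"
  shows "{x. \<exists>t\<in>C. t \<le> x} \<in> sets borel"
proof -
  \<comment> \<open>The indicator of an upward closed set is monotone, hence Borel, for an arbitrary
    set \<open>C\<close> of levels.\<close>
  have "(\<lambda>x. if \<exists>t\<in>C. t \<le> x then 1 else 0 :: real) \<in> borel_measurable borel"
    by (intro borel_measurable_mono) (auto simp: mono_def intro: order_trans)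
  then have "(\<lambda>x. if \<exists>t\<in>C. t \<le> x then 1 else 0 :: real) -` {1} \<inter> space borel \<in> sets borel"
    by (rule measurable_sets) simp
  also have "(\<lambda>x. if \<exists>t\<in>C. t \<le> x then 1 else 0 :: real) -` {1} \<inter> space borel = {x. \<exists>t\<in>C. t \<le> x}"
    by (auto split: if_splits)
  finally show ?thesis .
qed

text \<open>A level \<open>t\<close> is admissible iff some \<open>A \<subseteq> [p]\<close> lies above \<open>t\<close> and the level is admissible for
  the count \<open>|A|\<close>; for fixed \<open>A\<close> the candidate levels form a deterministic set.\<close>
lemma gmt_admissible_less_measurable:
  assumes [measurable]: "\<And>j. j < p \<Longrightarrow> (\<lambda>\<omega>. T \<omega> j) \<in> borel_measurable M"
  shows "{\<omega>\<in>space M. \<exists>t\<in>gmt_admissible \<alpha> p (T \<omega>). t < c} \<in> sets M"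
proof -
  define C where "C = (\<lambda>A::nat set. {t. 0 \<le> t \<and> t \<le> gmt_cutoff p \<and> t < c \<and>
     real p * normal_tail t / real (max (card A) 1) \<le> \<alpha>})"
  have eq: "(\<exists>t\<in>gmt_admissible \<alpha> p T'. t < c) \<longleftrightarrow>
      (\<exists>A\<in>Pow {..<p}. \<exists>t\<in>C A. \<forall>j\<in>A. t \<le> \<bar>T' j\<bar>)" for T'
  proof
    assume "\<exists>t\<in>gmt_admissible \<alpha> p T'. t < c"
    then obtain t where "t \<in> gmt_admissible \<alpha> p T'" "t < c" by blast
    then show "\<exists>A\<in>Pow {..<p}. \<exists>t\<in>C A. \<forall>j\<in>A. t \<le> \<bar>T' j\<bar>"
      by (intro bexI[of _ "{j. j < p \<and> t \<le> \<bar>T' j\<bar>}"] bexI[of _ t]) (auto simp: C_def gmt_admissible_def)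
  next
    assume "\<exists>A\<in>Pow {..<p}. \<exists>t\<in>C A. \<forall>j\<in>A. t \<le> \<bar>T' j\<bar>"
    then obtain A t where A: "A \<subseteq> {..<p}" "t \<in> C A" "\<forall>j\<in>A. t \<le> \<bar>T' j\<bar>" by blast
    \<comment> \<open>A larger count only lowers the ratio, so a level that is admissible for the
      count of a subset \<open>A\<close> is admissible for the full count.\<close>
    have "card A \<le> card {j. j < p \<and> t \<le> \<bar>T' j\<bar>}" using A by (intro card_mono) auto
    then have "real p * normal_tail t / real (max (card {j. j < p \<and> t \<le> \<bar>T' j\<bar>}) 1)
        \<le> real p * normal_tail t / real (max (card A) 1)"
      using normal_tail_nonneg by (intro divide_left_mono) auto
    then show "\<exists>t\<in>gmt_admissible \<alpha> p T'. t < c"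
      using A by (intro bexI[of _ t]) (auto simp: C_def gmt_admissible_def)
  qed
  \<comment> \<open>Over a finite nonempty \<open>A\<close> the quantifiers can be exchanged: choose
    a level below each \<open>x j\<close> and take the smallest. The event thus splits into
    conditions on single coordinates.\<close>
  have chain: "(\<exists>t\<in>C'. \<forall>j\<in>A. t \<le> x j) \<longleftrightarrow> (if A = {} then C' \<noteq> {} else \<forall>j\<in>A. x j \<in> {x. \<exists>t\<in>C'. t \<le> x})"
    if "finite A" for A and C' :: "real set" and x :: "nat \<Rightarrow> real"
  proof (cases "A = {}")
    case False
    have "\<exists>t\<in>C'. \<forall>j\<in>A. t \<le> x j" if "\<forall>j\<in>A. \<exists>t\<in>C'. t \<le> x j"
    proof -
      from that obtain f where f: "\<forall>j\<in>A. f j \<in> C' \<and> f j \<le> x j" by metis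
      have "Min (f ` A) \<in> f ` A" using \<open>finite A\<close> False by (intro Min_in) auto
      moreover have "Min (f ` A) \<le> x j" if "j \<in> A" for j
        using f that \<open>finite A\<close> by (meson Min_le finite_imageI image_eqI order_trans)
      ultimately show ?thesis using f by (intro bexI[of _ "Min (f ` A)"]) auto
    qed
    then show ?thesis using False by auto
  qed auto
  have "{\<omega>\<in>space M. \<exists>t\<in>C A. \<forall>j\<in>A. t \<le> \<bar>T \<omega> j\<bar>} \<in> sets M" if "A \<in> Pow {..<p}" for A
  proof -
    have fin: "finite A" using that finite_subset by auto
    have [measurable]: "{x. \<exists>t\<in>C A. t \<le> x} \<in> sets borel" by (rule borel_up_closure)
    have [measurable]: "\<And>j. j \<in> A \<Longrightarrow> (\<lambda>\<omega>. \<bar>T \<omega> j\<bar>) \<in> borel_measurable M" using that by auto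
    show ?thesis unfolding chain[OF fin]
    proof (cases "A = {}")
      case False
      have "{\<omega>\<in>space M. \<forall>j\<in>A. \<bar>T \<omega> j\<bar> \<in> {x. \<exists>t\<in>C A. t \<le> x}} \<in> sets M"
        using fin by (intro sets.sets_Collect_finite_All) measurable
      then show "{\<omega>\<in>space M. if A = {} then C A \<noteq> {} else \<forall>j\<in>A. \<bar>T \<omega> j\<bar> \<in> {x. \<exists>t\<in>C A. t \<le> x}} \<in> sets M"
        using False by simp
    qed simp
  qed
  then have "{\<omega>\<in>space M. \<exists>A\<in>Pow {..<p}. \<exists>t\<in>C A. \<forall>j\<in>A. t \<le> \<bar>T \<omega> j\<bar>} \<in> sets M"
    by (rule sets.sets_Collect_finite_Ex) simp_all
  then show ?thesis by (simp only: eq)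
qed

lemma gmt_threshold_measurable:
  assumes "\<And>j. j < p \<Longrightarrow> (\<lambda>\<omega>. T \<omega> j) \<in> borel_measurable M"
  shows "(\<lambda>\<omega>. gmt_threshold \<alpha> p (T \<omega>)) \<in> borel_measurable M"
proof (rule borel_measurableI_less)
  fix c
  note E = gmt_admissible_less_measurable[OF assms, of p]
  \<comment> \<open>Every admissible level is below \<open>gmt_cutoff p + 1\<close>, so that the
    fallback case too is described by an event already known to be measurable.\<close>
  have ne: "gmt_admissible \<alpha> p T' = {} \<longleftrightarrow> \<not> (\<exists>t\<in>gmt_admissible \<alpha> p T'. t < gmt_cutoff p + 1)" for T'
    by (force simp: gmt_admissible_def)
  have bdd: "bdd_below (gmt_admissible \<alpha> p T')" for T'
    by (rule bdd_belowI[of _ 0]) (auto simp: gmt_admissible_def)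
  have "(gmt_threshold \<alpha> p T' < c) \<longleftrightarrow>
      (\<exists>t\<in>gmt_admissible \<alpha> p T'. t < c) \<or>
      (\<not> (\<exists>t\<in>gmt_admissible \<alpha> p T'. t < gmt_cutoff p + 1) \<and> sqrt (2 * ln (real p)) < c)" for T'
    unfolding ne[symmetric] gmt_threshold_def using cInf_less_iff[OF _ bdd, of T' c] by auto
  then have eq: "{\<omega>\<in>space M. gmt_threshold \<alpha> p (T \<omega>) < c} =
      {\<omega>\<in>space M. (\<exists>t\<in>gmt_admissible \<alpha> p (T \<omega>). t < c) \<or>
      (\<not> (\<exists>t\<in>gmt_admissible \<alpha> p (T \<omega>). t < gmt_cutoff p + 1) \<and> sqrt (2 * ln (real p)) < c)}" by blast
  show "{\<omega>\<in>space M. gmt_threshold \<alpha> p (T \<omega>) < c} \<in> sets M" unfolding eq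
    by (intro sets.sets_Collect sets.sets_Collect_const E)
qed

text \<open>Let \<open>f\<close> be the fraction of bad signals. On \<open>\<Omega>\<close> with
  \<open>f \<le> 1 / 2\<close>, enough signals are large to pull the threshold down, and the
  integrand \<open>g\<close> is at least \<open>1 - f\<close>. For \<open>f > 1 / 2\<close> the
  number \<open>1 - 3 * f\<close> is negative. So \<open>indicator \<Omega> - 3 * f \<le> g\<close>
  holds everywhere, and integrating this linear bound takes the place of Markov's
  inequality.\<close>

lemma directional_power_bounds:
  fixes \<beta> :: rvec and p :: nat
  assumes "prob_space M" and T: "\<And>j. j < p \<Longrightarrow> (\<lambda>\<omega>. T \<omega> j) \<in> borel_measurable M"
    and \<alpha>: "0 < \<alpha>" "\<alpha> < 1" and s: "s = card (support p \<beta>)" "1 \<le> s"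
    and cutoff: "sqrt (2 * ln (real p)) \<le> gmt_cutoff p + 1" "1 \<le> ln (real p)"
    and \<Omega>: "\<Omega> \<in> sets M" and bad: "\<And>j. j \<in> support p \<beta> \<Longrightarrow> bad j \<in> sets M"
      "\<And>j. j \<in> support p \<beta> \<Longrightarrow> measure M (bad j) \<le> \<delta>"
    and good: "\<And>\<omega> j. \<omega> \<in> \<Omega> \<Longrightarrow> j \<in> support p \<beta> \<Longrightarrow> \<omega> \<notin> bad j \<Longrightarrow>
      sgn (T \<omega> j) = sgn (\<beta> $ j) \<and> sqrt (2 * ln (2 * real p / (\<alpha> * real s))) + 3 \<le> \<bar>T \<omega> j\<bar>"
  shows "directional_power M \<alpha> p \<beta> T \<le> 1"
    and "measure M \<Omega> - 3 * \<delta> \<le> directional_power M \<alpha> p \<beta> T"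
proof -
  interpret prob_space M by fact
  let ?S = "support p \<beta>"
  have finS: "finite ?S" and Sp: "?S \<subseteq> {..<p}" by (auto simp: support_def)
  have "card ?S \<le> card {..<p}" using Sp by (intro card_mono) auto
  then have sp: "s \<le> p" using s by simp
  have p2: "p \<ge> 2"
  proof (rule ccontr)
    assume "\<not> p \<ge> 2"
    then have "p = 0 \<or> p = 1" by auto
    then show False using cutoff(2) by auto
  qed
  define g where "g = (\<lambda>\<omega>. real (card {j \<in> gmt_selected \<alpha> p (T \<omega>). sgn (T \<omega> j) = sgn (\<beta> $ j)}) / real s)"
  have dp: "directional_power M \<alpha> p \<beta> T = (\<integral>\<omega>. g \<omega> \<partial>M)"
    using s by (simp add: directional_power_def g_def max_def)
  note thr [measurable] = gmt_threshold_measurable[of p T M \<alpha>, OF T]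
  \<comment> \<open>A selected null coordinate never counts: there the sign of
    \<open>\<beta>\<close> is 0, while selected statistics are nonzero. This is why the ratio cannot
    exceed 1.\<close>
  have sub: "{j \<in> gmt_selected \<alpha> p (T \<omega>). sgn (T \<omega> j) = sgn (\<beta> $ j)} \<subseteq> ?S" for \<omega>
  proof
    fix j assume j: "j \<in> {j \<in> gmt_selected \<alpha> p (T \<omega>). sgn (T \<omega> j) = sgn (\<beta> $ j)}"
    then have "0 < \<bar>T \<omega> j\<bar>" using gmt_threshold_pos[OF \<alpha>(2) p2, of "T \<omega>"]
      by (auto simp: gmt_selected_def)
    then have "sgn (T \<omega> j) \<noteq> 0" by (simp add: sgn_0_0)
    with j show "j \<in> ?S" by (auto simp: support_def gmt_selected_def)
  qed
  have g1: "g \<omega> \<le> 1" "0 \<le> g \<omega>" for \<omega>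
    using card_mono[OF finS sub[of \<omega>]] s by (auto simp: g_def)
  \<comment> \<open>As a finite sum of indicators the random count is open to the measurability
    rules.\<close>
  have card_eq: "real (card {j \<in> gmt_selected \<alpha> p (T \<omega>). sgn (T \<omega> j) = sgn (\<beta> $ j)})
      = (\<Sum>j<p. if gmt_threshold \<alpha> p (T \<omega>) \<le> \<bar>T \<omega> j\<bar> \<and> sgn (T \<omega> j) = sgn (\<beta> $ j) then 1 else 0)" for \<omega>
    by (simp add: gmt_selected_def sum.If_cases) (auto intro!: arg_cong[where f = card])
  have g_meas: "g \<in> borel_measurable M" unfolding g_def card_eq
  proof (intro borel_measurable_divide borel_measurable_sum borel_measurable_const)
    fix j assume "j \<in> {..<p}"
    then have [measurable]: "(\<lambda>\<omega>. T \<omega> j) \<in> borel_measurable M" using T by simp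
    show "(\<lambda>\<omega>. if gmt_threshold \<alpha> p (T \<omega>) \<le> \<bar>T \<omega> j\<bar> \<and> sgn (T \<omega> j) = sgn (\<beta> $ j) then 1 else 0 :: real)
        \<in> borel_measurable M"
      by measurable
  qed
  have g_int: "integrable M g"
    by (rule integrable_const_bound[where B = 1]) (use g1 g_meas in auto)
  show "directional_power M \<alpha> p \<beta> T \<le> 1"
    unfolding dp using integral_le_const[OF g_int] g1 by simp
  define f where "f = (\<lambda>\<omega>. (\<Sum>j\<in>?S. indicator (bad j) \<omega> :: real) / real s)"
  have ind: "integrable M (indicat_real A)" if "A \<in> sets M" for A
    using that by (rule integrable_real_indicator) (simp add: less_top[symmetric])
  have f_int: "integrable M f" unfolding f_def
    by (intro integrable_divide_zero Bochner_Integration.integrable_sum ind bad(1))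
  have "(\<integral>\<omega>. f \<omega> \<partial>M) = (\<Sum>j\<in>?S. measure M (bad j)) / real s"
    unfolding f_def using bad(1)
    by (subst integral_divide_zero, subst Bochner_Integration.integral_sum) (auto intro: ind)
  also have "\<dots> \<le> (\<Sum>j\<in>?S. \<delta>) / real s" using bad by (intro divide_right_mono sum_mono) auto
  also have "\<dots> = \<delta>" using s by simp
  finally have Ef: "(\<integral>\<omega>. f \<omega> \<partial>M) \<le> \<delta>" .
  have f0: "0 \<le> f \<omega>" for \<omega> by (simp add: f_def sum_nonneg)
  have lower: "indicator \<Omega> \<omega> - 3 * f \<omega> \<le> g \<omega>" if "\<omega> \<in> space M" for \<omega>
  proof (cases "\<omega> \<in> \<Omega> \<and> f \<omega> \<le> 1 / 2")
    case False
    then show ?thesis using g1[of \<omega>] f0[of \<omega>] by (auto simp: indicator_def)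
  next
    case True
    define G where "G = {j\<in>?S. \<omega> \<notin> bad j}"
    have "real (card ?S) = (\<Sum>j\<in>?S. indicator (bad j) \<omega> + indicator (- bad j) \<omega>)"
      by (subst sum.cong[OF refl, of _ _ "\<lambda>_. 1"]) (auto simp: indicator_def)
    also have "\<dots> = real s * f \<omega> + real (card G)"
      using s finS by (simp add: sum.distrib f_def G_def indicator_def sum.If_cases)
        (auto intro!: arg_cong[where f = card])
    finally have cardG: "real (card G) = real s * (1 - f \<omega>)" using s by (simp add: algebra_simps)
    let ?\<tau> = "sqrt (2 * ln (2 * real p / (\<alpha> * real s))) + 2"
    have "card G \<le> card {j. j < p \<and> ?\<tau> \<le> \<bar>T \<omega> j\<bar>}"
      using good[of \<omega>] True Sp by (intro card_mono) (force simp: G_def)+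
    moreover have "real s * (1 / 2) \<le> real s * (1 - f \<omega>)" using True by (intro mult_left_mono) auto
    ultimately have "gmt_threshold \<alpha> p (T \<omega>) \<le> ?\<tau> + 1"
      using cardG by (intro gmt_threshold_le \<alpha> s(2) sp cutoff) auto
    then have "G \<subseteq> {j \<in> gmt_selected \<alpha> p (T \<omega>). sgn (T \<omega> j) = sgn (\<beta> $ j)}"
      using good[of \<omega>] True Sp by (force simp: G_def gmt_selected_def)
    then have "card G \<le> card {j \<in> gmt_selected \<alpha> p (T \<omega>). sgn (T \<omega> j) = sgn (\<beta> $ j)}"
      using finite_subset[OF sub finS] by (intro card_mono)
    then have "real s * (1 - f \<omega>) / real s \<le> g \<omega>"
      unfolding g_def cardG[symmetric] by (intro divide_right_mono) auto
    then show ?thesis using s True f0[of \<omega>] by simp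
  qed
  have "(\<integral>\<omega>. indicator \<Omega> \<omega> - 3 * f \<omega> \<partial>M) \<le> (\<integral>\<omega>. g \<omega> \<partial>M)"
    by (rule integral_mono) (use ind[OF \<Omega>] f_int g_int lower in auto)
  also have "(\<integral>\<omega>. indicator \<Omega> \<omega> - 3 * f \<omega> \<partial>M) = measure M \<Omega> - 3 * (\<integral>\<omega>. f \<omega> \<partial>M)"
    using ind[OF \<Omega>] f_int \<Omega> by simp
  finally show "measure M \<Omega> - 3 * \<delta> \<le> directional_power M \<alpha> p \<beta> T"
    using Ef dp by linarith
qed

section \<open>Positive definite matrices\<close>

definition bilin :: "nat \<Rightarrow> (nat \<Rightarrow> nat \<Rightarrow> real) \<Rightarrow> (nat \<Rightarrow> real) \<Rightarrow> (nat \<Rightarrow> real) \<Rightarrow> real" where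
  "bilin p B z w = (\<Sum>j<p. \<Sum>k<p. z j * B j k * w k)"

lemma bilin_mult: "bilin p B z w = (\<Sum>j<p. z j * (\<Sum>k<p. B j k * w k))"
  by (simp add: bilin_def sum_distrib_left mult.assoc)

lemma bilin_commute:
  assumes "\<And>j k. j < p \<Longrightarrow> k < p \<Longrightarrow> B j k = B k j"
  shows "bilin p B z w = bilin p B w z"
  unfolding bilin_def by (subst sum.swap) (auto intro!: sum.cong simp: assms)

lemma bilin_expand:
  assumes "\<And>j k. j < p \<Longrightarrow> k < p \<Longrightarrow> B j k = B k j"
  shows "bilin p B (\<lambda>j. z j + t * w j) (\<lambda>j. z j + t * w j)
    = bilin p B z z + 2 * t * bilin p B z w + t\<^sup>2 * bilin p B w w"
proof -
  have "bilin p B (\<lambda>j. z j + t * w j) (\<lambda>j. z j + t * w j)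
    = bilin p B z z + t * bilin p B z w + t * bilin p B w z + t\<^sup>2 * bilin p B w w"
    unfolding bilin_def sum_distrib_left sum.distrib[symmetric]
    by (intro sum.cong refl) (simp add: algebra_simps power2_eq_square)
  then show ?thesis using bilin_commute[of p B, OF assms, of w z] by simp
qed

text \<open>The discriminant of a nonnegative quadratic in \<open>t\<close>. Only semidefiniteness
  is available for \<open>A - m I\<close> below, so the leading coefficient may vanish; a
  nonnegative affine function is then constant.\<close>

lemma bilin_Cauchy_Schwarz:
  assumes sym: "\<And>j k. j < p \<Longrightarrow> k < p \<Longrightarrow> B j k = B k j"
    and psd: "\<And>z. 0 \<le> bilin p B z z"
  shows "(bilin p B z w)\<^sup>2 \<le> bilin p B z z * bilin p B w w"
proof -
  let ?a = "bilin p B z z" and ?b = "bilin p B z w" and ?c = "bilin p B w w"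
  have quad: "0 \<le> ?a + 2 * t * ?b + t\<^sup>2 * ?c" for t
    using psd[of "\<lambda>j. z j + t * w j"] bilin_expand[of p B, OF sym] by simp
  show ?thesis
  proof (cases "?c = 0")
    case True
    have "?b = 0"
    proof (rule ccontr)
      assume "?b \<noteq> 0"
      then have "2 * (- (?a + 1) / (2 * ?b)) * ?b = - (?a + 1)" by simp
      then show False using quad[of "- (?a + 1) / (2 * ?b)"] True by simp
    qed
    then show ?thesis using True by simp
  next
    case False
    then have c: "?c > 0" using psd[of w] by simp
    have "0 \<le> ?a + 2 * (- ?b / ?c) * ?b + (- ?b / ?c)\<^sup>2 * ?c" by (rule quad)
    also have "\<dots> = ?a - ?b\<^sup>2 / ?c" using c by (simp add: power2_eq_square field_simps)
    finally show ?thesis using c by (simp add: field_simps)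
  qed
qed

section \<open>Singular values, inverses and the operator norm\<close>

lemma mult_mat_vec_entry:
  "A \<in> carrier_mat p p \<Longrightarrow> v \<in> carrier_vec p \<Longrightarrow> i < p \<Longrightarrow>
    (A *\<^sub>v v) $ i = (\<Sum>k<p. A $$ (i, k) * v $ k)"
  by (auto simp: scalar_prod_def atLeast0LessThan)

lemma mult_mat_entry:
  "A \<in> carrier_mat p p \<Longrightarrow> B \<in> carrier_mat p p \<Longrightarrow> i < p \<Longrightarrow> j < p \<Longrightarrow>
    (A * B) $$ (i, j) = (\<Sum>k<p. A $$ (i, k) * B $$ (k, j))"
  by (auto simp: scalar_prod_def atLeast0LessThan)

text \<open>The \<open>Min\<close> in \<open>sigma_min\<close> is informative only over a finite
  set. Squares of singular values are roots of a characteristic polynomial, which is monic and hence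
  nonzero.\<close>

lemma finite_singular_values:
  assumes "A \<in> carrier_mat p p"
  shows "finite (singular_values A)"
proof -
  let ?G = "transpose_mat A * A"
  have G: "?G \<in> carrier_mat p p" using assms by simp
  then have "char_poly ?G \<noteq> 0" using degree_monic_char_poly[OF G] by auto
  then have "finite {k. eigenvalue ?G k}"
    using poly_roots_finite eigenvalue_root_char_poly[OF G] by simp
  then have "finite (sqrt ` {k. eigenvalue ?G k})" by simp
  moreover have "singular_values A \<subseteq> sqrt ` {k. eigenvalue ?G k}"
    by (force simp: singular_values_def)
  ultimately show ?thesis by (rule rev_finite_subset)
qed

lemma psd_eigenvalue_singular:
  assumes A: "A \<in> carrier_mat p p" and sym: "transpose_mat A = A"
    and v: "v \<in> carrier_vec p" "v \<noteq> 0\<^sub>v p" "A *\<^sub>v v = m \<cdot>\<^sub>v v" and m: "0 \<le> m"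
  shows "m \<in> singular_values A"
proof -
  have "(transpose_mat A * A) *\<^sub>v v = A *\<^sub>v (A *\<^sub>v v)"
    using A v by (simp add: sym assoc_mult_mat_vec)
  also have "\<dots> = m \<cdot>\<^sub>v (A *\<^sub>v v)" using A v by (simp add: mult_mat_vec)
  also have "\<dots> = m\<^sup>2 \<cdot>\<^sub>v v" using v by (simp add: smult_smult_assoc power2_eq_square)
  finally have "eigenvector (transpose_mat A * A) v (m\<^sup>2)"
    using A v unfolding eigenvector_def by auto
  then show ?thesis using m by (auto simp: singular_values_def eigenvalue_def)
qed

text \<open>The infimum \<open>m\<close> of the Rayleigh quotient is an eigenvalue: otherwise \<open>A - m I\<close> is positive
  semidefinite and invertible, hence bounded below by Cauchy-Schwarz, and \<open>m\<close> could be increased.\<close>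
lemma sigma_min_le_rayleigh:
  assumes A: "A \<in> carrier_mat p p" and sym: "transpose_mat A = A"
    and psd: "\<And>z. 0 \<le> bilin p (\<lambda>j k. A $$ (j, k)) z z"
  shows "sigma_min A * (\<Sum>j<p. (z j)\<^sup>2) \<le> bilin p (\<lambda>j k. A $$ (j, k)) z z"
proof (cases "(\<Sum>j<p. (z j)\<^sup>2) = 0")
  case True
  then show ?thesis using psd by simp
next
  case False
  define q where "q = (\<lambda>z. bilin p (\<lambda>j k. A $$ (j, k)) z z)"
  define s :: "(nat \<Rightarrow> real) \<Rightarrow> real" where "s = (\<lambda>z. \<Sum>j<p. (z j)\<^sup>2)"
  define Q where "Q = (\<lambda>z. q z / s z) ` {z. s z \<noteq> 0}"
  define m where "m = Inf Q"
  have s0: "0 \<le> s z" for z by (simp add: s_def sum_nonneg)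
  have Qne: "Q \<noteq> {}" using False by (auto simp: Q_def s_def)
  have Qbdd: "bdd_below Q"
    by (rule bdd_belowI[of _ 0]) (auto simp: Q_def q_def intro!: divide_nonneg_nonneg psd s0)
  have m0: "0 \<le> m" unfolding m_def
    by (rule cInf_greatest[OF Qne]) (auto simp: Q_def q_def intro!: divide_nonneg_nonneg psd s0)
  have ms: "m * s z \<le> q z" for z
  proof (cases "s z = 0")
    case False
    then have "m \<le> q z / s z" unfolding m_def by (intro cInf_lower Qbdd) (auto simp: Q_def)
    then show ?thesis using False s0[of z] by (simp add: field_simps)
  qed (simp add: q_def psd)
  have Asym: "A $$ (j, k) = A $$ (k, j)" if "j < p" "k < p" for j k
    using arg_cong[OF sym, of "\<lambda>M. M $$ (k, j)"] A that by simp
  define Am where "Am = A - m \<cdot>\<^sub>m 1\<^sub>m p"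
  have Am: "Am \<in> carrier_mat p p" unfolding Am_def by (rule minus_carrier_mat) simp
  define B where "B = (\<lambda>j k. Am $$ (j, k))"
  have B: "B j k = A $$ (j, k) - (if j = k then m else 0)" if "j < p" "k < p" for j k
    using that A by (simp add: B_def Am_def)
  have Bsym: "B j k = B k j" if "j < p" "k < p" for j k
    using B that Asym by simp
  have qB: "bilin p B z z = q z - m * s z" for z
  proof -
    have "bilin p B z z = (\<Sum>j<p. \<Sum>k<p. z j * A $$ (j, k) * z k - (if j = k then m * (z j)\<^sup>2 else 0))"
      unfolding bilin_def by (intro sum.cong refl) (simp add: B algebra_simps power2_eq_square)
    also have "\<dots> = q z - m * s z"
      by (simp add: sum_subtractf q_def bilin_def s_def sum_distrib_left sum.delta)
    finally show ?thesis .
  qed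
  have Bpsd: "0 \<le> bilin p B z z" for z using ms[of z] by (simp add: qB)
  have "det Am = 0"
  proof (rule ccontr)
    assume "det Am \<noteq> 0"
    from det_non_zero_imp_unit[OF Am this, of "()"]
    obtain D where D: "D \<in> carrier_mat p p" "Am * D = 1\<^sub>m p"
      by (auto simp: Units_def ring_mat_simps)
    \<comment> \<open>\<open>K\<close> bounds every entry of the inverse; the added 1 makes it
      positive.\<close>
    define K where "K = (\<Sum>j<p. \<Sum>k<p. \<bar>D $$ (j, k)\<bar>) + 1"
    have K: "K > 0" by (simp add: K_def sum_nonneg add_nonneg_pos)
    have DK: "\<bar>D $$ (j, k)\<bar> \<le> K" if "j < p" "k < p" for j k
    proof -
      have "\<bar>D $$ (j, k)\<bar> \<le> (\<Sum>k<p. \<bar>D $$ (j, k)\<bar>)"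
        using that by (intro member_le_sum) auto
      also have "\<dots> \<le> (\<Sum>j<p. \<Sum>k<p. \<bar>D $$ (j, k)\<bar>)"
        using that by (intro member_le_sum[of j "{..<p}" "\<lambda>j. \<Sum>k<p. \<bar>D $$ (j, k)\<bar>"])
          (auto intro: sum_nonneg)
      finally show ?thesis by (simp add: K_def)
    qed
    have p: "p > 0" using False by (cases p) auto
    have lower: "s z \<le> K * p * bilin p B z z" if "s z \<noteq> 0" for z
    proof -
      \<comment> \<open>With \<open>w\<close> the preimage of \<open>z\<close> under
        \<open>B\<close>, the mixed form is \<open>s z\<close>, and \<open>bilin p B w w\<close> is
        at most \<open>K * p * s z\<close>. Cauchy-Schwarz then bounds \<open>bilin p B z z\<close>
        from below by \<open>s z / (K * p)\<close>.\<close>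
      define w where "w = (\<lambda>j. \<Sum>k<p. D $$ (j, k) * z k)"
      have Bw: "(\<Sum>l<p. B j l * w l) = z j" if "j < p" for j
      proof -
        have "(\<Sum>l<p. B j l * w l) = (\<Sum>k<p. (\<Sum>l<p. B j l * D $$ (l, k)) * z k)"
          unfolding w_def sum_distrib_left sum_distrib_right
          by (subst sum.swap) (simp add: mult.assoc)
        also have "\<dots> = (\<Sum>k<p. if j = k then z k else 0)"
        proof (intro sum.cong refl)
          fix k assume "k \<in> {..<p}"
          then have "(\<Sum>l<p. B j l * D $$ (l, k)) = (1\<^sub>m p :: rmat) $$ (j, k)"
            using mult_mat_entry[OF Am D(1) that, of k] D(2) by (simp add: B_def)
          then show "(\<Sum>l<p. B j l * D $$ (l, k)) * z k = (if j = k then z k else 0)"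
            using \<open>k \<in> _\<close> that by simp
        qed
        finally show ?thesis using that by (simp add: sum.delta)
      qed
      have zw: "bilin p B z w = s z" unfolding bilin_mult s_def
        by (intro sum.cong refl) (simp add: Bw power2_eq_square)
      have "bilin p B w w = (\<Sum>j<p. w j * z j)"
        unfolding bilin_mult by (intro sum.cong refl) (simp add: Bw)
      also have "\<dots> = bilin p (\<lambda>j k. D $$ (j, k)) z z"
        unfolding bilin_mult by (simp add: w_def mult.commute)
      also have "\<dots> \<le> K * (\<Sum>j<p. \<bar>z j\<bar>)\<^sup>2"
        using abs_quadratic_form_le[of p "\<lambda>j k. D $$ (j, k)" K z] DK K by (simp add: bilin_def)
      also have "\<dots> \<le> K * (p * s z)"
        using sum_abs_le_sqrt_card[of z "{..<p}"] K by (simp add: s_def)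
      finally have "bilin p B w w \<le> K * p * s z" by simp
      then have "bilin p B z z * bilin p B w w \<le> bilin p B z z * (K * p * s z)"
        using Bpsd by (intro mult_left_mono)
      moreover have "(s z)\<^sup>2 \<le> bilin p B z z * bilin p B w w"
        using bilin_Cauchy_Schwarz[of p B z w, OF Bsym Bpsd] zw by simp
      ultimately have "s z * s z \<le> (K * p * bilin p B z z) * s z"
        by (simp add: power2_eq_square mult_ac)
      then show ?thesis using that s0[of z] by (simp add: mult_le_cancel_right)
    qed
    have "m + 1 / (K * p) \<le> Inf Q"
    proof (rule cInf_greatest[OF Qne])
      fix x assume "x \<in> Q"
      then obtain z where z: "s z \<noteq> 0" "x = q z / s z" by (auto simp: Q_def)
      then have "s z > 0" using s0[of z] by simp
      moreover have "s z \<le> K * p * (q z - m * s z)" using lower[OF z(1)] by (simp add: qB)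
      then have "s z / (K * p) \<le> q z - m * s z" using K p by (simp add: field_simps)
      ultimately show "m + 1 / (K * p) \<le> x" unfolding z(2)
        by (simp add: le_divide_eq algebra_simps)
    qed
    moreover have "1 / (K * p) > 0" using K p by simp
    ultimately show False by (simp add: m_def[symmetric])
  qed
  then obtain v where v: "v \<in> carrier_vec p" "v \<noteq> 0\<^sub>v p" "Am *\<^sub>v v = 0\<^sub>v p"
    using det_0_iff_vec_prod_zero_field[OF Am] by blast
  have "A *\<^sub>v v = m \<cdot>\<^sub>v v"
  proof
    fix i assume "i < dim_vec (m \<cdot>\<^sub>v v)"
    then have i: "i < p" using v by simp
    have "0 = (Am *\<^sub>v v) $ i" using v(3) i by simp
    also have "\<dots> = (\<Sum>k<p. A $$ (i, k) * v $ k - (if i = k then m * v $ k else 0))"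
      unfolding mult_mat_vec_entry[OF Am v(1) i]
    proof (intro sum.cong refl)
      fix k assume "k \<in> {..<p}"
      then have "Am $$ (i, k) = A $$ (i, k) - (if i = k then m else 0)"
        using B[OF i, of k] by (simp add: B_def)
      then show "Am $$ (i, k) * v $ k = A $$ (i, k) * v $ k - (if i = k then m * v $ k else 0)"
        by (simp only:) (simp add: left_diff_distrib)
    qed
    also have "\<dots> = (A *\<^sub>v v) $ i - m * v $ i"
      using i mult_mat_vec_entry[OF A v(1) i] by (simp add: sum_subtractf sum.delta)
    finally show "(A *\<^sub>v v) $ i = (m \<cdot>\<^sub>v v) $ i" using i v by simp
  qed (use A v in auto)
  then have "m \<in> singular_values A" using psd_eigenvalue_singular[OF A sym v(1,2)] m0 by blast
  then have "sigma_min A \<le> m"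
    unfolding sigma_min_def using finite_singular_values[OF A] by (intro Min_le)
  then have "sigma_min A * s z \<le> m * s z" using s0 by (intro mult_right_mono)
  then show ?thesis using ms[of z] by (simp add: s_def q_def)
qed

text \<open>Definiteness excludes kernel vectors, so \<open>mat_inverse\<close> returns a matrix and
  \<open>the\<close> is meaningful. The third conclusion is \<open>A T = I\<close> with
  \<open>T\<close> read by rows, the form that suits the CLIME estimates. The fourth is
  Cauchy-Schwarz in the form of \<open>A\<close> for a unit vector and a row of \<open>T\<close>,
  whose mixed form is 1.\<close>

lemma pos_def_inverse:
  assumes A: "A \<in> carrier_mat p p" and sym: "transpose_mat A = A"
    and pd: "\<And>z. c * (\<Sum>j<p. (z j)\<^sup>2) \<le> bilin p (\<lambda>j k. A $$ (j, k)) z z" and c: "c > 0"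
  defines "T \<equiv> the (mat_inverse A)"
  shows "T \<in> carrier_mat p p"
    and "\<And>j k. j < p \<Longrightarrow> k < p \<Longrightarrow> T $$ (j, k) = T $$ (k, j)"
    and "\<And>i j. i < p \<Longrightarrow> j < p \<Longrightarrow> (\<Sum>k<p. A $$ (i, k) * T $$ (j, k)) = (if i = j then 1 else 0)"
    and "\<And>j. j < p \<Longrightarrow> 1 \<le> A $$ (j, j) * T $$ (j, j)"
proof -
  have "det A \<noteq> 0"
  proof
    assume "det A = 0"
    then obtain v where v: "v \<in> carrier_vec p" "v \<noteq> 0\<^sub>v p" "A *\<^sub>v v = 0\<^sub>v p"
      using det_0_iff_vec_prod_zero_field[OF A] by blast
    have "bilin p (\<lambda>j k. A $$ (j, k)) (($) v) (($) v) = (\<Sum>j<p. v $ j * (A *\<^sub>v v) $ j)"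
      unfolding bilin_mult by (intro sum.cong refl) (simp add: mult_mat_vec_entry[OF A v(1)])
    also have "\<dots> = 0" using v(3) by simp
    finally have "c * (\<Sum>j<p. (v $ j)\<^sup>2) \<le> 0" using pd[of "($) v"] by simp
    then have "(\<Sum>j<p. (v $ j)\<^sup>2) \<le> 0" using c by (simp add: mult_le_0_iff)
    then have "(\<Sum>j<p. (v $ j)\<^sup>2) = 0" by (simp add: order_antisym sum_nonneg)
    then have "\<forall>j<p. v $ j = 0" by (simp add: sum_nonneg_eq_0_iff)
    then have "v = 0\<^sub>v p" using v(1) by (intro eq_vecI) auto
    with v(2) show False by simp
  qed
  from det_non_zero_imp_unit[OF A this]
  have "A \<in> Units (ring_mat TYPE(real) p ())" .
  with mat_inverse(1)[OF A] obtain T' where "mat_inverse A = Some T'" by fastforce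
  with mat_inverse(2)[OF A this] have T: "A * T = 1\<^sub>m p" "T * A = 1\<^sub>m p" "T \<in> carrier_mat p p"
    by (auto simp: T_def)
  show "T \<in> carrier_mat p p" by (rule T)
  have "transpose_mat T * A = 1\<^sub>m p"
    using arg_cong[OF T(1), of transpose_mat] A T(3) sym by (simp add: transpose_mult)
  then have "transpose_mat T * A * T = T" using T(3) by simp
  moreover have "transpose_mat T * A * T = transpose_mat T"
    using A T by (simp add: assoc_mult_mat[of _ p p _ p _ p])
  ultimately have "transpose_mat T = T" by simp
  then show Ts: "T $$ (j, k) = T $$ (k, j)" if "j < p" "k < p" for j k
    using that T(3) by (metis carrier_matD index_transpose_mat(1))
  show AT: "(\<Sum>k<p. A $$ (i, k) * T $$ (j, k)) = (if i = j then 1 else 0)" if "i < p" "j < p" for i j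
  proof -
    have "(\<Sum>k<p. A $$ (i, k) * T $$ (j, k)) = (A * T) $$ (i, j)"
      unfolding mult_mat_entry[OF A T(3) that] using Ts that by (intro sum.cong) auto
    then show ?thesis using T(1) that by simp
  qed
  show "1 \<le> A $$ (j, j) * T $$ (j, j)" if j: "j < p" for j
  proof -
    let ?B = "\<lambda>j k. A $$ (j, k)"
    define e :: "nat \<Rightarrow> real" where "e = (\<lambda>i. if i = j then 1 else 0)"
    have Asym: "A $$ (i, k) = A $$ (k, i)" if "i < p" "k < p" for i k
      using arg_cong[OF sym, of "\<lambda>M. M $$ (k, i)"] A that by simp
    have psd: "0 \<le> bilin p ?B z z" for z
      using pd[of z] c by (meson mult_nonneg_nonneg order_trans less_imp_le sum_nonneg zero_le_power2)
    have e: "(\<Sum>i<p. e i * f i) = f j" for f :: "nat \<Rightarrow> real"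
      using j by (simp add: e_def if_distrib[of "\<lambda>x. x * _"] sum.delta' cong: if_cong)
    have "bilin p ?B e (\<lambda>k. T $$ (j, k)) = 1"
      unfolding bilin_mult e using AT[OF j j] by simp
    moreover have "bilin p ?B e e = A $$ (j, j)"
      unfolding bilin_mult e using e[of "\<lambda>k. A $$ (j, k)"] by (simp add: mult.commute)
    moreover have "bilin p ?B (\<lambda>k. T $$ (j, k)) (\<lambda>k. T $$ (j, k)) = T $$ (j, j)"
    proof -
      have "bilin p ?B (\<lambda>k. T $$ (j, k)) (\<lambda>k. T $$ (j, k)) = (\<Sum>i<p. e i * T $$ (j, i))"
        unfolding bilin_mult by (intro sum.cong refl) (simp add: AT j e_def)
      then show ?thesis by (simp add: e)
    qed
    ultimately show ?thesis
      using bilin_Cauchy_Schwarz[of p ?B e "\<lambda>k. T $$ (j, k)", OF Asym psd] by simp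
  qed
qed

text \<open>Testing the supremum on a unit vector picks out a column. Most of the work is
  boundedness of the quotients, without which a real \<open>SUP\<close> says nothing; the sum of all
  absolute entries is a crude bound.\<close>

lemma op1_norm_column:
  assumes A: "A \<in> carrier_mat p p" and j: "j < p"
  shows "(\<Sum>i<p. \<bar>A $$ (i, j)\<bar>) \<le> op1_norm A"
proof -
  let ?V = "{v \<in> carrier_vec (dim_col A). v \<noteq> 0\<^sub>v (dim_col A)}"
  let ?f = "\<lambda>v. l1_norm (A *\<^sub>v v) / l1_norm v"
  have "?f v \<le> (\<Sum>i<p. \<Sum>k<p. \<bar>A $$ (i, k)\<bar>)" if "v \<in> ?V" for v
  proof -
    have v: "v \<in> carrier_vec p" "v \<noteq> 0\<^sub>v p" using that A by auto
    then obtain i where i: "i < p" "v $ i \<noteq> 0" by (metis carrier_vecD eq_vecI index_zero_vec)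
    have dv: "dim_vec v = p" using v by simp
    have "\<bar>v $ i\<bar> \<le> l1_norm v" unfolding l1_norm_def dv using i by (intro member_le_sum) auto
    then have lv: "0 < l1_norm v" using i by simp
    have "l1_norm (A *\<^sub>v v) = (\<Sum>i<p. \<bar>\<Sum>k<p. A $$ (i, k) * v $ k\<bar>)"
      using A v by (simp add: l1_norm_def mult_mat_vec_entry[symmetric] del: index_mult_mat_vec)
    also have "\<dots> \<le> (\<Sum>i<p. \<Sum>k<p. \<bar>A $$ (i, k)\<bar> * l1_norm v)"
    proof (intro sum_mono order_trans[OF sum_abs])
      fix i k assume "i \<in> {..<p}" "k \<in> {..<p}"
      then have "\<bar>v $ k\<bar> \<le> l1_norm v" unfolding l1_norm_def dv by (intro member_le_sum) auto
      then show "\<bar>A $$ (i, k) * v $ k\<bar> \<le> \<bar>A $$ (i, k)\<bar> * l1_norm v"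
        by (simp add: abs_mult mult_left_mono)
    qed
    finally show ?thesis using lv by (simp add: divide_le_eq sum_distrib_right)
  qed
  then have bdd: "bdd_above (?f ` ?V)" by (auto intro!: bdd_aboveI2)
  have uV: "unit_vec p j \<in> ?V" using A j by (simp add: unit_vec_nonzero)
  have "A *\<^sub>v unit_vec p j = col A j" using A j by (intro eq_vecI) auto
  moreover have "l1_norm (unit_vec p j) = 1"
    using j by (simp add: l1_norm_def if_distrib[of abs] sum.delta' unit_vec_def cong: if_cong)
  ultimately have "?f (unit_vec p j) = (\<Sum>i<p. \<bar>A $$ (i, j)\<bar>)"
    using A j by (simp add: l1_norm_def)
  then show ?thesis unfolding op1_norm_def using cSUP_upper[OF uV bdd] by simp
qed

section \<open>Concentration of the score and of the sample information\<close>

text \<open>Chernoff's bound at \<open>l = \<epsilon> / V\<close>, which minimises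
  \<open>V * l\<^sup>2 / 2 - l * \<epsilon>\<close>. The moment generating functions are nonnegative
  integrals, so no integrability of exponentials has to be tracked.\<close>

lemma (in prob_space) subgaussian_sum_tail:
  fixes W :: "'b \<Rightarrow> 'a \<Rightarrow> real" and \<epsilon> V :: real
  assumes I: "finite I" "I \<noteq> {}" and ind: "indep_vars (\<lambda>_. borel) W I"
    and mgf: "\<And>i l. i \<in> I \<Longrightarrow> (\<integral>\<^sup>+\<omega>. ennreal (exp (l * W i \<omega>)) \<partial>M) \<le> ennreal (exp (V * l\<^sup>2 / 2))"
    and V: "V > 0" and \<epsilon>: "\<epsilon> > 0"
  shows "prob {\<omega>\<in>space M. \<epsilon> \<le> \<bar>(\<Sum>i\<in>I. W i \<omega>) / card I\<bar>} \<le> 2 * exp (- (card I * \<epsilon>\<^sup>2 / (2 * V)))"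
proof -
  define m where "m = real (card I)"
  have m: "m > 0" using I by (simp add: m_def card_gt_0_iff)
  have [measurable]: "W i \<in> borel_measurable M" if "i \<in> I" for i
    using ind that by (auto simp: indep_vars_def)
  define l where "l = \<epsilon> / V"
  have l: "l > 0" using V \<epsilon> by (simp add: l_def)
  \<comment> \<open>Taking \<open>c = 1\<close> and \<open>c = - 1\<close> covers the two
    tails.\<close>
  have one: "prob {\<omega>\<in>space M. m * \<epsilon> \<le> c * (\<Sum>i\<in>I. W i \<omega>)} \<le> exp (- (m * \<epsilon>\<^sup>2 / (2 * V)))"
    if c: "c\<^sup>2 = 1" for c :: real
  proof -
    have "ennreal (prob {\<omega>\<in>space M. m * \<epsilon> \<le> c * (\<Sum>i\<in>I. W i \<omega>)})
        = emeasure M {\<omega>\<in>space M. m * \<epsilon> \<le> c * (\<Sum>i\<in>I. W i \<omega>)}"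
      by (simp add: emeasure_eq_measure)
    also have "\<dots> \<le> ennreal (exp (- l * (m * \<epsilon>))) *
        (\<integral>\<^sup>+\<omega>. ennreal (exp (l * (c * (\<Sum>i\<in>I. W i \<omega>)))) * indicator (space M) \<omega> \<partial>M)"
      by (rule Chernoff_ineq_nn_integral_ge[OF l]) measurable
    also have "(\<integral>\<^sup>+\<omega>. ennreal (exp (l * (c * (\<Sum>i\<in>I. W i \<omega>)))) * indicator (space M) \<omega> \<partial>M)
        = (\<integral>\<^sup>+\<omega>. (\<Prod>i\<in>I. ennreal (exp (l * c * W i \<omega>))) \<partial>M)"
    proof (intro nn_integral_cong)
      fix \<omega> assume "\<omega> \<in> space M"
      have "exp (l * (c * (\<Sum>i\<in>I. W i \<omega>))) = exp (\<Sum>i\<in>I. l * c * W i \<omega>)"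
        by (simp only: sum_distrib_left mult.assoc)
      also have "\<dots> = (\<Prod>i\<in>I. exp (l * c * W i \<omega>))" by (rule exp_sum[OF I(1)])
      finally show "ennreal (exp (l * (c * (\<Sum>i\<in>I. W i \<omega>)))) * indicator (space M) \<omega>
          = (\<Prod>i\<in>I. ennreal (exp (l * c * W i \<omega>)))"
        using \<open>\<omega> \<in> space M\<close> by (simp only: indicator_simps mult_1_right prod_ennreal exp_ge_zero)
    qed
    also have "\<dots> = (\<Prod>i\<in>I. \<integral>\<^sup>+\<omega>. ennreal (exp (l * c * W i \<omega>)) \<partial>M)"
    proof (rule indep_vars_nn_integral[OF I(1)])
      show "indep_vars (\<lambda>_. borel) (\<lambda>i \<omega>. ennreal (exp (l * c * W i \<omega>))) I"
        by (rule indep_vars_compose2[OF ind, where Y = "\<lambda>_ x. ennreal (exp (l * c * x))"]) measurable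
    qed simp
    also have "ennreal (exp (- l * (m * \<epsilon>))) * \<dots>
        \<le> ennreal (exp (- l * (m * \<epsilon>))) * (\<Prod>i\<in>I. ennreal (exp (V * (l * c)\<^sup>2 / 2)))"
      by (intro mult_left_mono prod_mono_ennreal mgf) simp_all
    also have "(\<Prod>i\<in>I. ennreal (exp (V * (l * c)\<^sup>2 / 2))) = ennreal (exp (m * (V * l\<^sup>2 / 2)))"
    proof -
      have "(l * c)\<^sup>2 = l\<^sup>2" using c by (simp only: power_mult_distrib mult_1_right)
      then show ?thesis unfolding m_def exp_of_nat_mult by (simp only: prod_constant ennreal_power exp_ge_zero)
    qed
    also have "ennreal (exp (- l * (m * \<epsilon>))) * \<dots> = ennreal (exp (- l * (m * \<epsilon>) + m * (V * l\<^sup>2 / 2)))"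
      unfolding exp_add by (rule ennreal_mult[symmetric]) simp_all
    also have "- l * (m * \<epsilon>) + m * (V * l\<^sup>2 / 2) = - (m * \<epsilon>\<^sup>2 / (2 * V))"
    proof -
      have "V * l\<^sup>2 = \<epsilon> * l" using V by (simp add: l_def power2_eq_square)
      then have "- l * (m * \<epsilon>) + m * (V * l\<^sup>2 / 2) = - (m * (\<epsilon> * l) / 2)" by simp
      then show ?thesis by (simp add: l_def power2_eq_square)
    qed
    finally show ?thesis by (simp only: ennreal_le_iff exp_ge_zero)
  qed
  have split: "{\<omega>\<in>space M. \<epsilon> \<le> \<bar>(\<Sum>i\<in>I. W i \<omega>) / card I\<bar>} =
      {\<omega>\<in>space M. m * \<epsilon> \<le> 1 * (\<Sum>i\<in>I. W i \<omega>)} \<union> {\<omega>\<in>space M. m * \<epsilon> \<le> (- 1) * (\<Sum>i\<in>I. W i \<omega>)}"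
  proof -
    have "\<epsilon> \<le> \<bar>S / m\<bar> \<longleftrightarrow> m * \<epsilon> \<le> 1 * S \<or> m * \<epsilon> \<le> (- 1) * S" for S
    proof -
      have "\<epsilon> \<le> \<bar>S / m\<bar> \<longleftrightarrow> \<epsilon> * m \<le> \<bar>S\<bar>" using m by (simp add: pos_le_divide_eq)
      also have "\<dots> \<longleftrightarrow> m * \<epsilon> \<le> 1 * S \<or> m * \<epsilon> \<le> (- 1) * S" by (auto simp: mult.commute)
      finally show ?thesis .
    qed
    then show ?thesis unfolding m_def[symmetric] by blast
  qed
  have "prob {\<omega>\<in>space M. \<epsilon> \<le> \<bar>(\<Sum>i\<in>I. W i \<omega>) / card I\<bar>}
      \<le> prob {\<omega>\<in>space M. m * \<epsilon> \<le> 1 * (\<Sum>i\<in>I. W i \<omega>)}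
      + prob {\<omega>\<in>space M. m * \<epsilon> \<le> (- 1) * (\<Sum>i\<in>I. W i \<omega>)}"
    unfolding split by (rule measure_Un_le) measurable
  also have "\<dots> \<le> 2 * exp (- (m * \<epsilon>\<^sup>2 / (2 * V)))"
    using one[OF power_one] one[OF power2_minus[of 1, unfolded power_one]] by linarith
  finally show ?thesis by (simp add: m_def)
qed

text \<open>A product of two independent integrable variables is integrable, so the cross terms
  exist, and they vanish by centring.\<close>

lemma (in prob_space) indep_sum_second_moment:
  fixes W :: "'b \<Rightarrow> 'a \<Rightarrow> real"
  assumes I: "finite I" and ind: "indep_vars (\<lambda>_. borel) W I"
    and int: "\<And>i. i \<in> I \<Longrightarrow> integrable M (W i)" and mean: "\<And>i. i \<in> I \<Longrightarrow> expectation (W i) = 0"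
    and sq: "\<And>i. i \<in> I \<Longrightarrow> integrable M (\<lambda>\<omega>. (W i \<omega>)\<^sup>2)"
  shows "integrable M (\<lambda>\<omega>. (\<Sum>i\<in>I. W i \<omega>)\<^sup>2)"
    and "expectation (\<lambda>\<omega>. (\<Sum>i\<in>I. W i \<omega>)\<^sup>2) = (\<Sum>i\<in>I. expectation (\<lambda>\<omega>. (W i \<omega>)\<^sup>2))"
proof -
  have cross: "integrable M (\<lambda>\<omega>. W i \<omega> * W j \<omega>) \<and> expectation (\<lambda>\<omega>. W i \<omega> * W j \<omega>) = 0"
    if "i \<in> I" "j \<in> I" "i \<noteq> j" for i j
  proof -
    have sub: "indep_vars (\<lambda>_. borel) W {i, j}"
      by (rule indep_vars_subset[OF ind]) (use that in auto)
    have "integrable M (\<lambda>\<omega>. \<Prod>k\<in>{i, j}. W k \<omega>)"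
      by (rule indep_vars_integrable[OF _ sub]) (use that int in auto)
    moreover have "expectation (\<lambda>\<omega>. \<Prod>k\<in>{i, j}. W k \<omega>) = (\<Prod>k\<in>{i, j}. expectation (W k))"
      by (rule indep_vars_lebesgue_integral[OF _ sub]) (use that int in auto)
    ultimately show ?thesis using that mean by simp
  qed
  have prod: "integrable M (\<lambda>\<omega>. W i \<omega> * W j \<omega>)" if "i \<in> I" "j \<in> I" for i j
    using cross[OF that] sq that by (cases "i = j") (auto simp: power2_eq_square)
  have eq: "(\<Sum>i\<in>I. W i \<omega>)\<^sup>2 = (\<Sum>i\<in>I. \<Sum>j\<in>I. W i \<omega> * W j \<omega>)" for \<omega>
    by (simp add: power2_eq_square sum_product)
  show "integrable M (\<lambda>\<omega>. (\<Sum>i\<in>I. W i \<omega>)\<^sup>2)"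
    unfolding eq using prod by (intro Bochner_Integration.integrable_sum)
  have "expectation (\<lambda>\<omega>. (\<Sum>i\<in>I. W i \<omega>)\<^sup>2) = (\<Sum>i\<in>I. \<Sum>j\<in>I. expectation (\<lambda>\<omega>. W i \<omega> * W j \<omega>))"
  proof -
    have "expectation (\<lambda>\<omega>. (\<Sum>i\<in>I. W i \<omega>)\<^sup>2) = (\<Sum>i\<in>I. expectation (\<lambda>\<omega>. \<Sum>j\<in>I. W i \<omega> * W j \<omega>))"
      unfolding eq
      by (intro Bochner_Integration.integral_sum Bochner_Integration.integrable_sum prod)
    also have "\<dots> = (\<Sum>i\<in>I. \<Sum>j\<in>I. expectation (\<lambda>\<omega>. W i \<omega> * W j \<omega>))"
      by (rule sum.cong[OF refl], rule Bochner_Integration.integral_sum, rule prod)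
    finally show ?thesis .
  qed
  also have "\<dots> = (\<Sum>i\<in>I. \<Sum>j\<in>I. if i = j then expectation (\<lambda>\<omega>. (W i \<omega>)\<^sup>2) else 0)"
    using cross by (intro sum.cong refl) (auto simp: power2_eq_square)
  finally show "expectation (\<lambda>\<omega>. (\<Sum>i\<in>I. W i \<omega>)\<^sup>2) = (\<Sum>i\<in>I. expectation (\<lambda>\<omega>. (W i \<omega>)\<^sup>2))"
    using I by (simp add: sum.delta)
qed

text \<open>Convexity of \<open>exp\<close> replaces the random exponent \<open>s w\<close> by the two deterministic exponents
  \<open>\<plusminus> s A\<close>, for which the conditional moment generating function is controlled.\<close>
lemma (in prob_space) weighted_subgaussian_mgf:
  assumes F: "subalgebra M F" and Z: "cond_subgaussian M F Z v"
    and proxy: "AE \<omega> in M. v \<omega> \<le> c\<^sup>2"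
    and w: "w \<in> borel_measurable F" "AE \<omega> in M. \<bar>w \<omega>\<bar> \<le> A" and A: "A > 0"
  shows "(\<integral>\<^sup>+\<omega>. ennreal (exp (s * (w \<omega> * Z \<omega>))) \<partial>M) \<le> ennreal (exp (A\<^sup>2 * c\<^sup>2 * s\<^sup>2 / 2))"
proof -
  interpret finite_measure_subalgebra M F using F by unfold_locales
  have [measurable]: "Z \<in> borel_measurable M" using Z by (auto simp: cond_subgaussian_def)
  note [measurable] = w(1) measurable_from_subalg[OF F w(1)]
  have mgf: "AE \<omega> in M. nn_cond_exp M F (\<lambda>\<omega>. ennreal (exp (t * Z \<omega>))) \<omega> \<le> ennreal (exp (v \<omega> * t\<^sup>2 / 2))"
    for t using Z by (auto simp: cond_subgaussian_def)
  \<comment> \<open>The weight in \<open>w = q * A + (1 - q) * (- A)\<close>. Since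
    \<open>\<bar>w \<omega>\<bar> \<le> A\<close> holds only almost surely, it is clipped to lie in
    \<open>[0, 1]\<close> everywhere, which keeps it measurable with respect to
    \<open>F\<close>.\<close>
  define q where "q = (\<lambda>\<omega>. max 0 (min 1 ((1 + w \<omega> / A) / 2)))"
  have q01: "0 \<le> q \<omega>" "q \<omega> \<le> 1" for \<omega> by (auto simp: q_def)
  have qF [measurable]: "q \<in> borel_measurable F" unfolding q_def by measurable
  note [measurable] = measurable_from_subalg[OF F qF]
  define K where "K = ennreal (exp (c\<^sup>2 * (s * A)\<^sup>2 / 2))"
  \<comment> \<open>A factor measurable with respect to \<open>F\<close> passes through the
    conditional expectation; the two exponents \<open>s * A\<close> and \<open>- (s * A)\<close>
    have the same square and hence the same bound \<open>K\<close>.\<close>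
  have part: "(\<integral>\<^sup>+\<omega>. ennreal (r \<omega>) * ennreal (exp (t * Z \<omega>)) \<partial>M) \<le> (\<integral>\<^sup>+\<omega>. ennreal (r \<omega>) * K \<partial>M)"
    if [measurable]: "r \<in> borel_measurable F" and t: "t\<^sup>2 = (s * A)\<^sup>2" for r :: "'a \<Rightarrow> real" and t
  proof -
    have "(\<integral>\<^sup>+\<omega>. ennreal (r \<omega>) * ennreal (exp (t * Z \<omega>)) \<partial>M)
        = (\<integral>\<^sup>+\<omega>. ennreal (r \<omega>) * nn_cond_exp M F (\<lambda>\<omega>. ennreal (exp (t * Z \<omega>))) \<omega> \<partial>M)"
      by (rule nn_cond_exp_intg[symmetric]) measurable
    also have "\<dots> \<le> (\<integral>\<^sup>+\<omega>. ennreal (r \<omega>) * K \<partial>M)"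
    proof (intro nn_integral_mono_AE)
      show "AE \<omega> in M. ennreal (r \<omega>) * nn_cond_exp M F (\<lambda>\<omega>. ennreal (exp (t * Z \<omega>))) \<omega> \<le> ennreal (r \<omega>) * K"
        using mgf[of t] proxy
      proof eventually_elim
        case (elim \<omega>)
        have "v \<omega> * t\<^sup>2 / 2 \<le> c\<^sup>2 * (s * A)\<^sup>2 / 2" unfolding t using elim by (intro divide_right_mono mult_right_mono) auto
        then have "ennreal (exp (v \<omega> * t\<^sup>2 / 2)) \<le> K" unfolding K_def by (intro ennreal_leI) simp
        with elim show ?case by (intro mult_left_mono) auto
      qed
    qed
    finally show ?thesis .
  qed
  have "(\<integral>\<^sup>+\<omega>. ennreal (exp (s * (w \<omega> * Z \<omega>))) \<partial>M)
      \<le> (\<integral>\<^sup>+\<omega>. ennreal (q \<omega>) * ennreal (exp (s * A * Z \<omega>))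
        + ennreal (1 - q \<omega>) * ennreal (exp (- (s * A) * Z \<omega>)) \<partial>M)"
  proof (intro nn_integral_mono_AE)
    show "AE \<omega> in M. ennreal (exp (s * (w \<omega> * Z \<omega>))) \<le> ennreal (q \<omega>) * ennreal (exp (s * A * Z \<omega>))
        + ennreal (1 - q \<omega>) * ennreal (exp (- (s * A) * Z \<omega>))"
      using w(2)
    proof eventually_elim
      case (elim \<omega>)
      then have "- 1 \<le> w \<omega> / A" "w \<omega> / A \<le> 1" using A by (auto simp: le_divide_eq)
      then have q: "q \<omega> = (1 + w \<omega> / A) / 2" by (simp add: q_def)
      have "s * (w \<omega> * Z \<omega>) = (1 - (1 - q \<omega>)) * (s * A * Z \<omega>) + (1 - q \<omega>) * (- (s * A) * Z \<omega>)"
        using A by (simp add: q field_simps)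
      also have "exp (\<dots>) \<le> (1 - (1 - q \<omega>)) * exp (s * A * Z \<omega>) + (1 - q \<omega>) * exp (- (s * A) * Z \<omega>)"
        using convex_onD[OF convex_on_exp[of 1], of "1 - q \<omega>" "s * A * Z \<omega>" "- (s * A) * Z \<omega>"] q01[of \<omega>]
        by simp
      finally have "exp (s * (w \<omega> * Z \<omega>)) \<le> q \<omega> * exp (s * A * Z \<omega>) + (1 - q \<omega>) * exp (- (s * A) * Z \<omega>)"
        by simp
      then show ?case using q01[of \<omega>]
        by (simp add: ennreal_mult[symmetric] ennreal_plus[symmetric] ennreal_leI del: ennreal_plus)
    qed
  qed
  also have "\<dots> = (\<integral>\<^sup>+\<omega>. ennreal (q \<omega>) * ennreal (exp (s * A * Z \<omega>)) \<partial>M)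
      + (\<integral>\<^sup>+\<omega>. ennreal (1 - q \<omega>) * ennreal (exp (- (s * A) * Z \<omega>)) \<partial>M)"
    by (rule nn_integral_add) measurable
  also have "\<dots> \<le> (\<integral>\<^sup>+\<omega>. ennreal (q \<omega>) * K \<partial>M) + (\<integral>\<^sup>+\<omega>. ennreal (1 - q \<omega>) * K \<partial>M)"
    by (intro add_mono part) (auto simp: power2_eq_square)
  also have "\<dots> = (\<integral>\<^sup>+\<omega>. ennreal (q \<omega>) * K + ennreal (1 - q \<omega>) * K \<partial>M)"
    by (rule nn_integral_add[symmetric]) measurable
  also have "\<dots> = (\<integral>\<^sup>+\<omega>. K \<partial>M)"
    using q01 by (intro nn_integral_cong)
      (simp add: distrib_right[symmetric] ennreal_plus[symmetric] del: ennreal_plus)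
  also have "\<dots> = K" by (simp add: emeasure_space_1)
  finally show ?thesis by (simp add: K_def power_mult_distrib mult_ac)
qed

section \<open>Moments and tails of random data at one sample size\<close>

locale glm_data = glm_loss +
  fixes M :: "'w measure" and p n :: nat and X :: "nat \<Rightarrow> 'w \<Rightarrow> rvec" and Y :: "nat \<Rightarrow> 'w \<Rightarrow> real"
    and \<beta> :: rvec and v :: "nat \<Rightarrow> real \<Rightarrow> real" and L c B D :: real
  assumes iid: "iid_data M p n X Y" and \<beta>: "\<beta> \<in> carrier_vec p" and n: "n \<ge> 1" and p: "p \<ge> 1"
    and X_bounded: "AE \<omega> in M. \<forall>i<n. linf_norm (X i \<omega>) \<le> L" and L: "L > 0"
    and \<beta>_bounded: "l1_norm \<beta> \<le> B"
    and D: "D > 0" "\<And>u. \<bar>u\<bar> \<le> L * B \<Longrightarrow> \<bar>deriv (deriv b) u\<bar> \<le> D"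
    and c: "c > 0"
    and subgaussian: "\<And>i. i < n \<Longrightarrow> cond_subgaussian M (covariate_algebra M p X {..<n})
        (\<lambda>\<omega>. Y i \<omega> - real_cond_exp M (covariate_algebra M p X {i}) (Y i) \<omega>)
        (\<lambda>\<omega>. v i (X i \<omega> \<bullet> \<beta>))"
    and proxy: "AE \<omega> in M. \<forall>i<n. v i (X i \<omega> \<bullet> \<beta>) \<le> c\<^sup>2"
    and cond_mean: "\<And>i. i < n \<Longrightarrow>
      AE \<omega> in M. real_cond_exp M (covariate_algebra M p X {i}) (Y i) \<omega> = deriv b (X i \<omega> \<bullet> \<beta>)"
    and cond_var: "\<And>i. i < n \<Longrightarrow> AE \<omega> in M. 0 < deriv (deriv b) (X i \<omega> \<bullet> \<beta>) \<and>
       cond_variance M (covariate_algebra M p X {i}) (Y i) \<omega> = ennreal (deriv (deriv b) (X i \<omega> \<bullet> \<beta>))"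
begin

sublocale prob_space M using iid by (simp add: iid_data_def)

definition obs :: "nat \<Rightarrow> 'w \<Rightarrow> (nat \<Rightarrow> real) \<times> real" where
  "obs i \<omega> = (\<lambda>j\<in>{..<p}. X i \<omega> $ j, Y i \<omega>)"

lemma obs_indep: "indep_vars (\<lambda>_. data_space p) obs {..<n}"
  using iid by (simp add: iid_data_def Let_def obs_def[abs_def])

lemma obs_measurable: "i < n \<Longrightarrow> obs i \<in> measurable M (data_space p)"
  using obs_indep by (auto simp: indep_vars_def)

lemma obs_distr: "i < n \<Longrightarrow> distr M (data_space p) (obs i) = distr M (data_space p) (obs 0)"
  using iid unfolding iid_data_def Let_def obs_def[abs_def] by blast

lemma coord_data_measurable [measurable]:
  "j < p \<Longrightarrow> (\<lambda>d. fst d j) \<in> borel_measurable (data_space p)"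
  "snd \<in> borel_measurable (data_space p)"
proof -
  show "(\<lambda>d. fst d j) \<in> borel_measurable (data_space p)" if "j < p"
    unfolding data_space_def
    by (rule measurable_compose[OF measurable_fst measurable_component_singleton]) (use that in simp)
  show "snd \<in> borel_measurable (data_space p)" unfolding data_space_def by (rule measurable_snd)
qed

lemma X_measurable [measurable]: "i < n \<Longrightarrow> j < p \<Longrightarrow> (\<lambda>\<omega>. X i \<omega> $ j) \<in> borel_measurable M"
proof -
  assume "i < n" "j < p"
  from measurable_compose[OF obs_measurable[OF this(1)] coord_data_measurable(1)[OF this(2)]]
  show ?thesis using \<open>j < p\<close> by (simp add: obs_def)
qed

lemma Y_measurable [measurable]: "i < n \<Longrightarrow> Y i \<in> borel_measurable M"
proof -
  assume "i < n"
  from measurable_compose[OF obs_measurable[OF this] coord_data_measurable(2)]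
  show ?thesis by (simp add: obs_def)
qed

lemma lin_eq: "X i \<omega> \<bullet> \<beta> = (\<Sum>j<p. X i \<omega> $ j * \<beta> $ j)"
  using \<beta> by (simp add: scalar_prod_def atLeast0LessThan)

text \<open>Conditioning takes place on two kinds of algebra: mean and variance of a response are
  given its own covariates, \<open>I = {i}\<close>, while the sub-Gaussian bound is conditional on
  all covariates, \<open>I = {..<n}\<close>.\<close>

lemma covariate_subalgebra:
  assumes "I \<subseteq> {..<n}"
  shows "subalgebra M (covariate_algebra M p X I)"
proof -
  have "(\<lambda>\<omega>. \<lambda>i\<in>I. \<lambda>j\<in>{..<p}. X i \<omega> $ j) \<in> measurable M (\<Pi>\<^sub>M i\<in>I. \<Pi>\<^sub>M j\<in>{..<p}. borel)"
    using assms by (intro measurable_restrict X_measurable) auto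
  then show ?thesis
    unfolding subalgebra_def covariate_algebra_def
    by (auto simp: space_vimage_algebra sets_vimage_algebra measurable_sets
        intro!: sets.sigma_sets_subset)
qed

lemma X_covariate_measurable [measurable]:
  assumes "i \<in> I" "I \<subseteq> {..<n}" "j < p"
  shows "(\<lambda>\<omega>. X i \<omega> $ j) \<in> borel_measurable (covariate_algebra M p X I)"
proof -
  have "(\<lambda>\<omega>. \<lambda>i\<in>I. \<lambda>j\<in>{..<p}. X i \<omega> $ j)
      \<in> measurable (covariate_algebra M p X I) (\<Pi>\<^sub>M i\<in>I. \<Pi>\<^sub>M j\<in>{..<p}. borel)"
    unfolding covariate_algebra_def
    by (intro measurable_vimage_algebra1) (auto simp: space_PiM PiE_def Pi_def)
  from measurable_compose[OF this measurable_component_singleton[OF assms(1)]]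
  have "(\<lambda>\<omega>. \<lambda>j\<in>{..<p}. X i \<omega> $ j) \<in> measurable (covariate_algebra M p X I) (\<Pi>\<^sub>M j\<in>{..<p}. borel)"
    using assms by simp
  from measurable_compose[OF this measurable_component_singleton[of j]] assms
  show ?thesis by simp
qed

lemma entries_bounded: "AE \<omega> in M. \<forall>i<n. \<forall>j<p. \<bar>X i \<omega> $ j\<bar> \<le> L"
  using X_bounded AE_space
proof eventually_elim
  case (elim \<omega>)
  show ?case
  proof (intro allI impI)
    fix i j assume i: "i < n" and j: "j < p"
    have "X i \<omega> \<in> carrier_vec p" using iid i elim by (simp add: iid_data_def)
    then have "\<bar>X i \<omega> $ j\<bar> \<le> linf_norm (X i \<omega>)"
      unfolding linf_norm_def using j by (intro Max_ge) auto
    also have "\<dots> \<le> L" using elim i by simp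
    finally show "\<bar>X i \<omega> $ j\<bar> \<le> L" .
  qed
qed

lemma wlin_bounded:
  "AE \<omega> in M. \<forall>i<n. \<forall>\<theta>. \<bar>\<Sum>j<p. X i \<omega> $ j * \<theta> j\<bar> \<le> L * (\<Sum>j<p. \<bar>\<theta> j\<bar>)"
  using entries_bounded by eventually_elim (auto intro!: abs_sum_mult_le)

lemma hess_weight_bounded: "AE \<omega> in M. \<forall>i<n. \<bar>b'' (X i \<omega> \<bullet> \<beta>)\<bar> \<le> D"
  using wlin_bounded
proof eventually_elim
  case (elim \<omega>)
  show ?case
  proof (intro allI impI D(2))
    fix i assume "i < n"
    then have "\<bar>X i \<omega> \<bullet> \<beta>\<bar> \<le> L * (\<Sum>j<p. \<bar>\<beta> $ j\<bar>)" using elim by (simp add: lin_eq)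
    also have "(\<Sum>j<p. \<bar>\<beta> $ j\<bar>) \<le> B" using \<beta>_bounded \<beta> by (simp add: l1_norm_def)
    finally show "\<bar>X i \<omega> \<bullet> \<beta>\<bar> \<le> L * B" using L by simp
  qed
qed

definition noise :: "nat \<Rightarrow> 'w \<Rightarrow> real" where
  "noise i \<omega> = Y i \<omega> - deriv b (X i \<omega> \<bullet> \<beta>)"

text \<open>One summand of the score paired with \<open>\<theta>\<close>. A unit vector gives a
  coordinate of the score, a row of the inverse information gives the noise in a test
  statistic.\<close>

definition wnoise :: "(nat \<Rightarrow> real) \<Rightarrow> nat \<Rightarrow> 'w \<Rightarrow> real" where
  "wnoise \<theta> i \<omega> = (\<Sum>j<p. X i \<omega> $ j * \<theta> j) * noise i \<omega>"

lemma noise_AE: "i < n \<Longrightarrow> AE \<omega> in M. Y i \<omega> - real_cond_exp M (covariate_algebra M p X {i}) (Y i) \<omega> = noise i \<omega>"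
  using cond_mean[of i] by (auto simp: noise_def)

lemma lin_measurable [measurable]: "i < n \<Longrightarrow> (\<lambda>\<omega>. X i \<omega> \<bullet> \<beta>) \<in> borel_measurable M"
  unfolding lin_eq by measurable

lemma noise_measurable [measurable]: "i < n \<Longrightarrow> noise i \<in> borel_measurable M"
  unfolding noise_def[abs_def] by measurable

lemma wnoise_measurable [measurable]: "i < n \<Longrightarrow> wnoise \<theta> i \<in> borel_measurable M"
  unfolding wnoise_def[abs_def] by measurable

lemma indep_function_obs:
  assumes "g \<in> borel_measurable (data_space p)" "\<And>i \<omega>. i < n \<Longrightarrow> W i \<omega> = g (obs i \<omega>)"
  shows "indep_vars (\<lambda>_. borel) W {..<n}"
proof -
  have "indep_vars (\<lambda>_. borel) (\<lambda>i \<omega>. g (obs i \<omega>)) {..<n}"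
    by (rule indep_vars_compose2[OF obs_indep]) (use assms in auto)
  then show ?thesis
    by (rule iffD1[OF indep_vars_cong, rotated -1]) (use assms in auto)
qed

lemma expectation_function_obs:
  fixes g :: "_ \<Rightarrow> real"
  assumes g: "g \<in> borel_measurable (data_space p)" and i: "i < n"
  shows "expectation (\<lambda>\<omega>. g (obs i \<omega>)) = expectation (\<lambda>\<omega>. g (obs 0 \<omega>))"
proof -
  have "expectation (\<lambda>\<omega>. g (obs i \<omega>)) = integral\<^sup>L (distr M (data_space p) (obs i)) g"
    using obs_measurable[OF i] g by (subst integral_distr) auto
  also have "\<dots> = integral\<^sup>L (distr M (data_space p) (obs 0)) g" using obs_distr[OF i] by simp
  also have "\<dots> = expectation (\<lambda>\<omega>. g (obs 0 \<omega>))"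
    using obs_measurable[of 0] n g by (subst integral_distr) auto
  finally show ?thesis .
qed

lemma wnoise_indep: "indep_vars (\<lambda>_. borel) (wnoise \<theta>) {..<n}"
proof (rule indep_function_obs)
  show "(\<lambda>d. (\<Sum>j<p. fst d j * \<theta> j) * (snd d - deriv b (\<Sum>j<p. fst d j * \<beta> $ j)))
      \<in> borel_measurable (data_space p)" by measurable
qed (simp add: wnoise_def noise_def lin_eq obs_def)

text \<open>The weight is a function of the covariates and bounded by Hoelder, so
  \<open>weighted_subgaussian_mgf\<close> applies to the centred response, which equals
  \<open>noise\<close> almost surely.\<close>

lemma wnoise_mgf:
  assumes i: "i < n" and A: "L * (\<Sum>j<p. \<bar>\<theta> j\<bar>) \<le> A" "A > 0"
  shows "(\<integral>\<^sup>+\<omega>. ennreal (exp (s * wnoise \<theta> i \<omega>)) \<partial>M) \<le> ennreal (exp (A\<^sup>2 * c\<^sup>2 * s\<^sup>2 / 2))"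
proof -
  let ?Z = "\<lambda>\<omega>. Y i \<omega> - real_cond_exp M (covariate_algebra M p X {i}) (Y i) \<omega>"
  let ?w = "\<lambda>\<omega>. \<Sum>j<p. X i \<omega> $ j * \<theta> j"
  have "(\<integral>\<^sup>+\<omega>. ennreal (exp (s * (?w \<omega> * ?Z \<omega>))) \<partial>M) \<le> ennreal (exp (A\<^sup>2 * c\<^sup>2 * s\<^sup>2 / 2))"
  proof (rule weighted_subgaussian_mgf[OF covariate_subalgebra[OF order_refl] subgaussian[OF i]])
    show "AE \<omega> in M. v i (X i \<omega> \<bullet> \<beta>) \<le> c\<^sup>2" using proxy i by auto
    have [measurable]: "(\<lambda>\<omega>. X i \<omega> $ j) \<in> borel_measurable (covariate_algebra M p X {..<n})" if "j < p" for j
      using that i by (intro X_covariate_measurable) auto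
    show "?w \<in> borel_measurable (covariate_algebra M p X {..<n})" by measurable
    show "AE \<omega> in M. \<bar>?w \<omega>\<bar> \<le> A" using wlin_bounded 
    proof eventually_elim
      case (elim \<omega>)
      then have "\<bar>?w \<omega>\<bar> \<le> L * (\<Sum>j<p. \<bar>\<theta> j\<bar>)" using i by blast
      then show ?case using A(1) by linarith
    qed
  qed fact
  moreover have "(\<integral>\<^sup>+\<omega>. ennreal (exp (s * (?w \<omega> * ?Z \<omega>))) \<partial>M) = (\<integral>\<^sup>+\<omega>. ennreal (exp (s * wnoise \<theta> i \<omega>)) \<partial>M)"
    using noise_AE[OF i] by (intro nn_integral_cong_AE, eventually_elim) (simp only: wnoise_def)
  ultimately show ?thesis by simp
qed

lemma wnoise_mean:
  assumes i: "i < n"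
  shows "integrable M (wnoise \<theta> i)" "expectation (wnoise \<theta> i) = 0"
proof -
  let ?F = "covariate_algebra M p X {..<n}"
  let ?Z = "\<lambda>\<omega>. Y i \<omega> - real_cond_exp M (covariate_algebra M p X {i}) (Y i) \<omega>"
  let ?w = "\<lambda>\<omega>. \<Sum>j<p. X i \<omega> $ j * \<theta> j"
  interpret finite_measure_subalgebra M ?F
    using covariate_subalgebra[of "{..<n}"] by unfold_locales auto
  have Z: "integrable M ?Z" "AE \<omega> in M. real_cond_exp M ?F ?Z \<omega> = 0"
    using subgaussian[OF i] by (auto simp: cond_subgaussian_def)
  have [measurable]: "(\<lambda>\<omega>. X i \<omega> $ j) \<in> borel_measurable ?F" if "j < p" for j
    using that i by (intro X_covariate_measurable) auto
  have w: "?w \<in> borel_measurable ?F" by measurable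
  have [measurable]: "?Z \<in> borel_measurable M" using Z by auto
  have wM [measurable]: "?w \<in> borel_measurable M" using i by measurable
  have int: "integrable M (\<lambda>\<omega>. ?w \<omega> * ?Z \<omega>)"
  proof (rule Bochner_Integration.integrable_bound)
    show "integrable M (\<lambda>\<omega>. (L * (\<Sum>j<p. \<bar>\<theta> j\<bar>)) * ?Z \<omega>)" using Z by simp
    show "AE \<omega> in M. norm (?w \<omega> * ?Z \<omega>) \<le> norm ((L * (\<Sum>j<p. \<bar>\<theta> j\<bar>)) * ?Z \<omega>)"
      using wlin_bounded
    proof eventually_elim
      case (elim \<omega>)
      then have "\<bar>?w \<omega>\<bar> \<le> \<bar>L * (\<Sum>j<p. \<bar>\<theta> j\<bar>)\<bar>" using i by (meson abs_ge_self order_trans)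
      then show ?case by (simp only: real_norm_def abs_mult mult_right_mono abs_ge_zero)
    qed
  qed measurable
  have ae: "AE \<omega> in M. ?w \<omega> * ?Z \<omega> = wnoise \<theta> i \<omega>"
    using noise_AE[OF i] by (auto simp: wnoise_def elim: eventually_mono)
  show "integrable M (wnoise \<theta> i)"
    using int ae i by (subst integrable_cong_AE[of _ _ "\<lambda>\<omega>. ?w \<omega> * ?Z \<omega>"]) (auto elim: eventually_mono)
  have "expectation (wnoise \<theta> i) = (\<integral>\<omega>. ?w \<omega> * ?Z \<omega> \<partial>M)"
    using ae i by (intro integral_cong_AE) (auto elim: eventually_mono)
  also have "\<dots> = (\<integral>\<omega>. ?w \<omega> * real_cond_exp M ?F ?Z \<omega> \<partial>M)"
    by (rule real_cond_exp_intg(2)[OF int w, symmetric]) measurable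
  also have "\<dots> = (\<integral>\<omega>. 0 \<partial>M)"
    using Z(2) by (intro integral_cong_AE) (auto elim: eventually_mono)
  finally show "expectation (wnoise \<theta> i) = 0" by simp
qed

abbreviation Sig :: rmat where "Sig \<equiv> information_mat b M p (X 0) \<beta>"

abbreviation qform :: "(nat \<Rightarrow> real) \<Rightarrow> (nat \<Rightarrow> real) \<Rightarrow> real" where
  "qform \<equiv> bilin p (\<lambda>j k. Sig $$ (j, k))"

abbreviation hess_term :: "nat \<Rightarrow> nat \<Rightarrow> nat \<Rightarrow> 'w \<Rightarrow> real" where
  "hess_term i j k \<omega> \<equiv> X i \<omega> $ j * X i \<omega> $ k * b'' (X i \<omega> \<bullet> \<beta>)"

lemma Sig_integrable:
  assumes "i < n" "j < p" "k < p"
  shows "integrable M (\<lambda>\<omega>. hess_term i j k \<omega>)"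
    and "AE \<omega> in M. \<bar>hess_term i j k \<omega>\<bar> \<le> L\<^sup>2 * D"
proof -
  show bd: "AE \<omega> in M. \<bar>hess_term i j k \<omega>\<bar> \<le> L\<^sup>2 * D"
    using entries_bounded hess_weight_bounded
    by eventually_elim
      (use assms L D(1) in \<open>auto simp: abs_mult power2_eq_square intro!: mult_mono\<close>)
  show "integrable M (\<lambda>\<omega>. hess_term i j k \<omega>)"
    by (rule integrable_const_bound[where B = "L\<^sup>2 * D"]) (use bd assms in auto)
qed

text \<open>\<open>Sig\<close> is defined through observation 0; equality in law transfers it to
  every other observation.\<close>

lemma Sig_entry:
  assumes "i < n" "j < p" "k < p"
  shows "expectation (\<lambda>\<omega>. hess_term i j k \<omega>) = Sig $$ (j, k)"
proof -
  let ?g = "\<lambda>d. fst d j * fst d k * b'' (\<Sum>l<p. fst d l * \<beta> $ l)"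
  have "?g \<in> borel_measurable (data_space p)" using assms by measurable
  from expectation_function_obs[OF this assms(1)]
  show ?thesis using assms by (simp add: obs_def lin_eq information_mat_def)
qed

lemma Sig_form:
  assumes "i < n"
  shows "integrable M (\<lambda>\<omega>. (\<Sum>j<p. X i \<omega> $ j * \<theta> j)\<^sup>2 * b'' (X i \<omega> \<bullet> \<beta>))"
    and "expectation (\<lambda>\<omega>. (\<Sum>j<p. X i \<omega> $ j * \<theta> j)\<^sup>2 * b'' (X i \<omega> \<bullet> \<beta>))
      = qform \<theta> \<theta>"
proof -
  have eq: "(\<Sum>j<p. X i \<omega> $ j * \<theta> j)\<^sup>2 * b'' (X i \<omega> \<bullet> \<beta>)
      = (\<Sum>j<p. \<Sum>k<p. \<theta> j * \<theta> k * hess_term i j k \<omega>)" for \<omega>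
    unfolding power2_eq_square sum_product unfolding sum_distrib_right
    by (intro sum.cong refl) (simp only: mult_ac)
  have int: "integrable M (\<lambda>\<omega>. \<theta> j * \<theta> k * hess_term i j k \<omega>)"
    if "j \<in> {..<p}" "k \<in> {..<p}" for j k
    using that Sig_integrable(1)[OF assms] by (intro integrable_mult_right) auto
  show "integrable M (\<lambda>\<omega>. (\<Sum>j<p. X i \<omega> $ j * \<theta> j)\<^sup>2 * b'' (X i \<omega> \<bullet> \<beta>))"
    unfolding eq by (intro Bochner_Integration.integrable_sum int)
  have "expectation (\<lambda>\<omega>. (\<Sum>j<p. X i \<omega> $ j * \<theta> j)\<^sup>2 * b'' (X i \<omega> \<bullet> \<beta>))
      = (\<Sum>j<p. \<Sum>k<p. expectation (\<lambda>\<omega>. \<theta> j * \<theta> k * hess_term i j k \<omega>))"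
  proof -
    have "expectation (\<lambda>\<omega>. (\<Sum>j<p. X i \<omega> $ j * \<theta> j)\<^sup>2 * b'' (X i \<omega> \<bullet> \<beta>))
        = (\<Sum>j<p. expectation (\<lambda>\<omega>. \<Sum>k<p. \<theta> j * \<theta> k * hess_term i j k \<omega>))"
      unfolding eq
      by (intro Bochner_Integration.integral_sum Bochner_Integration.integrable_sum int)
    also have "\<dots> = (\<Sum>j<p. \<Sum>k<p. expectation (\<lambda>\<omega>. \<theta> j * \<theta> k * hess_term i j k \<omega>))"
      by (rule sum.cong[OF refl], rule Bochner_Integration.integral_sum, rule int)
    finally show ?thesis .
  qed
  also have "\<dots> = (\<Sum>j<p. \<Sum>k<p. (\<theta> j * \<theta> k) * Sig $$ (j, k))"
    by (intro sum.cong refl) (simp add: Sig_entry[OF assms])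
  also have "\<dots> = qform \<theta> \<theta>" by (simp add: bilin_def mult_ac)
  finally show "expectation (\<lambda>\<omega>. (\<Sum>j<p. X i \<omega> $ j * \<theta> j)\<^sup>2 * b'' (X i \<omega> \<bullet> \<beta>))
      = qform \<theta> \<theta>" .
qed

text \<open>The weights \<open>b''\<close> are conditional variances of the responses, hence
  positive almost surely.\<close>

lemma Sig_psd: "0 \<le> qform \<theta> \<theta>"
proof -
  have "0 < n" using n by simp
  have "0 \<le> expectation (\<lambda>\<omega>. (\<Sum>j<p. X 0 \<omega> $ j * \<theta> j)\<^sup>2 * b'' (X 0 \<omega> \<bullet> \<beta>))"
    using cond_var[OF \<open>0 < n\<close>] by (intro integral_nonneg_AE) (auto elim!: eventually_mono)
  then show ?thesis using Sig_form(2)[OF \<open>0 < n\<close>] by simp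
qed

lemma Sig_carrier: "Sig \<in> carrier_mat p p" by (simp add: information_mat_def)

lemma Sig_sym: "transpose_mat Sig = Sig"
  by (rule eq_matI) (auto simp: information_mat_def mult_ac)

lemma Sig_diag_le: "j < p \<Longrightarrow> Sig $$ (j, j) \<le> L\<^sup>2 * D"
proof -
  assume j: "j < p"
  have n0: "0 < n" using n by simp
  have "expectation (\<lambda>\<omega>. hess_term 0 j j \<omega>) \<le> L\<^sup>2 * D"
    using Sig_integrable[OF n0 j j] by (intro integral_le_const) (auto elim!: eventually_mono)
  then show ?thesis using Sig_entry[OF n0 j j] by simp
qed

text \<open>Given its covariates, the noise has variance \<open>b''\<close>, which is exactly the
  weight in \<open>Sig\<close>: the information matrix is also the covariance of a score summand.
  Computing with nonnegative integrals yields square integrability as a by-product.\<close>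

lemma wnoise_second_moment:
  assumes i: "i < n"
  shows "integrable M (\<lambda>\<omega>. (wnoise \<theta> i \<omega>)\<^sup>2)"
    and "expectation (\<lambda>\<omega>. (wnoise \<theta> i \<omega>)\<^sup>2) = qform \<theta> \<theta>"
proof -
  let ?F = "covariate_algebra M p X {i}"
  let ?Z = "\<lambda>\<omega>. Y i \<omega> - real_cond_exp M ?F (Y i) \<omega>"
  let ?w = "\<lambda>\<omega>. \<Sum>j<p. X i \<omega> $ j * \<theta> j"
  interpret finite_measure_subalgebra M ?F
    using covariate_subalgebra[of "{i}"] i by unfold_locales auto
  have [measurable]: "(\<lambda>\<omega>. X i \<omega> $ j) \<in> borel_measurable ?F" if "j < p" for j
    using that i by (intro X_covariate_measurable) auto
  have [measurable]: "?w \<in> borel_measurable ?F" by measurable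
  have [measurable]: "Y i \<in> borel_measurable M" using i by measurable
  have pos: "AE \<omega> in M. 0 \<le> ?w \<omega> ^ 2 * b'' (X i \<omega> \<bullet> \<beta>)"
    using cond_var[OF i] by (auto elim!: eventually_mono)
  have "(\<integral>\<^sup>+\<omega>. ennreal ((wnoise \<theta> i \<omega>)\<^sup>2) \<partial>M) = (\<integral>\<^sup>+\<omega>. ennreal ((?w \<omega>)\<^sup>2) * ennreal ((?Z \<omega>)\<^sup>2) \<partial>M)"
    using noise_AE[OF i] by (intro nn_integral_cong_AE)
      (auto simp: wnoise_def power_mult_distrib ennreal_mult[symmetric] elim!: eventually_mono)
  also have "\<dots> = (\<integral>\<^sup>+\<omega>. ennreal ((?w \<omega>)\<^sup>2) * nn_cond_exp M ?F (\<lambda>\<omega>. ennreal ((?Z \<omega>)\<^sup>2)) \<omega> \<partial>M)"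
    by (rule nn_cond_exp_intg[symmetric]) measurable
  also have "\<dots> = (\<integral>\<^sup>+\<omega>. ennreal ((?w \<omega>)\<^sup>2 * b'' (X i \<omega> \<bullet> \<beta>)) \<partial>M)"
    using cond_var[OF i]
  proof (intro nn_integral_cong_AE, eventually_elim)
    case (elim \<omega>)
    then have "nn_cond_exp M ?F (\<lambda>\<omega>. ennreal ((?Z \<omega>)\<^sup>2)) \<omega> = ennreal (b'' (X i \<omega> \<bullet> \<beta>))"
      by (simp only: cond_variance_def)
    then show ?case using elim by (simp only: ennreal_mult zero_le_power2 less_imp_le)
  qed
  also have "\<dots> = ennreal (qform \<theta> \<theta>)"
    using Sig_form[OF i] pos by (subst nn_integral_eq_integral) auto
  finally have nn: "(\<integral>\<^sup>+\<omega>. ennreal ((wnoise \<theta> i \<omega>)\<^sup>2) \<partial>M) = ennreal (qform \<theta> \<theta>)" .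
  show "integrable M (\<lambda>\<omega>. (wnoise \<theta> i \<omega>)\<^sup>2)"
    by (rule integrableI_nn_integral_finite[OF _ _ nn]) (use i Sig_psd in auto)
  show "expectation (\<lambda>\<omega>. (wnoise \<theta> i \<omega>)\<^sup>2) = qform \<theta> \<theta>"
    by (rule integral_eq_nn_integral[THEN trans]) (use i nn Sig_psd in auto)
qed

lemma score_tail:
  fixes \<epsilon> :: real
  assumes k: "k < p" and \<epsilon>: "\<epsilon> > 0"
  shows "prob {\<omega>\<in>space M. \<epsilon> \<le> \<bar>(\<Sum>i<n. X i \<omega> $ k * noise i \<omega>) / n\<bar>}
    \<le> 2 * exp (- (n * \<epsilon>\<^sup>2 / (2 * (L\<^sup>2 * c\<^sup>2))))"
proof -
  define e :: "nat \<Rightarrow> real" where "e = (\<lambda>i. if i = k then 1 else 0)"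
  have e: "(\<Sum>j<p. f j * e j) = f k" for f :: "nat \<Rightarrow> real"
    using k by (simp add: e_def if_distrib[of "\<lambda>x. _ * x"] sum.delta' cong: if_cong)
  have e1: "(\<Sum>j<p. \<bar>e j\<bar>) = 1" using e[of "\<lambda>_. 1"] by (simp add: e_def if_distrib[of abs] cong: if_cong)
  have w: "wnoise e i \<omega> = X i \<omega> $ k * noise i \<omega>" for i \<omega> by (simp add: wnoise_def e)
  have ne: "{..<n} \<noteq> {}" using n by (simp add: lessThan_empty_iff)
  have "prob {\<omega>\<in>space M. \<epsilon> \<le> \<bar>(\<Sum>i<n. wnoise e i \<omega>) / card {..<n}\<bar>}
      \<le> 2 * exp (- (card {..<n} * \<epsilon>\<^sup>2 / (2 * (L\<^sup>2 * c\<^sup>2))))"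
    by (rule subgaussian_sum_tail) (use wnoise_indep ne wnoise_mgf[of _ e L] e1 L c \<epsilon> in auto)
  then show ?thesis by (simp only: w card_lessThan)
qed

text \<open>Chebyshev's inequality for a sum of independent centred terms. For
  \<open>\<epsilon>\<close> of order \<open>1 / sqrt n\<close> the bound is a constant, which is the
  regime of a studentized statistic.\<close>

lemma noise_functional_tail:
  fixes \<epsilon> :: real
  assumes \<epsilon>: "\<epsilon> > 0"
  shows "prob {\<omega>\<in>space M. \<epsilon> \<le> \<bar>(\<Sum>i<n. wnoise \<theta> i \<omega>) / n\<bar>}
    \<le> qform \<theta> \<theta> / (n * \<epsilon>\<^sup>2)"
proof -
  let ?W = "\<lambda>\<omega>. \<Sum>i<n. wnoise \<theta> i \<omega>"
  note sm = indep_sum_second_moment[OF _ wnoise_indep, of \<theta>]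
  have int: "integrable M (\<lambda>\<omega>. (?W \<omega>)\<^sup>2)"
    by (rule sm(1)) (use wnoise_mean wnoise_second_moment in auto)
  have sq: "expectation (\<lambda>\<omega>. (?W \<omega>)\<^sup>2) = n * qform \<theta> \<theta>"
    by (subst sm(2)) (use wnoise_mean wnoise_second_moment in auto)
  have mean: "expectation ?W = 0"
    using wnoise_mean by (subst Bochner_Integration.integral_sum) auto
  have [measurable]: "?W \<in> borel_measurable M" by measurable
  have cheb: "prob {\<omega>\<in>space M. n * \<epsilon> \<le> \<bar>?W \<omega> - expectation ?W\<bar>} \<le> variance ?W / (n * \<epsilon>)\<^sup>2"
    by (rule Chebyshev_inequality) (use int n \<epsilon> in auto)
  have var: "variance ?W = n * qform \<theta> \<theta>" using mean sq by simp
  have frac: "n * s / (n * \<epsilon>)\<^sup>2 = s / (n * \<epsilon>\<^sup>2)" for s :: real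
    using n by (simp add: power2_eq_square)
  have "\<epsilon> \<le> \<bar>S / n\<bar> \<longleftrightarrow> n * \<epsilon> \<le> \<bar>S - 0\<bar>" for S :: real
    using n by (simp add: pos_le_divide_eq mult.commute)
  then have set: "{\<omega>\<in>space M. \<epsilon> \<le> \<bar>?W \<omega> / n\<bar>} = {\<omega>\<in>space M. n * \<epsilon> \<le> \<bar>?W \<omega> - expectation ?W\<bar>}"
    unfolding mean by blast
  show ?thesis using cheb unfolding set var frac .
qed

lemma hess_tail:
  fixes \<epsilon> :: real
  assumes j: "j < p" and k: "k < p" and \<epsilon>: "\<epsilon> > 0"
  shows "prob {\<omega>\<in>space M. \<epsilon> \<le> \<bar>(\<Sum>i<n. hess_term i j k \<omega>) / n - Sig $$ (j, k)\<bar>}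
    \<le> 2 * exp (- (n * \<epsilon>\<^sup>2 / (2 * (L\<^sup>2 * D)\<^sup>2)))"
proof -
  let ?V = "\<lambda>i \<omega>. hess_term i j k \<omega>"
  let ?K = "L\<^sup>2 * D"
  have K: "?K > 0" using L D by simp
  have "(\<lambda>d. fst d j * fst d k * b'' (\<Sum>l<p. fst d l * \<beta> $ l)) \<in> borel_measurable (data_space p)"
    using j k by measurable
  then have ind: "indep_vars (\<lambda>_. borel) ?V {..<n}"
    by (rule indep_function_obs) (use j k in \<open>simp add: obs_def lin_eq\<close>)
  interpret Hoeffding_ineq M "{..<n}" ?V "\<lambda>_. - ?K" "\<lambda>_. ?K" "\<Sum>i<n. expectation (?V i)"
  proof unfold_locales
    fix i assume "i \<in> {..<n}"
    then show "AE \<omega> in M. ?V i \<omega> \<in> {- ?K..?K}"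
      using Sig_integrable(2)[of i j k] j k
      by (simp only: lessThan_iff atLeastAtMost_iff abs_le_iff minus_le_iff) simp
  qed (use ind in auto)
  have mu: "(\<Sum>i<n. expectation (?V i)) = n * Sig $$ (j, k)" using Sig_entry[OF _ j k] by simp
  have hoeff: "prob {\<omega>\<in>space M. n * \<epsilon> \<le> \<bar>(\<Sum>i<n. ?V i \<omega>) - (\<Sum>i<n. expectation (?V i))\<bar>}
      \<le> 2 * exp (- 2 * (n * \<epsilon>)\<^sup>2 / (\<Sum>i<n. (?K - (- ?K))\<^sup>2))"
    by (rule Hoeffding_ineq_abs_ge) (use \<epsilon> n L D(1) in auto)
  \<comment> \<open>Each summand ranges over an interval of length \<open>2 * ?K\<close>, so
    Hoeffding's exponent is
    \<open>2 * n\<^sup>2 * \<epsilon>\<^sup>2 / (4 * n * ?K\<^sup>2)\<close>.\<close>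
  have "(\<Sum>i<n. (?K - (- ?K))\<^sup>2) = 4 * n * ?K\<^sup>2" by (simp add: power2_eq_square)
  then have ex: "- 2 * (n * \<epsilon>)\<^sup>2 / (\<Sum>i<n. (?K - (- ?K))\<^sup>2) = - (n * \<epsilon>\<^sup>2 / (2 * ?K\<^sup>2))"
    using n by (simp only:) (simp add: power2_eq_square mult_ac)
  have "\<epsilon> \<le> \<bar>S / n - s\<bar> \<longleftrightarrow> n * \<epsilon> \<le> \<bar>S - n * s\<bar>" for S s :: real
  proof -
    have "S - n * s = n * (S / n - s)" using n by (simp add: right_diff_distrib)
    then have "\<bar>S - n * s\<bar> = n * \<bar>S / n - s\<bar>" by (simp add: abs_mult)
    then show ?thesis using n by simp
  qed
  then have set: "{\<omega>\<in>space M. \<epsilon> \<le> \<bar>(\<Sum>i<n. ?V i \<omega>) / n - Sig $$ (j, k)\<bar>}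
      = {\<omega>\<in>space M. n * \<epsilon> \<le> \<bar>(\<Sum>i<n. ?V i \<omega>) - (\<Sum>i<n. expectation (?V i))\<bar>}"
    unfolding mu by blast
  show ?thesis using hoeff unfolding set ex .
qed

end

section \<open>Directional power at a fixed sample size\<close>

text \<open>The scalar core: \<open>u\<close> is the detection boundary, \<open>e\<close> the relative error of the variance
  estimate, \<open>w\<close> the margin left by the signal.\<close>
lemma studentized_signal:
  fixes \<beta> z err \<theta> \<theta>h u e w K :: real and n :: nat
  assumes n: "n > 0" and \<theta>: "\<theta> > 0" and e: "0 \<le> e" "e \<le> 1 / 2" "e * u \<le> 1" and u: "0 \<le> u"
    and \<theta>h: "\<bar>\<theta>h - \<theta>\<bar> \<le> e * \<theta>" and z: "\<bar>z\<bar> \<le> K * sqrt (\<theta> / n)"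
    and err: "sqrt n * \<bar>err\<bar> \<le> sqrt \<theta>"
    and signal: "u + w \<le> sqrt n * \<bar>\<beta>\<bar> / sqrt \<theta>" and w: "K + 9 \<le> w" "0 \<le> K"
  defines "T \<equiv> sqrt n * (\<beta> + z + err) / sqrt \<theta>h"
  shows "sgn T = sgn \<beta> \<and> u + 3 \<le> \<bar>T\<bar>"
proof -
  have "\<beta> \<noteq> 0"
  proof
    assume "\<beta> = 0"
    with signal u w show False by simp
  qed
  then have s1: "\<bar>sgn \<beta>\<bar> = 1" by (simp add: abs_sgn_eq)
  \<comment> \<open>Multiplication by the sign of \<open>\<beta>\<close> reduces both claims to one
    lower bound on \<open>sgn \<beta> * T\<close>.\<close>
  have sb: "sgn \<beta> * \<beta> = \<bar>\<beta>\<bar>" by (simp add: abs_sgn mult.commute)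
  have "- \<bar>z\<bar> \<le> sgn \<beta> * z" "- \<bar>err\<bar> \<le> sgn \<beta> * err"
    using s1 abs_ge_minus_self[of "sgn \<beta> * z"] abs_ge_minus_self[of "sgn \<beta> * err"]
    by (simp_all add: abs_mult)
  then have low: "\<bar>\<beta>\<bar> - \<bar>z\<bar> - \<bar>err\<bar> \<le> sgn \<beta> * (\<beta> + z + err)"
    using sb by (simp add: distrib_left)
  have "sqrt n * \<bar>z\<bar> \<le> sqrt n * (K * sqrt (\<theta> / n))" using z by (intro mult_left_mono) auto
  also have "\<dots> = K * sqrt \<theta>" using n by (simp add: real_sqrt_divide)
  finally have z': "sqrt n * \<bar>z\<bar> \<le> K * sqrt \<theta>" .
  have sig': "(u + w) * sqrt \<theta> \<le> sqrt n * \<bar>\<beta>\<bar>" using signal \<theta> by (simp add: pos_le_divide_eq)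
  have "(u + w - K - 1) * sqrt \<theta> \<le> sqrt n * (\<bar>\<beta>\<bar> - \<bar>z\<bar> - \<bar>err\<bar>)"
    using sig' z' err by (simp add: algebra_simps)
  also have "\<dots> \<le> sqrt n * (sgn \<beta> * (\<beta> + z + err))" using low by (intro mult_left_mono) auto
  finally have main: "(u + w - K - 1) * sqrt \<theta> \<le> sqrt n * (sgn \<beta> * (\<beta> + z + err))" .
  have "e * \<theta> \<le> 1 / 2 * \<theta>" using e \<theta> by (intro mult_right_mono) auto
  then have \<theta>h0: "\<theta>h > 0" "\<theta>h \<le> (1 + e) * \<theta>"
    using \<theta>h \<theta> unfolding distrib_right by linarith+
  \<comment> \<open>The estimated standard deviation is at most
    \<open>(1 + e) * sqrt \<theta>\<close>. As \<open>(1 - e) * (1 + e) \<le> 1\<close>, dividing by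
    it costs no more than a factor \<open>1 - e\<close>.\<close>
  have "(1 - e) * sqrt \<theta>h \<le> (1 - e) * ((1 + e) * sqrt \<theta>)"
  proof (rule mult_left_mono)
    have "sqrt \<theta>h \<le> sqrt ((1 + e) * \<theta>)" using \<theta>h0 by simp
    also have "\<dots> = sqrt (1 + e) * sqrt \<theta>" by (rule real_sqrt_mult)
    also have "\<dots> \<le> (1 + e) * sqrt \<theta>"
    proof (rule mult_right_mono)
      have "1 + e \<le> (1 + e)\<^sup>2" using e by (simp add: power2_eq_square algebra_simps)
      then show "sqrt (1 + e) \<le> 1 + e" using e by (intro real_le_lsqrt) auto
    qed (use \<theta> in simp)
    finally show "sqrt \<theta>h \<le> (1 + e) * sqrt \<theta>" .
  qed (use e in simp)
  also have "\<dots> = (1 - e\<^sup>2) * sqrt \<theta>" by (simp add: power2_eq_square algebra_simps)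
  also have "\<dots> \<le> 1 * sqrt \<theta>" using \<theta> by (intro mult_right_mono) auto
  finally have ratio: "(1 - e) * sqrt \<theta>h \<le> sqrt \<theta>" by simp
  \<comment> \<open>Origin of the 9: \<open>w - K - 1 \<ge> 8\<close> leaves at least 4 after the
    factor \<open>1 - e \<ge> 1 / 2\<close>, and \<open>e * u \<le> 1\<close> costs 1, so that 3
    remains above \<open>u\<close>.\<close>
  have "(1 - e) * (w - K - 1) \<ge> (1 / 2) * 8" using e w by (intro mult_mono) auto
  moreover have "(1 - e) * u \<ge> u - 1" using e by (simp add: algebra_simps)
  ultimately have "u + 3 \<le> (1 - e) * (u + w - K - 1)" by (simp add: algebra_simps)
  then have "(u + 3) * sqrt \<theta>h \<le> (1 - e) * (u + w - K - 1) * sqrt \<theta>h"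
    using \<theta>h0 by (intro mult_right_mono) auto
  also have "\<dots> = (u + w - K - 1) * ((1 - e) * sqrt \<theta>h)" by simp
  also have "\<dots> \<le> (u + w - K - 1) * sqrt \<theta>"
    using ratio u w by (intro mult_left_mono) auto
  also note main
  finally have fin: "u + 3 \<le> sgn \<beta> * T" using \<theta>h0 by (simp add: T_def pos_le_divide_eq mult_ac)
  then have pos: "0 < sgn \<beta> * T" using u by linarith
  then have "sgn T = sgn \<beta>" using \<open>\<beta> \<noteq> 0\<close> by (auto simp: zero_less_mult_iff sgn_if split: if_splits)
  moreover have "\<bar>T\<bar> = sgn \<beta> * T" using pos s1 by (metis abs_mult abs_of_pos mult_1)
  ultimately show ?thesis using fin by simp
qed

section \<open>The event on which score and sample information concentrate\<close>

context glm_data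
begin

definition rate :: real where "rate = sqrt (ln p / n)"

text \<open>The third clause holds almost surely; it is made part of the event so that
  \<open>glm_sample\<close> can be instantiated at every single outcome in it.\<close>

definition good_event :: "'w set" where
  "good_event = {\<omega>\<in>space M.
     (\<forall>k<p. \<bar>(\<Sum>i<n. X i \<omega> $ k * noise i \<omega>) / n\<bar> < 2 * L * c * rate) \<and>
     (\<forall>j<p. \<forall>k<p. \<bar>(\<Sum>i<n. hess_term i j k \<omega>) / n - Sig $$ (j, k)\<bar>
        < 4 * (L\<^sup>2 * D) * rate) \<and>
     (\<forall>i<n. \<forall>j<p. \<bar>X i \<omega> $ j\<bar> \<le> L)}"

lemma good_event_sets: "good_event \<in> events"
  unfolding good_event_def by measurable

text \<open>The constants 2 and 4 in \<open>good_event\<close> make the single tail bounds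
  \<open>2 / p\<^sup>2\<close> for the \<open>p\<close> score coordinates and, generously,
  \<open>2 / p ^ 3\<close> for the \<open>p\<^sup>2\<close> matrix entries. Each of the two union
  bounds then costs at most \<open>2 / p\<close>.\<close>

lemma prob_good_event:
  assumes p2: "p \<ge> 2"
  shows "1 - 4 / p \<le> prob good_event"
proof -
  let ?A = "\<lambda>k. {\<omega>\<in>space M. 2 * L * c * rate \<le> \<bar>(\<Sum>i<n. X i \<omega> $ k * noise i \<omega>) / n\<bar>}"
  let ?B = "\<lambda>(j, k). {\<omega>\<in>space M. 4 * (L\<^sup>2 * D) * rate
    \<le> \<bar>(\<Sum>i<n. hess_term i j k \<omega>) / n - Sig $$ (j, k)\<bar>}"
  let ?C = "{\<omega>\<in>space M. \<not> (\<forall>i<n. \<forall>j<p. \<bar>X i \<omega> $ j\<bar> \<le> L)}"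
  have rate: "rate > 0" "n * rate\<^sup>2 = ln p" using p2 n by (simp_all add: rate_def)
  have explnp: "exp (- (real m * ln p)) = 1 / p ^ m" for m
    using p2 by (simp add: exp_minus exp_of_nat_mult divide_inverse)
  have A: "prob (?A k) \<le> 2 / p ^ 2" if "k < p" for k
  proof -
    have "prob (?A k) \<le> 2 * exp (- (n * (2 * L * c * rate)\<^sup>2 / (2 * (L\<^sup>2 * c\<^sup>2))))"
      using that L c rate by (intro score_tail) auto
    moreover have "n * (2 * L * c * rate)\<^sup>2 / (2 * (L\<^sup>2 * c\<^sup>2)) = real 2 * ln p"
      unfolding rate(2)[symmetric] using L c by (simp add: power_mult_distrib)
    ultimately show ?thesis using explnp[of 2] by simp
  qed
  have B: "prob (?B jk) \<le> 2 / p ^ 3" if jk_in: "jk \<in> {..<p} \<times> {..<p}" for jk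
  proof -
    obtain j k where jk: "jk = (j, k)" "j < p" "k < p" using jk_in by auto
    have K: "4 * (L\<^sup>2 * D) * rate > 0" using L D rate by simp
    have "prob (?B jk) \<le> 2 * exp (- (n * (4 * (L\<^sup>2 * D) * rate)\<^sup>2 / (2 * (L\<^sup>2 * D)\<^sup>2)))"
      using hess_tail[OF jk(2,3) K] by (simp add: jk(1))
    moreover have "n * (4 * (L\<^sup>2 * D) * rate)\<^sup>2 / (2 * (L\<^sup>2 * D)\<^sup>2) = 8 * ln p"
      unfolding rate(2)[symmetric] using L D by (simp add: power_mult_distrib)
    moreover have "exp (- (8 * ln (real p))) \<le> exp (- (real 3 * ln p))" using p2 by simp
    ultimately have "prob (?B jk) \<le> 2 * (1 / p ^ 3)" unfolding explnp by simp
    then show ?thesis by simp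
  qed
  have Cm: "?C \<in> events" by measurable
  have C: "prob ?C = 0"
    using entries_bounded Cm by (subst prob_eq_0) auto
  have Am: "?A ` {..<p} \<subseteq> events" by auto
  have Bm: "?B ` ({..<p} \<times> {..<p}) \<subseteq> events" by auto
  have UA: "prob (\<Union>k\<in>{..<p}. ?A k) \<le> (\<Sum>k<p. prob (?A k))"
    by (rule finite_measure_subadditive_finite[OF _ Am]) simp
  have UB: "prob (\<Union>jk\<in>{..<p} \<times> {..<p}. ?B jk) \<le> (\<Sum>jk\<in>{..<p} \<times> {..<p}. prob (?B jk))"
    by (rule finite_measure_subadditive_finite[OF _ Bm]) simp
  have "(\<Sum>k<p. prob (?A k)) \<le> (\<Sum>k<p. 2 / p ^ 2)" using A by (intro sum_mono) auto
  then have UA': "prob (\<Union>k\<in>{..<p}. ?A k) \<le> 2 / p" using UA p2 by (simp add: power2_eq_square)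
  have "(\<Sum>jk\<in>{..<p} \<times> {..<p}. prob (?B jk)) \<le> (\<Sum>jk\<in>{..<p} \<times> {..<p}. 2 / p ^ 3)"
    using B by (intro sum_mono) auto
  then have UB': "prob (\<Union>jk\<in>{..<p} \<times> {..<p}. ?B jk) \<le> 2 / p"
    using UB p2 by (simp add: power3_eq_cube)
  have cover: "space M - good_event \<subseteq> ((\<Union>k\<in>{..<p}. ?A k) \<union> (\<Union>jk\<in>{..<p} \<times> {..<p}. ?B jk)) \<union> ?C"
  proof
    fix \<omega> assume "\<omega> \<in> space M - good_event"
    then have sp: "\<omega> \<in> space M" and ng: "\<omega> \<notin> good_event" by auto
    consider k where "k < p" "2 * L * c * rate \<le> \<bar>(\<Sum>i<n. X i \<omega> $ k * noise i \<omega>) / n\<bar>"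
      | j k where "j < p" "k < p" "4 * (L\<^sup>2 * D) * rate
        \<le> \<bar>(\<Sum>i<n. hess_term i j k \<omega>) / n - Sig $$ (j, k)\<bar>"
      | "\<not> (\<forall>i<n. \<forall>j<p. \<bar>X i \<omega> $ j\<bar> \<le> L)"
      using sp ng unfolding good_event_def mem_Collect_eq by (meson not_less)
    then show "\<omega> \<in> ((\<Union>k\<in>{..<p}. ?A k) \<union> (\<Union>jk\<in>{..<p} \<times> {..<p}. ?B jk)) \<union> ?C"
    proof cases
      case (2 j k)
      then have "\<omega> \<in> ?B (j, k)" "(j, k) \<in> {..<p} \<times> {..<p}" using sp by auto
      then show ?thesis by blast
    qed (use sp in auto)
  qed
  have sets: "(\<Union>k\<in>{..<p}. ?A k) \<in> events" "(\<Union>jk\<in>{..<p} \<times> {..<p}. ?B jk) \<in> events"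
    using Am Bm by (auto intro!: sets.finite_UN)
  have "prob (space M - good_event)
      \<le> prob (((\<Union>k\<in>{..<p}. ?A k) \<union> (\<Union>jk\<in>{..<p} \<times> {..<p}. ?B jk)) \<union> ?C)"
    using cover sets Cm by (intro finite_measure_mono) auto
  moreover have "prob (((\<Union>k\<in>{..<p}. ?A k) \<union> (\<Union>jk\<in>{..<p} \<times> {..<p}. ?B jk)) \<union> ?C)
      \<le> prob ((\<Union>k\<in>{..<p}. ?A k) \<union> (\<Union>jk\<in>{..<p} \<times> {..<p}. ?B jk)) + prob ?C"
    using sets Cm by (intro measure_Un_le) auto
  moreover have "prob ((\<Union>k\<in>{..<p}. ?A k) \<union> (\<Union>jk\<in>{..<p} \<times> {..<p}. ?B jk))
      \<le> prob (\<Union>k\<in>{..<p}. ?A k) + prob (\<Union>jk\<in>{..<p} \<times> {..<p}. ?B jk)"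
    using sets by (intro measure_Un_le) auto
  ultimately have "prob (space M - good_event) \<le> 4 / p" using UA' UB' C by linarith
  then show ?thesis using prob_compl[OF good_event_sets] by linarith
qed

end

lemma linf_norm_le_iff:
  "dim_vec v = p \<Longrightarrow> p \<ge> 1 \<Longrightarrow> linf_norm v \<le> m \<longleftrightarrow> (\<forall>i<p. \<bar>v $ i\<bar> \<le> m)"
  unfolding linf_norm_def by (subst Max_le_iff) (auto simp: lessThan_empty_iff)

section \<open>Test statistics and power under numerical side conditions\<close>

context glm_data
begin

abbreviation Th :: rmat where "Th \<equiv> the (mat_inverse Sig)"

lemma test_stat_measurable:
  assumes car: "\<And>\<omega>. \<omega> \<in> space M \<Longrightarrow> \<beta>h \<omega> \<in> carrier_vec p \<and> Thh \<omega> \<in> carrier_mat p p"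
    and [measurable]: "\<And>j. j < p \<Longrightarrow> (\<lambda>\<omega>. \<beta>h \<omega> $ j) \<in> borel_measurable M"
      "\<And>j k. j < p \<Longrightarrow> k < p \<Longrightarrow> (\<lambda>\<omega>. Thh \<omega> $$ (j, k)) \<in> borel_measurable M"
    and j: "j < p"
  shows "(\<lambda>\<omega>. test_stat b p n (\<lambda>i. X i \<omega>) (\<lambda>i. Y i \<omega>) (\<beta>h \<omega>) (Thh \<omega>) j) \<in> borel_measurable M"
proof -
  have "(\<lambda>\<omega>. test_stat b p n (\<lambda>i. X i \<omega>) (\<lambda>i. Y i \<omega>) (\<beta>h \<omega>) (Thh \<omega>) j) \<in> borel_measurable M
    \<longleftrightarrow> (\<lambda>\<omega>. sqrt n * (\<beta>h \<omega> $ j + (\<Sum>k<p. Thh \<omega> $$ (j, k)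
        * ((\<Sum>i<n. X i \<omega> $ k * (Y i \<omega> - deriv b (\<Sum>l<p. X i \<omega> $ l * \<beta>h \<omega> $ l))) / n)))
        / sqrt (Thh \<omega> $$ (j, j))) \<in> borel_measurable M"
  proof (rule measurable_cong)
    fix \<omega> assume "\<omega> \<in> space M"
    then have c: "\<beta>h \<omega> \<in> carrier_vec p" "Thh \<omega> \<in> carrier_mat p p" using car by auto
    have "X i \<omega> \<bullet> \<beta>h \<omega> = (\<Sum>l<p. X i \<omega> $ l * \<beta>h \<omega> $ l)" for i
      using c by (simp add: scalar_prod_def atLeast0LessThan)
    then have sc: "score b p n (\<lambda>i. X i \<omega>) (\<lambda>i. Y i \<omega>) (\<beta>h \<omega>) = Matrix.vec p (\<lambda>k.
        (\<Sum>i<n. X i \<omega> $ k * (Y i \<omega> - deriv b (\<Sum>l<p. X i \<omega> $ l * \<beta>h \<omega> $ l))) / n)"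
      by (simp add: score_def)
    have "(Thh \<omega> *\<^sub>v Matrix.vec p f) $ j = (\<Sum>k<p. Thh \<omega> $$ (j, k) * f k)" for f
      using mult_mat_vec_entry[OF c(2) vec_carrier j] by simp
    then show "test_stat b p n (\<lambda>i. X i \<omega>) (\<lambda>i. Y i \<omega>) (\<beta>h \<omega>) (Thh \<omega>) j
      = sqrt n * (\<beta>h \<omega> $ j + (\<Sum>k<p. Thh \<omega> $$ (j, k)
        * ((\<Sum>i<n. X i \<omega> $ k * (Y i \<omega> - deriv b (\<Sum>l<p. X i \<omega> $ l * \<beta>h \<omega> $ l))) / n)))
        / sqrt (Thh \<omega> $$ (j, j))"
      using c j by (simp add: test_stat_def debiased_def sc del: index_mult_mat_vec)
  qed
  moreover have "(\<lambda>\<omega>. sqrt n * (\<beta>h \<omega> $ j + (\<Sum>k<p. Thh \<omega> $$ (j, k)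
        * ((\<Sum>i<n. X i \<omega> $ k * (Y i \<omega> - deriv b (\<Sum>l<p. X i \<omega> $ l * \<beta>h \<omega> $ l))) / n)))
        / sqrt (Thh \<omega> $$ (j, j))) \<in> borel_measurable M"
    using j by measurable
  ultimately show ?thesis by blast
qed

context
  fixes c1 :: real
  assumes c1: "0 < c1" and spectrum: "c1 \<le> sigma_min Sig"
begin

lemma Sig_pos_def: "c1 * (\<Sum>j<p. (z j)\<^sup>2) \<le> qform z z"
proof -
  have "c1 * (\<Sum>j<p. (z j)\<^sup>2) \<le> sigma_min Sig * (\<Sum>j<p. (z j)\<^sup>2)"
    using spectrum by (intro mult_right_mono sum_nonneg) auto
  also have "\<dots> \<le> qform z z"
    by (rule sigma_min_le_rayleigh[OF Sig_carrier Sig_sym Sig_psd])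
  finally show ?thesis .
qed

lemmas Th_facts = pos_def_inverse[OF Sig_carrier Sig_sym Sig_pos_def c1]

lemma Sig_entry_sym: "j < p \<Longrightarrow> k < p \<Longrightarrow> Sig $$ (j, k) = Sig $$ (k, j)"
  by (simp add: information_mat_def mult_ac)

lemma Th_row_l1: "j < p \<Longrightarrow> (\<Sum>k<p. \<bar>Th $$ (j, k)\<bar>) \<le> op1_norm Th"
  using op1_norm_column[OF Th_facts(1)] Th_facts(2)[of j] by simp

text \<open>Cauchy-Schwarz gives \<open>1 \<le> Sig $$ (j, j) * Th $$ (j, j)\<close>, and
  \<open>Sig $$ (j, j)\<close> is at most \<open>L\<^sup>2 * D\<close>. Variances bounded away from
  0 turn the absolute error of the CLIME diagonal into a relative one.\<close>

lemma Th_diag_lower: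
  assumes j: "j < p"
  shows "1 / (L\<^sup>2 * D) \<le> Th $$ (j, j)" "0 < Th $$ (j, j)"
proof -
  have K: "0 < L\<^sup>2 * D" using L D by simp
  have 1: "1 \<le> Sig $$ (j, j) * Th $$ (j, j)" using Th_facts(4)[OF j] .
  have S: "0 \<le> Sig $$ (j, j)"
  proof -
    have "0 \<le> qform (\<lambda>i. if i = j then 1 else 0) (\<lambda>i. if i = j then 1 else 0)"
      by (rule Sig_psd)
    also have "\<dots> = Sig $$ (j, j)" unfolding bilin_def using j
      by (simp add: if_distrib[of "\<lambda>x. x * _"] if_distrib[of "\<lambda>x. _ * x"] sum.delta' cong: if_cong)
    finally show ?thesis .
  qed
  show pos: "0 < Th $$ (j, j)"
  proof (rule ccontr)
    assume "\<not> 0 < Th $$ (j, j)"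
    then have "Sig $$ (j, j) * Th $$ (j, j) \<le> 0" using S by (intro mult_nonneg_nonpos) auto
    with 1 show False by simp
  qed
  have "Sig $$ (j, j) * Th $$ (j, j) \<le> (L\<^sup>2 * D) * Th $$ (j, j)"
    using Sig_diag_le[OF j] pos by (intro mult_right_mono) auto
  with 1 show "1 / (L\<^sup>2 * D) \<le> Th $$ (j, j)" using K by (simp add: pos_divide_le_eq mult.commute)
qed

text \<open>The identity \<Theta> \<Sigma> \<Theta> = \<Theta> on the diagonal: the averaged noise
  of row \<open>j\<close> has variance \<open>Th $$ (j, j) / n\<close>, exactly what studentization
  divides out.\<close>

lemma bilin_Th_row:
  assumes j: "j < p"
  shows "qform (\<lambda>k. Th $$ (j, k)) (\<lambda>k. Th $$ (j, k)) = Th $$ (j, j)"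
proof -
  have "qform (\<lambda>k. Th $$ (j, k)) (\<lambda>k. Th $$ (j, k))
      = (\<Sum>i<p. if i = j then Th $$ (j, i) else 0)"
    unfolding bilin_mult by (intro sum.cong refl) (simp add: Th_facts(3) j)
  then show ?thesis using j by (simp add: sum.delta')
qed

text \<open>All randomness is frozen. \<open>small\<close> serves the Lasso bound, \<open>mu\<close>
  the feasibility of the true row, \<open>rem\<close> the numerator and \<open>e\<close> the
  denominator; \<open>noise\<close> is the one condition that singles out outcomes separately for
  each \<open>j\<close>.\<close>

lemma test_stat_good:
  fixes \<beta>h :: rvec and T :: rmat and lam mu t u w K :: real and r :: nat
  assumes \<omega>: "\<omega> \<in> good_event"
    and \<beta>h: "\<beta>h \<in> carrier_vec p" and T: "T \<in> carrier_mat p p"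
    and lasso: "is_lasso b p n (\<lambda>i. X i \<omega>) (\<lambda>i. Y i \<omega>) lam \<beta>h"
    and clime: "is_clime p (sample_information_mat b p n (\<lambda>i. X i \<omega>) \<beta>h) mu T"
    and s: "s = card (support p \<beta>)" "1 \<le> s" and j: "j < p"
    and lam: "0 < lam" "4 * (L * c) * rate \<le> lam"
    and t: "t = 100 * lam * s / c1" "L * t \<le> R"
    and small: "4 * (L\<^sup>2 * D) * rate \<le> c1 / (64 * s)" "C * L ^ 3 * t \<le> c1 / (64 * s)"
    and mu: "(4 * (L\<^sup>2 * D) * rate + L\<^sup>2 * (C * (L * t))) * op1_norm Th \<le> mu"
    and r: "card {k. k < p \<and> Th $$ (j, k) \<noteq> 0} \<le> r"
    and rem: "sqrt n * (mu * t + op1_norm Th * (L * (C * (L * t)\<^sup>2))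
        + 4 * real r * op1_norm Th * mu * (2 * L * c * rate)) \<le> sqrt (1 / (L\<^sup>2 * D))"
    and e: "2 * op1_norm Th * mu * (L\<^sup>2 * D) \<le> 1 / 2"
      "2 * op1_norm Th * mu * (L\<^sup>2 * D) * u \<le> 1"
    and u: "0 \<le> u" and w: "K + 9 \<le> w" "0 \<le> K"
    and signal: "u + w \<le> sqrt n * \<bar>\<beta> $ j\<bar> / sqrt (Th $$ (j, j))"
    and noise: "\<bar>(\<Sum>i<n. wnoise (\<lambda>k. Th $$ (j, k)) i \<omega>) / n\<bar> \<le> K * sqrt (Th $$ (j, j) / n)"
  defines "TS \<equiv> test_stat b p n (\<lambda>i. X i \<omega>) (\<lambda>i. Y i \<omega>) \<beta>h T j"
  shows "sgn TS = sgn (\<beta> $ j) \<and> u + 3 \<le> \<bar>TS\<bar>"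
proof -
  define N where "N = op1_norm Th"
  have good: "\<And>k. k < p \<Longrightarrow> \<bar>(\<Sum>i<n. X i \<omega> $ k * noise i \<omega>) / n\<bar> \<le> 2 * L * c * rate"
    "\<And>j k. j < p \<Longrightarrow> k < p \<Longrightarrow>
      \<bar>(\<Sum>i<n. hess_term i j k \<omega>) / n - Sig $$ (j, k)\<bar>
        \<le> 4 * (L\<^sup>2 * D) * rate"
    "\<And>i j. i < n \<Longrightarrow> j < p \<Longrightarrow> \<bar>X i \<omega> $ j\<bar> \<le> L"
    using \<omega> by (auto simp: good_event_def less_imp_le)
  interpret G: glm_sample b R C p n "\<lambda>i j. X i \<omega> $ j" "\<lambda>i. Y i \<omega>" L
    by unfold_locales (use good n L in auto)
  have Glin: "G.lin i (($) v) = X i \<omega> \<bullet> v" if "v \<in> carrier_vec p" for i v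
    using that by (simp add: G.lin_def scalar_prod_def atLeast0LessThan)
  have grad_eq: "G.grad (($) \<beta>) k = (\<Sum>i<n. X i \<omega> $ k * noise i \<omega>) / n" for k
    by (simp add: G.grad_def Glin[OF \<beta>] noise_def)
  have hess_eq: "G.hess (($) \<beta>) j k
      = (\<Sum>i<n. hess_term i j k \<omega>) / n" for j k
    by (simp add: G.hess_def Glin[OF \<beta>])
  have score: "\<bar>G.grad (($) \<beta>) k\<bar> \<le> 2 * L * c * rate" if "k < p" for k
    using good(1)[OF that] by (simp only: grad_eq)
  have close: "\<bar>G.hess (($) \<beta>) j k - Sig $$ (j, k)\<bar> \<le> 4 * (L\<^sup>2 * D) * rate" if "j < p" "k < p" for j k
    using good(2)[OF that] by (simp only: hess_eq)
  have obj: "- loglik b n (\<lambda>i. X i \<omega>) (\<lambda>i. Y i \<omega>) v + lam * l1_norm v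
      = G.neg_loglik (($) v) + lam * (\<Sum>j<p. \<bar>v $ j\<bar>)" if "v \<in> carrier_vec p" for v
    using that by (simp add: loglik_def G.neg_loglik_def Glin l1_norm_def)
  have opt: "G.neg_loglik (($) \<beta>h) + lam * (\<Sum>j<p. \<bar>\<beta>h $ j\<bar>)
      \<le> G.neg_loglik (($) \<beta>) + lam * (\<Sum>j<p. \<bar>\<beta> $ j\<bar>)"
  proof -
    have "\<not> (- loglik b n (\<lambda>i. X i \<omega>) (\<lambda>i. Y i \<omega>) \<beta> + lam * l1_norm \<beta>
        < - loglik b n (\<lambda>i. X i \<omega>) (\<lambda>i. Y i \<omega>) \<beta>h + lam * l1_norm \<beta>h)"
      using lasso \<beta> unfolding is_lasso_def is_arg_min_def by blast
    then show ?thesis unfolding obj[OF \<beta>] obj[OF \<beta>h] by simp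
  qed
  have t0: "0 < t" using lam s c1 by (simp add: t)
  have l1: "(\<Sum>j<p. \<bar>\<beta>h $ j - \<beta> $ j\<bar>) \<le> t"
  proof (rule G.lasso_l1_error[where J = "support p \<beta>" and s = s and c = c1
        and Sig = "\<lambda>j k. Sig $$ (j, k)" and \<eta> = "4 * (L\<^sup>2 * D) * rate", OF opt lam(1)])
    show "\<bar>G.grad (($) \<beta>) j\<bar> \<le> lam / 2" if "j < p" for j
      using score[OF that] lam by (simp add: mult_ac)
    show "c1 * (\<Sum>j<p. (z j)\<^sup>2) \<le> (\<Sum>j<p. \<Sum>k<p. z j * Sig $$ (j, k) * z k)" for z
      using Sig_pos_def[of z] by (simp only: bilin_def)
    \<comment> \<open>The constant 100 in \<open>t\<close>: the curvature left after both errors is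
      \<open>1 / 16 - 1 / 64 - 1 / 64 = 1 / 32\<close>, in units of \<open>c1 / s\<close>, and
      \<open>3 / 100 < 1 / 32\<close>.\<close>
    have "3 * lam = 3 / 100 * (c1 * t / s)" using c1 s by (simp add: t)
    also have "\<dots> < 1 / 32 * (c1 * t / s)" using c1 s t0 by (intro mult_strict_right_mono) auto
    finally have "3 * lam * t < 1 / 32 * (c1 * t / s) * t" using t0 by (rule mult_strict_right_mono)
    then have "3 * lam * t < c1 / (32 * s) * t * t" by simp
    moreover have "(c1 / (16 * s) - 4 * (L\<^sup>2 * D) * rate) * t\<^sup>2 \<ge> (c1 / (16 * s) - c1 / (64 * s)) * t\<^sup>2"
      using small by (intro mult_right_mono) auto
    moreover have "C * L ^ 3 * t * t\<^sup>2 \<le> c1 / (64 * s) * t\<^sup>2" using small by (intro mult_right_mono) auto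
    then have "C * (L * t) ^ 3 \<le> c1 / (64 * s) * t\<^sup>2"
      by (simp add: power_mult_distrib power2_eq_square power3_eq_cube mult_ac)
    moreover have "(c1 / (16 * s) - c1 / (64 * s)) * t\<^sup>2 - c1 / (64 * s) * t\<^sup>2 = c1 / (32 * s) * t * t"
      using s by (simp add: power2_eq_square field_simps)
    ultimately show "3 * lam * t < (c1 / (16 * s) - 4 * (L\<^sup>2 * D) * rate) * t\<^sup>2 - C * (L * t) ^ 3"
      by linarith
  qed (use s c1 close t0 t in \<open>auto simp: support_def\<close>)
  define A where "A = sample_information_mat b p n (\<lambda>i. X i \<omega>) \<beta>h"
  have A: "A \<in> carrier_mat p p" by (simp add: A_def sample_information_mat_def)
  have A_eq: "A $$ (j, k) = G.hess (($) \<beta>h) j k" if "j < p" "k < p" for j k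
    using that by (simp add: A_def sample_information_mat_def G.hess_def Glin[OF \<beta>h])
  have feas_iff: "linf_norm (A *\<^sub>v v - unit_vec p j) \<le> mu \<longleftrightarrow>
      (\<forall>i<p. \<bar>(\<Sum>k<p. G.hess (($) \<beta>h) i k * v $ k) - (if i = j then 1 else 0)\<bar> \<le> mu)"
    if v: "v \<in> carrier_vec p" for v
  proof -
    have "(A *\<^sub>v v - unit_vec p j) $ i
        = (\<Sum>k<p. G.hess (($) \<beta>h) i k * v $ k) - (if i = j then 1 else 0)" if i: "i < p" for i
    proof -
      have "(A *\<^sub>v v - unit_vec p j) $ i = (A *\<^sub>v v) $ i - (if i = j then 1 else 0)"
        using i A v j by (simp add: unit_vec_def)
      also have "(A *\<^sub>v v) $ i = (\<Sum>k<p. G.hess (($) \<beta>h) i k * v $ k)"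
        unfolding mult_mat_vec_entry[OF A v i] by (intro sum.cong refl) (simp add: A_eq i)
      finally show ?thesis .
    qed
    moreover have "dim_vec (A *\<^sub>v v - unit_vec p j) = p" by simp
    ultimately show ?thesis using p by (subst linf_norm_le_iff) auto
  qed
  define W where "W = row T j"
  have W: "W \<in> carrier_vec p" "\<And>k. k < p \<Longrightarrow> W $ k = T $$ (j, k)" using T j by (auto simp: W_def)
  have argmin: "is_arg_min l1_norm (\<lambda>w. w \<in> carrier_vec p \<and> linf_norm (A *\<^sub>v w - unit_vec p j) \<le> mu) W"
    using clime j by (simp add: is_clime_def A_def W_def)
  have feas: "\<bar>(\<Sum>k<p. G.hess (($) \<beta>h) i k * W $ k) - (if i = j then 1 else 0)\<bar> \<le> mu" if "i < p" for i
    using argmin feas_iff[OF W(1)] that by (auto simp: is_arg_min_def)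
  have min: "(\<Sum>k<p. \<bar>W $ k\<bar>) \<le> (\<Sum>k<p. \<bar>v k\<bar>)"
    if v: "\<And>i. i < p \<Longrightarrow> \<bar>(\<Sum>k<p. G.hess (($) \<beta>h) i k * v k) - (if i = j then 1 else 0)\<bar> \<le> mu" for v
  proof -
    have "linf_norm (A *\<^sub>v Matrix.vec p v - unit_vec p j) \<le> mu"
      using v by (subst feas_iff) auto
    then have "\<not> l1_norm (Matrix.vec p v) < l1_norm W"
      using argmin unfolding is_arg_min_def by auto
    then show ?thesis using W(1) by (simp add: l1_norm_def)
  qed
  note err = G.debiased_error[where \<beta>h = "($) \<beta>h" and \<beta> = "($) \<beta>" and t = t
      and Sig = "\<lambda>j k. Sig $$ (j, k)" and Th = "\<lambda>j k. Th $$ (j, k)" and \<eta> = "4 * (L\<^sup>2 * D) * rate"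
      and N = N and \<mu> = mu and j = j and w = "($) W" and r = r and \<sigma> = "2 * L * c * rate",
      OF l1 t(2) close Th_facts(2) Th_facts(3) Sig_entry_sym Th_row_l1[folded N_def]
        mu[folded N_def] j feas min r score]
  define z where "z = (\<Sum>k<p. Th $$ (j, k) * G.grad (($) \<beta>) k)"
  have z_eq: "z = (\<Sum>i<n. wnoise (\<lambda>k. Th $$ (j, k)) i \<omega>) / n"
    unfolding z_def G.grad_sum by (simp add: G.lin_def[symmetric] wnoise_def noise_def Glin[OF \<beta>])
  define dev where "dev = \<beta>h $ j + (\<Sum>k<p. W $ k * G.grad (($) \<beta>h) k) - \<beta> $ j - z"
  have score_vec: "score b p n (\<lambda>i. X i \<omega>) (\<lambda>i. Y i \<omega>) \<beta>h = Matrix.vec p (G.grad (($) \<beta>h))"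
    by (simp add: score_def G.grad_def[abs_def] Glin[OF \<beta>h])
  have "debiased b p n (\<lambda>i. X i \<omega>) (\<lambda>i. Y i \<omega>) \<beta>h T $ j
      = \<beta>h $ j + (T *\<^sub>v Matrix.vec p (G.grad (($) \<beta>h))) $ j"
    using T j by (simp add: debiased_def score_vec)
  also have "(T *\<^sub>v Matrix.vec p (G.grad (($) \<beta>h))) $ j = (\<Sum>k<p. W $ k * G.grad (($) \<beta>h) k)"
    unfolding mult_mat_vec_entry[OF T vec_carrier j] by (intro sum.cong refl) (simp add: W(2))
  finally have deb: "debiased b p n (\<lambda>i. X i \<omega>) (\<lambda>i. Y i \<omega>) \<beta>h T $ j = \<beta> $ j + z + dev"
    by (simp add: dev_def)
  have K: "L\<^sup>2 * D > 0" using L D by simp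
  note Thj = Th_diag_lower[OF j]
  have TS: "TS = sqrt n * (\<beta> $ j + z + dev) / sqrt (T $$ (j, j))"
    by (simp add: TS_def test_stat_def deb)
  have N0: "0 \<le> N"
    unfolding N_def by (rule order_trans[OF _ Th_row_l1[OF j]]) (simp add: sum_nonneg)
  have mu0: "0 \<le> mu" using feas[OF j] by linarith
  show ?thesis unfolding TS
  proof (rule studentized_signal[where w = w and K = K and e = "2 * op1_norm Th * mu * (L\<^sup>2 * D)"])
    show "\<bar>T $$ (j, j) - Th $$ (j, j)\<bar> \<le> 2 * op1_norm Th * mu * (L\<^sup>2 * D) * Th $$ (j, j)"
    proof -
      have "\<bar>T $$ (j, j) - Th $$ (j, j)\<bar> \<le> 2 * N * mu * 1" using err(1) W(2)[OF j] by simp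
      also have "\<dots> \<le> 2 * N * mu * (L\<^sup>2 * D * Th $$ (j, j))"
        using Thj K N0 mu0 by (intro mult_left_mono) (simp_all add: pos_divide_le_eq mult.commute)
      finally show ?thesis by (simp add: N_def mult_ac)
    qed
    show "\<bar>z\<bar> \<le> K * sqrt (Th $$ (j, j) / n)" using noise by (simp add: z_eq)
    show "sqrt n * \<bar>dev\<bar> \<le> sqrt (Th $$ (j, j))"
    proof -
      have "sqrt n * \<bar>dev\<bar> \<le> sqrt n * (mu * t + N * (L * (C * (L * t)\<^sup>2)) + 4 * real r * N * mu * (2 * L * c * rate))"
        using err(2) by (intro mult_left_mono) (simp_all add: dev_def z_def)
      also have "\<dots> \<le> sqrt (1 / (L\<^sup>2 * D))" using rem by (simp only: N_def)
      also have "\<dots> \<le> sqrt (Th $$ (j, j))" using Thj by simp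
      finally show ?thesis .
    qed
  qed (use n Thj e u w signal N0 mu0 K in \<open>simp_all add: N_def\<close>)
qed

text \<open>\<open>K\<close> stays free: by Chebyshev every signal is spoilt by noise with
  probability at most \<open>1 / K\<^sup>2\<close>, which costs \<open>3 / K\<^sup>2\<close> of
  power however large \<open>n\<close> is. So \<open>n\<close> tends to infinity for fixed
  \<open>K\<close>, and \<open>K\<close> is sent to infinity afterwards.\<close>

lemma directional_power_fixed_n:
  fixes \<beta>h :: "'w \<Rightarrow> rvec" and Thh :: "'w \<Rightarrow> rmat" and lam mu t u w K \<alpha> :: real and s r :: nat
  assumes car: "\<And>\<omega>. \<omega> \<in> space M \<Longrightarrow> \<beta>h \<omega> \<in> carrier_vec p \<and> Thh \<omega> \<in> carrier_mat p p"
    and meas: "\<And>j. j < p \<Longrightarrow> (\<lambda>\<omega>. \<beta>h \<omega> $ j) \<in> borel_measurable M"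
      "\<And>j k. j < p \<Longrightarrow> k < p \<Longrightarrow> (\<lambda>\<omega>. Thh \<omega> $$ (j, k)) \<in> borel_measurable M"
    and E: "E \<in> events" "\<And>\<omega>. \<omega> \<in> E \<Longrightarrow>
      is_lasso b p n (\<lambda>i. X i \<omega>) (\<lambda>i. Y i \<omega>) lam (\<beta>h \<omega>) \<and>
      is_clime p (sample_information_mat b p n (\<lambda>i. X i \<omega>) (\<beta>h \<omega>)) mu (Thh \<omega>)"
    and \<alpha>: "0 < \<alpha>" "\<alpha> < 1" and s: "s = card (support p \<beta>)" "1 \<le> s"
    and cutoff: "sqrt (2 * ln (real p)) \<le> gmt_cutoff p + 1" "1 \<le> ln (real p)"
    and lam: "0 < lam" "4 * (L * c) * rate \<le> lam"
    and t: "t = 100 * lam * s / c1" "L * t \<le> R"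
    and small: "4 * (L\<^sup>2 * D) * rate \<le> c1 / (64 * s)" "C * L ^ 3 * t \<le> c1 / (64 * s)"
    and mu: "(4 * (L\<^sup>2 * D) * rate + L\<^sup>2 * (C * (L * t))) * op1_norm Th \<le> mu"
    and r: "\<And>j. j < p \<Longrightarrow> card {i. i < p \<and> Th $$ (i, j) \<noteq> 0} \<le> r"
    and rem: "sqrt n * (mu * t + op1_norm Th * (L * (C * (L * t)\<^sup>2))
        + 4 * real r * op1_norm Th * mu * (2 * L * c * rate)) \<le> sqrt (1 / (L\<^sup>2 * D))"
    and u: "u = sqrt (2 * ln (2 * real p / (\<alpha> * real s)))"
    and e: "2 * op1_norm Th * mu * (L\<^sup>2 * D) \<le> 1 / 2"
      "2 * op1_norm Th * mu * (L\<^sup>2 * D) * u \<le> 1"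
    and w: "K + 9 \<le> w" "0 < K"
    and signal: "\<And>j. j \<in> support p \<beta> \<Longrightarrow> u + w \<le> sqrt n * \<bar>\<beta> $ j\<bar> / sqrt (Th $$ (j, j))"
  defines "P \<equiv> directional_power M \<alpha> p \<beta>
      (\<lambda>\<omega>. test_stat b p n (\<lambda>i. X i \<omega>) (\<lambda>i. Y i \<omega>) (\<beta>h \<omega>) (Thh \<omega>))"
  shows "P \<le> 1" "prob E - 4 / p - 3 / K\<^sup>2 \<le> P"
proof -
  let ?T = "\<lambda>\<omega>. test_stat b p n (\<lambda>i. X i \<omega>) (\<lambda>i. Y i \<omega>) (\<beta>h \<omega>) (Thh \<omega>)"
  define bad where "bad = (\<lambda>j. {\<omega>\<in>space M. K * sqrt (Th $$ (j, j) / n)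
      \<le> \<bar>(\<Sum>i<n. wnoise (\<lambda>k. Th $$ (j, k)) i \<omega>) / n\<bar>})"
  have supp: "j < p" if "j \<in> support p \<beta>" for j using that by (simp add: support_def)
  have bad_meas: "bad j \<in> events" for j unfolding bad_def by measurable
  have bad_prob: "prob (bad j) \<le> 1 / K\<^sup>2" if "j \<in> support p \<beta>" for j
  proof -
    have j: "j < p" using that by (rule supp)
    note Thj = Th_diag_lower(2)[OF j]
    have pos: "0 < K * sqrt (Th $$ (j, j) / n)" using w Thj n by simp
    have "prob (bad j) \<le> Th $$ (j, j) / (n * (K * sqrt (Th $$ (j, j) / n))\<^sup>2)"
      using noise_functional_tail[OF pos, of "\<lambda>k. Th $$ (j, k)"] by (simp only: bad_def bilin_Th_row[OF j])
    also have "\<dots> = 1 / K\<^sup>2" using Thj n w by (simp add: power_mult_distrib)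
    finally show ?thesis .
  qed
  have p2: "p \<ge> 2"
  proof (rule ccontr)
    assume "\<not> p \<ge> 2"
    then have "p = 0 \<or> p = 1" by auto
    then show False using cutoff(2) by auto
  qed
  have "\<alpha> * real s \<le> 1 * real p"
  proof (rule mult_mono)
    have "card (support p \<beta>) \<le> card {..<p}" by (intro card_mono) (auto simp: support_def)
    then show "real s \<le> real p" using s by simp
  qed (use \<alpha> in auto)
  then have u0: "0 \<le> u" using \<alpha> s by (simp add: u field_simps)
  have sets: "E \<inter> good_event \<in> events" using E good_event_sets by auto
  have good: "sgn (?T \<omega> j) = sgn (\<beta> $ j) \<and> sqrt (2 * ln (2 * real p / (\<alpha> * real s))) + 3 \<le> \<bar>?T \<omega> j\<bar>"
    if "\<omega> \<in> E \<inter> good_event" "j \<in> support p \<beta>" "\<omega> \<notin> bad j" for \<omega> j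
  proof -
    have j: "j < p" using that by (intro supp)
    have sp: "\<omega> \<in> space M" using that by (simp add: good_event_def)
    \<comment> \<open>Sparsity is given by columns, whereas the CLIME argument works with rows;
      symmetry of the inverse identifies the two.\<close>
    have "{k. k < p \<and> Th $$ (j, k) \<noteq> 0} = {i. i < p \<and> Th $$ (i, j) \<noteq> 0}"
      using Th_facts(2)[OF j] by auto
    then have rj: "card {k. k < p \<and> Th $$ (j, k) \<noteq> 0} \<le> r" using r[OF j] by simp
    have nz: "\<bar>(\<Sum>i<n. wnoise (\<lambda>k. Th $$ (j, k)) i \<omega>) / n\<bar> \<le> K * sqrt (Th $$ (j, j) / n)"
      using that(3) sp by (simp add: bad_def)
    have solved: "is_lasso b p n (\<lambda>i. X i \<omega>) (\<lambda>i. Y i \<omega>) lam (\<beta>h \<omega>)"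
      "is_clime p (sample_information_mat b p n (\<lambda>i. X i \<omega>) (\<beta>h \<omega>)) mu (Thh \<omega>)"
      using E(2) that(1) by auto
    show ?thesis unfolding u[symmetric]
      by (rule test_stat_good[where w = w and K = K and t = t and r = r and lam = lam and mu = mu and s = s])
        (use that(1) car[OF sp] solved s j lam t small mu rj rem e u0 w signal[OF that(2)] nz in auto)
  qed
  have "measure M (E \<inter> good_event) - 3 * (1 / K\<^sup>2) \<le> P" "P \<le> 1"
    unfolding P_def
    by (rule directional_power_bounds[where bad = bad and \<Omega> = "E \<inter> good_event" and s = s];
        (rule prob_space_axioms test_stat_measurable[OF car meas] \<alpha> s cutoff sets bad_meas bad_prob good)?;
        assumption?)+
  moreover have "prob E - 4 / p \<le> prob (E \<inter> good_event)"
  proof -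
    have "prob E \<le> prob ((E \<inter> good_event) \<union> (space M - good_event))"
      using E sets good_event_sets sets.sets_into_space[OF E(1)] by (intro finite_measure_mono) auto
    also have "\<dots> \<le> prob (E \<inter> good_event) + prob (space M - good_event)"
      using sets good_event_sets by (intro measure_Un_le) auto
    finally show ?thesis using prob_compl[OF good_event_sets] prob_good_event[OF p2] by linarith
  qed
  ultimately show "P \<le> 1" "prob E - 4 / p - 3 / K\<^sup>2 \<le> P" by auto
qed

end

end

section \<open>Rates\<close>

text \<open>Every claim reduces to a constant times \<open>q\<close>. The tuning \<open>mu\<close>
  carries a factor \<open>N\<close>, so that row norm and sparsity meet in the product
  \<open>N\<^sup>2 * r\<close>, precisely the quantity that is assumed to be small.\<close>

lemma rate_conditions:
  fixes lp h q lam t mu N u L D C c c1 cl cm cs cu :: real and n s r :: nat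
  assumes n: "n > 0" and lp: "1 \<le> lp" and s: "1 \<le> s" and r: "1 \<le> r"
    and h: "h = sqrt (lp / n)" and q: "q = (real s)\<^sup>2 * (lp * sqrt lp) / sqrt n"
    and lam: "0 \<le> lam" "lam \<le> cl * h" and t: "t = 100 * lam * s / c1" and c1: "c1 > 0"
    and N: "0 \<le> N" "N\<^sup>2 * r \<le> cs * sqrt lp" and mu: "0 \<le> mu" "mu \<le> cm * (N * s * h)"
    and u: "0 \<le> u" "u \<le> cu * sqrt lp"
    and pos: "0 < L" "0 < D" "0 \<le> C" "0 < c" "0 < cl" "0 < cm" "0 < cs" "0 < cu"
    and ct: "ct = 100 * cl / c1"
    and small: "L * ct * q \<le> R" "256 * (L\<^sup>2 * D) * q \<le> c1" "64 * C * L ^ 3 * ct * q \<le> c1"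
      "(cm * ct * (1 + cs) + L * C * L\<^sup>2 * ct\<^sup>2 * (1 + cs) + 8 * L * c * cm * cs) * q \<le> sqrt (1 / (L\<^sup>2 * D))"
      "2 * (L\<^sup>2 * D) * cm * cs * q \<le> 1 / 2" "2 * (L\<^sup>2 * D) * cm * cs * cu * q \<le> 1"
  shows "t \<le> ct * (s * h)" "L * t \<le> R" "4 * (L\<^sup>2 * D) * h \<le> c1 / (64 * s)" "C * L ^ 3 * t \<le> c1 / (64 * s)"
    "sqrt n * (mu * t + N * (L * (C * (L * t)\<^sup>2)) + 4 * real r * N * mu * (2 * L * c * h)) \<le> sqrt (1 / (L\<^sup>2 * D))"
    "2 * N * mu * (L\<^sup>2 * D) \<le> 1 / 2" "2 * N * mu * (L\<^sup>2 * D) * u \<le> 1"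
proof -
  define l where "l = sqrt lp"
  define m where "m = sqrt n"
  have l: "1 \<le> l" "l * l = lp" using lp by (simp_all add: l_def)
  have m: "0 < m" "m * m = n" using n by (simp_all add: m_def)
  have hm: "h = l / m" by (simp add: h l_def m_def real_sqrt_divide)
  have h0: "0 < h" using l m by (simp add: hm)
  have s1: "1 \<le> real s" using s by simp
  have qm: "q = real s * real s * (l * l * l) / m" by (simp add: q l_def[symmetric] l(2) m_def power2_eq_square)
  have ct0: "0 < ct" using pos c1 by (simp add: ct)
  have ss: "real s \<le> real s * real s" using s1 by simp
  have ll: "l \<le> l * l" "l * l \<le> l * l * l" using l(1) by simp_all
  have lll: "1 \<le> l * l" "l \<le> l * l * l" using ll l(1) by linarith+
  have b1: "real s * real s * h \<le> q" unfolding hm qm times_divide_eq_right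
    by (rule divide_right_mono[OF mult_left_mono[OF lll(2)]]) (use m in auto)
  have b2: "s * h \<le> q" using b1 mult_right_mono[OF ss, of h] h0 by linarith
  have b3: "l * (s * h) \<le> q"
  proof -
    have "real s * (l * l) \<le> (real s * real s) * (l * l * l)"
      using ss ll l by (intro mult_mono) auto
    then show ?thesis unfolding hm qm using m by (simp add: divide_right_mono mult_ac)
  qed
  have b4: "l * (s * h) * l \<le> q"
  proof -
    have "real s * (l * l * l) \<le> (real s * real s) * (l * l * l)"
      using ss l by (intro mult_right_mono) auto
    then show ?thesis unfolding hm qm using m by (simp add: divide_right_mono mult_ac)
  qed
  \<comment> \<open>The critical product, with equality: it fixes the form of \<open>q\<close>. The
    other products are merely dominated by \<open>q\<close>.\<close>
  have b5: "m * (l * (s * h) * (s * h)) = q"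
    unfolding hm qm using m(1) by (simp add: field_simps)
  have b6: "m * (l * (s * h) * h) \<le> q"
  proof -
    have "m * (l * (s * h) * h) = s * (l * l * l) / m" unfolding hm using m(1) by (simp add: field_simps)
    also have "\<dots> \<le> (real s * real s) * (l * l * l) / m"
      using ss l m by (intro divide_right_mono mult_right_mono) auto
    finally show ?thesis by (simp add: qm)
  qed
  have t0: "0 \<le> t" using lam c1 by (simp add: t)
  show tb: "t \<le> ct * (s * h)"
  proof -
    have "t \<le> 100 * (cl * h) * s / c1" unfolding t using lam c1 by (intro divide_right_mono mult_right_mono mult_left_mono) auto
    then show ?thesis by (simp add: ct mult_ac)
  qed
  have tq: "t \<le> ct * q" using tb mult_left_mono[OF b2, of ct] ct0 by linarith
  show "L * t \<le> R"
    using mult_left_mono[OF tq, of L] pos small(1) unfolding mult.assoc by linarith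
  show "4 * (L\<^sup>2 * D) * h \<le> c1 / (64 * s)"
  proof -
    have "256 * (L\<^sup>2 * D) * (s * h) \<le> 256 * (L\<^sup>2 * D) * q" using b2 pos by (intro mult_left_mono) auto
    also note small(2)
    finally show ?thesis using s by (simp add: field_simps)
  qed
  show "C * L ^ 3 * t \<le> c1 / (64 * s)"
  proof -
    have "s * t \<le> s * (ct * (s * h))" using tb by (intro mult_left_mono) auto
    also have "\<dots> = ct * (real s * real s * h)" by simp
    also have "\<dots> \<le> ct * q" using b1 ct0 by (intro mult_left_mono) auto
    finally have "64 * C * L ^ 3 * (s * t) \<le> 64 * C * L ^ 3 * (ct * q)" using pos by (intro mult_left_mono) auto
    also have "\<dots> \<le> c1" using small(3) by simp
    finally show ?thesis using s by (simp add: field_simps)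
  qed
  have N2: "N\<^sup>2 * r \<le> cs * l" using N by (simp add: l_def)
  have N2': "N\<^sup>2 \<le> cs * l" using N2 mult_left_mono[of 1 "real r" "N\<^sup>2"] r by simp
  \<comment> \<open>\<open>2 * N \<le> 1 + N\<^sup>2\<close> avoids a root; a bound linear in
    \<open>l\<close> is enough, since \<open>b5\<close> has room for one such factor.\<close>
  have N1: "N \<le> (1 + cs) * l"
  proof -
    have "0 \<le> (N - 1)\<^sup>2" by simp
    then have "2 * N \<le> 1 + N\<^sup>2" by (simp add: power2_eq_square algebra_simps)
    then show ?thesis using N2' l N by (simp add: algebra_simps)
  qed
  have sh0: "0 \<le> s * h" using h0 by simp
  have e1: "N * mu \<le> cm * cs * (l * (s * h))"
  proof -
    have "N * mu \<le> N * (cm * (N * s * h))" using mu N by (intro mult_left_mono) auto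
    also have "\<dots> = cm * (N\<^sup>2 * (s * h))" by (simp add: power2_eq_square)
    also have "\<dots> \<le> cm * (cs * l * (s * h))"
      using N2' sh0 pos by (intro mult_left_mono mult_right_mono) auto
    finally show ?thesis by (simp add: mult_ac)
  qed
  have e2: "r * (N * mu) \<le> cm * cs * (l * (s * h))"
  proof -
    have "r * (N * mu) \<le> r * (N * (cm * (N * s * h)))" using mu N by (intro mult_left_mono) auto
    also have "\<dots> = cm * (N\<^sup>2 * r * (s * h))" by (simp add: power2_eq_square)
    also have "\<dots> \<le> cm * (cs * l * (s * h))"
      using N2 sh0 pos by (intro mult_left_mono mult_right_mono) auto
    finally show ?thesis by (simp add: mult_ac)
  qed
  have Nmu0: "0 \<le> N * mu" using N mu by simp
  show "2 * N * mu * (L\<^sup>2 * D) \<le> 1 / 2"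
  proof -
    have "cm * cs * (l * (s * h)) \<le> cm * cs * q" using b3 pos by (intro mult_left_mono) auto
    then have "N * mu \<le> cm * cs * q" using e1 by linarith
    then have "2 * (L\<^sup>2 * D) * (N * mu) \<le> 2 * (L\<^sup>2 * D) * (cm * cs * q)" using pos by (intro mult_left_mono) auto
    then show ?thesis using small(5) by (simp add: mult_ac)
  qed
  show "2 * N * mu * (L\<^sup>2 * D) * u \<le> 1"
  proof -
    have "N * mu * u \<le> (cm * cs * (l * (s * h))) * (cu * l)"
      by (rule mult_mono[OF e1]) (use u pos l sh0 in \<open>auto simp: l_def[symmetric]\<close>)
    also have "\<dots> = cm * cs * cu * (l * (s * h) * l)" by simp
    also have "\<dots> \<le> cm * cs * cu * q" using b4 pos by (intro mult_left_mono) auto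
    finally have "2 * (L\<^sup>2 * D) * (N * mu * u) \<le> 2 * (L\<^sup>2 * D) * (cm * cs * cu * q)"
      using pos by (intro mult_left_mono) auto
    then show ?thesis using small(6) by (simp add: mult_ac)
  qed
  have r1: "m * (mu * t) \<le> cm * ct * (1 + cs) * q"
  proof -
    have "mu \<le> cm * ((1 + cs) * l * (s * h))"
    proof -
      have "N * (s * h) \<le> (1 + cs) * l * (s * h)" using N1 sh0 by (intro mult_right_mono)
      then have "cm * (N * (s * h)) \<le> cm * ((1 + cs) * l * (s * h))" using pos by (intro mult_left_mono) auto
      then show ?thesis using mu by (simp add: mult.assoc)
    qed
    then have "mu * t \<le> (cm * ((1 + cs) * l * (s * h))) * (ct * (s * h))"
      using tb mu t0 pos l sh0 by (intro mult_mono) auto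
    then have "m * (mu * t) \<le> m * ((cm * ((1 + cs) * l * (s * h))) * (ct * (s * h)))"
      using m by (intro mult_left_mono) auto
    also have "\<dots> = cm * ct * (1 + cs) * (m * (l * (s * h) * (s * h)))" by (simp only: mult_ac)
    finally show ?thesis by (simp only: b5)
  qed
  have r2: "m * (N * (L * (C * (L * t)\<^sup>2))) \<le> L * C * L\<^sup>2 * ct\<^sup>2 * (1 + cs) * q"
  proof -
    have "t\<^sup>2 \<le> (ct * (s * h))\<^sup>2" using tb t0 by (intro power_mono)
    then have "N * t\<^sup>2 \<le> ((1 + cs) * l) * (ct * (s * h))\<^sup>2"
      using N1 N by (intro mult_mono) auto
    then have "m * (L * C * L\<^sup>2) * (N * t\<^sup>2) \<le> m * (L * C * L\<^sup>2) * (((1 + cs) * l) * (ct * (s * h))\<^sup>2)"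
      using m pos by (intro mult_left_mono) auto
    also have "\<dots> = L * C * L\<^sup>2 * ct\<^sup>2 * (1 + cs) * (m * (l * (s * h) * (s * h)))"
      by (simp only: power2_eq_square mult_ac)
    finally have "m * (L * C * L\<^sup>2) * (N * t\<^sup>2) \<le> L * C * L\<^sup>2 * ct\<^sup>2 * (1 + cs) * q" by (simp only: b5)
    then show ?thesis by (simp add: power_mult_distrib mult_ac)
  qed
  have r3: "m * (4 * real r * N * mu * (2 * L * c * h)) \<le> 8 * L * c * cm * cs * q"
  proof -
    have "m * (4 * real r * N * mu * (2 * L * c * h)) = 8 * L * c * m * h * (r * (N * mu))" by simp
    also have "\<dots> \<le> 8 * L * c * m * h * (cm * cs * (l * (s * h)))"
      using e2 pos m h0 by (intro mult_left_mono) auto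
    also have "\<dots> = 8 * L * c * cm * cs * (m * (l * (s * h) * h))" by (simp only: mult_ac)
    also have "\<dots> \<le> 8 * L * c * cm * cs * q" using b6 pos by (intro mult_left_mono) auto
    finally show ?thesis .
  qed
  have "m * (mu * t + N * (L * (C * (L * t)\<^sup>2)) + 4 * real r * N * mu * (2 * L * c * h))
      \<le> (cm * ct * (1 + cs) + L * C * L\<^sup>2 * ct\<^sup>2 * (1 + cs) + 8 * L * c * cm * cs) * q"
    using r1 r2 r3 by (simp add: distrib_left distrib_right)
  also note small(4)
  finally show "sqrt n * (mu * t + N * (L * (C * (L * t)\<^sup>2)) + 4 * real r * N * mu * (2 * L * c * h)) \<le> sqrt (1 / (L\<^sup>2 * D))"
    by (simp only: m_def)
qed

text \<open>The sparsity condition makes \<open>s * ln p / n powr (1 / 4)\<close> vanish. Its square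
  carries \<open>(ln p)\<^sup>2\<close>, which dominates \<open>ln p * sqrt (ln p)\<close> once
  \<open>ln p \<ge> 1\<close>.\<close>

lemma sparsity_rate_tendsto_0:
  fixes p s :: "nat \<Rightarrow> nat"
  assumes s1: "\<And>n. n \<ge> 1 \<Longrightarrow> 1 \<le> s n" and p: "filterlim (\<lambda>n. real (p n)) at_top sequentially"
    and s: "(\<lambda>n. real (s n)) \<in> o(\<lambda>n. real n powr (1 / 4) / ln (real (p n)))"
  shows "(\<lambda>n. (real (s n))\<^sup>2 * (ln (p n) * sqrt (ln (p n))) / sqrt (real n)) \<longlonglongrightarrow> 0"
proof (rule tendstoI)
  fix \<epsilon> :: real assume \<epsilon>: "0 < \<epsilon>"
  have lnp: "\<forall>\<^sub>F n in sequentially. 1 \<le> ln (real (p n))"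
    using filterlim_compose[OF ln_at_top p] by (simp add: filterlim_at_top)
  from landau_o.smallD[OF s, of "sqrt (\<epsilon> / 2)"] \<epsilon>
  have "\<forall>\<^sub>F n in sequentially. norm (real (s n)) \<le> sqrt (\<epsilon> / 2) * norm (real n powr (1 / 4) / ln (real (p n)))"
    by simp
  with lnp eventually_ge_at_top[of 1]
  show "\<forall>\<^sub>F n in sequentially. dist ((real (s n))\<^sup>2 * (ln (p n) * sqrt (ln (p n))) / sqrt (real n)) 0 < \<epsilon>"
  proof eventually_elim
    case (elim n)
    define l where "l = ln (real (p n))"
    have l: "1 \<le> l" using elim by (simp add: l_def)
    have "real (s n) * l \<le> sqrt (\<epsilon> / 2) * real n powr (1 / 4)"
      using elim l by (simp add: l_def[symmetric] field_simps)
    then have "(real (s n) * l)\<^sup>2 \<le> (sqrt (\<epsilon> / 2) * real n powr (1 / 4))\<^sup>2"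
      using l by (intro power_mono) auto
    also have "\<dots> = \<epsilon> / 2 * (real n powr (1 / 4))\<^sup>2" using \<epsilon> by (simp add: power_mult_distrib)
    also have "(real n powr (1 / 4))\<^sup>2 = sqrt (real n)"
      using elim by (simp add: powr_power powr_half_sqrt)
    finally have sq: "(real (s n))\<^sup>2 * l\<^sup>2 / sqrt (real n) \<le> \<epsilon> / 2"
      using elim by (simp add: power_mult_distrib pos_divide_le_eq)
    have "sqrt l \<le> l" using l by (intro real_le_lsqrt) (auto simp: power2_eq_square)
    then have "(real (s n))\<^sup>2 * (l * sqrt l) / sqrt (real n) \<le> (real (s n))\<^sup>2 * l\<^sup>2 / sqrt (real n)"
      using l unfolding power2_eq_square[of l] by (intro divide_right_mono mult_left_mono) auto
    then have "(real (s n))\<^sup>2 * (l * sqrt l) / sqrt (real n) < \<epsilon>" using sq \<epsilon> by linarith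
    moreover have "0 \<le> (real (s n))\<^sup>2 * (l * sqrt l) / sqrt (real n)" using l by simp
    ultimately show ?case
      unfolding dist_real_def l_def[symmetric] diff_0_right by (simp only: abs_of_nonneg)
  qed
qed

text \<open>The two roots differ by a term of order \<open>ln (ln P) / sqrt (ln P)\<close>, which
  tends to 0; the allowance 1 is the one built into \<open>gmt_threshold_le\<close>.\<close>

lemma gmt_cutoff_asymptotic:
  "\<forall>\<^sub>F P :: real in at_top. sqrt (2 * ln P) \<le> sqrt (2 * ln P - 2 * ln (ln P)) + 1"
  by real_asymp

section \<open>Choice of the tuning constants and passage to the limit\<close>

theorem corollary1:
  fixes M :: "nat \<Rightarrow> 'w measure"
    and p s0 :: "nat \<Rightarrow> nat"
    and x :: "nat \<Rightarrow> nat \<Rightarrow> 'w \<Rightarrow> rvec"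
    and y :: "nat \<Rightarrow> nat \<Rightarrow> 'w \<Rightarrow> real"
    and \<beta>0 :: "nat \<Rightarrow> rvec"
    and S :: "nat \<Rightarrow> nat set"
    and b :: "real \<Rightarrow> real"
    and v :: "nat \<Rightarrow> nat \<Rightarrow> real \<Rightarrow> real"
    and Sig Th :: "nat \<Rightarrow> rmat"
    and L B a \<kappa> C\<^sub>b R C\<^sub>R r \<gamma> \<rho> c1 c2 \<alpha> :: real
  assumes data: "\<And>n. n \<ge> 1 \<Longrightarrow> iid_data (M n) (p n) n (x n) (y n)"
    and beta0: "\<And>n. n \<ge> 1 \<Longrightarrow> \<beta>0 n \<in> carrier_vec (p n)"
    and S: "\<And>n. S n = support (p n) (\<beta>0 n)"
    and s0: "\<And>n. s0 n = card (S n)"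
    and s0_pos: "\<And>n. n \<ge> 1 \<Longrightarrow> s0 n \<ge> 1"
    and Sig: "\<And>n. Sig n = information_mat b (M n) (p n) (x n 0) (\<beta>0 n)"
    and Th: "\<And>n. Th n = the (mat_inverse (Sig n))"
    and b_diff: "\<And>u. b differentiable at u" "\<And>u. deriv b differentiable at u"
    and b_convex: "convex_on UNIV b"
    and x_bounded: "\<And>n. n \<ge> 1 \<Longrightarrow> AE \<omega> in M n. \<forall>i<n. linf_norm (x n i \<omega>) \<le> L"
    and beta0_bounded: "\<And>n. n \<ge> 1 \<Longrightarrow> l1_norm (\<beta>0 n) \<le> B"
    and a: "a > 1"
    and kappa: "\<kappa> > 0"
    and restricted_eigenvalue: "\<And>n. n \<ge> 1 \<Longrightarrow>
      (INF J\<in>{J. J \<subseteq> {..<p n} \<and> card J \<le> s0 n}.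
         INF z\<in>re_cone (p n) J (a / (a - 1)) (sqrt (real (s0 n)) / (a - 1)) - {0\<^sub>v (p n)}.
           ereal ((z \<bullet> (second_moment_mat (M n) (p n) (x n 0) *\<^sub>v z)) / (l2_norm z)\<^sup>2))
      > ereal \<kappa>"
    and y_integrable: "\<And>n i. i < n \<Longrightarrow> integrable (M n) (y n i)"
    and noise_indep: "\<And>n. n \<ge> 1 \<Longrightarrow>
      cond_indep (M n) (covariate_algebra (M n) (p n) (x n) {..<n})
        (\<lambda>i \<omega>. y n i \<omega> - real_cond_exp (M n) (covariate_algebra (M n) (p n) (x n) {i}) (y n i) \<omega>)
        {..<n}"
    and noise_nondegenerate: "\<And>n i. i < n \<Longrightarrow>
      cond_nondegenerate (M n) (covariate_algebra (M n) (p n) (x n) {..<n})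
        (\<lambda>\<omega>. y n i \<omega> - real_cond_exp (M n) (covariate_algebra (M n) (p n) (x n) {i}) (y n i) \<omega>)"
    and noise_subgaussian: "\<And>n i. i < n \<Longrightarrow>
      cond_subgaussian (M n) (covariate_algebra (M n) (p n) (x n) {..<n})
        (\<lambda>\<omega>. y n i \<omega> - real_cond_exp (M n) (covariate_algebra (M n) (p n) (x n) {i}) (y n i) \<omega>)
        (\<lambda>\<omega>. v n i (x n i \<omega> \<bullet> \<beta>0 n))"
    and C\<^sub>b: "C\<^sub>b > 0"
    and proxy_bounded: "\<And>n. n \<ge> 1 \<Longrightarrow>
      AE \<omega> in M n. \<forall>i<n. v n i (x n i \<omega> \<bullet> \<beta>0 n) \<le> C\<^sub>b\<^sup>2"
    and cond_mean: "\<And>n i. i < n \<Longrightarrow>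
      AE \<omega> in M n. real_cond_exp (M n) (covariate_algebra (M n) (p n) (x n) {i}) (y n i) \<omega>
                 = deriv b (x n i \<omega> \<bullet> \<beta>0 n)"
    and cond_var: "\<And>n i. i < n \<Longrightarrow>
      AE \<omega> in M n. 0 < deriv (deriv b) (x n i \<omega> \<bullet> \<beta>0 n) \<and>
                 cond_variance (M n) (covariate_algebra (M n) (p n) (x n) {i}) (y n i) \<omega>
                   = ennreal (deriv (deriv b) (x n i \<omega> \<bullet> \<beta>0 n))"
    and R: "R > 0"
    and local_lipschitz: "\<And>u u'. u \<noteq> u' \<Longrightarrow> \<bar>u - u'\<bar> \<le> R \<Longrightarrow>
      \<bar>deriv (deriv b) u - deriv (deriv b) u'\<bar> / \<bar>u - u'\<bar> \<le> C\<^sub>R"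
    and n_small: "(\<lambda>n. real n) \<in> o(\<lambda>n. real (p n))"
    and r: "0 < r" "r < 1 / 5"
    and p_small: "(\<lambda>n. real (p n)) \<in> o(\<lambda>n. exp (real n powr r))"
    and s0_small: "(\<lambda>n. real (s0 n)) \<in> o(\<lambda>n. real n powr (1 / 4) / ln (real (p n)))"
    and Th_liminf: "liminf (\<lambda>n. ereal (op1_norm (Th n))) > 0"
    and Th_sparse: "(\<lambda>n. (op1_norm (Th n))\<^sup>2
        * real (Max ((\<lambda>j. card {i. i < p n \<and> Th n $$ (i, j) \<noteq> 0}) ` {..<p n})))
      \<in> O(\<lambda>n. sqrt (ln (real (p n))))"
    and gamma: "\<gamma> > 1 / 2"
    and rho: "0 < \<rho>" "\<rho> < 1 / 3"
    and A_small: "(\<lambda>n. real (card {(j, k). j < p n \<and> k < p n \<and>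
          \<bar>normalize_mat (Th n) j k\<bar> \<ge> ln (real (p n)) powr (- 2 - \<gamma>)}))
      \<in> o(\<lambda>n. real (p n) powr (1 + \<rho>))"
    and B_small: "(\<lambda>n. real (card {(j, k). j < p n \<and> k < p n \<and>
          \<bar>normalize_mat (Th n) j k\<bar> > (1 - \<rho>) / (1 + \<rho>)}))
      \<in> O(\<lambda>n. real (p n))"
    and c1: "0 < c1"
    and Sig_spectrum: "\<And>n. n \<ge> 1 \<Longrightarrow>
      c1 \<le> sigma_min (Sig n) \<and> sigma_min (Sig n) \<le> sigma_max (Sig n) \<and> sigma_max (Sig n) \<le> c2"
    and signal: "\<And>n j. n \<ge> 1 \<Longrightarrow> j \<in> S n \<Longrightarrow>
      \<bar>\<beta>0 n $ j\<bar> > sqrt (8 * Th n $$ (j, j) * ln (real (p n) / real (s0 n)) / real n)"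
    and alpha: "0 < \<alpha>" "\<alpha> < 1"
    and beta_min: "filterlim (\<lambda>n.
        sqrt (real n) * Min ((\<lambda>j. \<bar>\<beta>0 n $ j\<bar>) ` S n)
          / sqrt (Max ((\<lambda>j. Th n $$ (j, j)) ` {..<p n}))
        - sqrt (2 * ln (2 * real (p n) / (\<alpha> * real (s0 n))))) at_top sequentially"
    \<comment> \<open>Tuning: \<open>lam\<close> and \<open>mu\<close> have the prescribed exact orders, with large enough constants.\<close>
  shows "\<exists>K>0. \<forall>lam :: nat \<Rightarrow> real.
     lam \<in> \<Theta>(\<lambda>n. sqrt (ln (real (p n) / real (s0 n)) / real n)) \<longrightarrow>
     (\<forall>\<^sub>F n in sequentially. lam n \<ge> K * sqrt (ln (real (p n) / real (s0 n)) / real n)) \<longrightarrow>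
     (\<exists>K'>0. \<forall>mu :: nat \<Rightarrow> real.
        mu \<in> \<Theta>(\<lambda>n. op1_norm (Th n) * real (s0 n) * sqrt (ln (real (p n)) / real n)) \<longrightarrow>
        (\<forall>\<^sub>F n in sequentially.
           mu n \<ge> K' * (op1_norm (Th n) * real (s0 n) * sqrt (ln (real (p n)) / real n))) \<longrightarrow>
        (\<forall>(\<beta>h :: nat \<Rightarrow> 'w \<Rightarrow> rvec) (Thh :: nat \<Rightarrow> 'w \<Rightarrow> rmat) (E :: nat \<Rightarrow> 'w set).
           (\<forall>n\<ge>1. \<forall>\<omega>\<in>space (M n). \<beta>h n \<omega> \<in> carrier_vec (p n) \<and> Thh n \<omega> \<in> carrier_mat (p n) (p n)) \<longrightarrow>
           (\<forall>n\<ge>1. \<forall>j<p n. (\<lambda>\<omega>. \<beta>h n \<omega> $ j) \<in> borel_measurable (M n)) \<longrightarrow>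
           (\<forall>n\<ge>1. \<forall>j<p n. \<forall>k<p n. (\<lambda>\<omega>. Thh n \<omega> $$ (j, k)) \<in> borel_measurable (M n)) \<longrightarrow>
           \<comment> \<open>\<open>E n\<close>: an event of probability tending to 1 on which both programs are solved\<close>
           (\<forall>n\<ge>1. E n \<in> sets (M n)) \<longrightarrow>
           (\<lambda>n. measure (M n) (E n)) \<longlonglongrightarrow> 1 \<longrightarrow>
           (\<forall>n\<ge>1. \<forall>\<omega>\<in>E n.
              is_lasso b (p n) n (\<lambda>i. x n i \<omega>) (\<lambda>i. y n i \<omega>) (lam n) (\<beta>h n \<omega>) \<and>
              is_clime (p n) (sample_information_mat b (p n) n (\<lambda>i. x n i \<omega>) (\<beta>h n \<omega>)) (mu n) (Thh n \<omega>)) \<longrightarrow>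
           (\<lambda>n. directional_power (M n) \<alpha> (p n) (\<beta>0 n)
                  (\<lambda>\<omega>. test_stat b (p n) n (\<lambda>i. x n i \<omega>) (\<lambda>i. y n i \<omega>) (\<beta>h n \<omega>) (Thh n \<omega>)))
             \<longlonglongrightarrow> 1))"
proof -
  have lip: "\<bar>deriv (deriv b) u - deriv (deriv b) u'\<bar> \<le> C\<^sub>R * \<bar>u - u'\<bar>" if "\<bar>u - u'\<bar> \<le> R" for u u'
  proof (cases "u = u'")
    case False
    then show ?thesis using local_lipschitz[OF False that] by (simp add: pos_divide_le_eq)
  qed simp
  interpret loss: glm_loss b R C\<^sub>R
    by unfold_locales (use b_diff b_convex R lip in auto)
  \<comment> \<open>A larger bound on the covariates remains valid, and this one is
    positive.\<close>
  define L' where "L' = max L 1"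
  have L': "L' > 0" by (simp add: L'_def)
  \<comment> \<open>A single \<open>D\<close> for all \<open>n\<close>, since \<open>L'\<close> and
    \<open>B\<close> are constants.\<close>
  obtain D where D: "D > 0" "\<And>u. \<bar>u\<bar> \<le> L' * B \<Longrightarrow> \<bar>deriv (deriv b) u\<bar> \<le> D"
    using loss.deriv2_bounded by metis
  have p1: "p n \<ge> 1" if "n \<ge> 1" for n
  proof (rule ccontr)
    assume "\<not> p n \<ge> 1"
    then have "S n = {}" by (simp add: S support_def)
    then show False using s0_pos[OF that] by (simp add: s0)
  qed
  have G: "glm_data b R C\<^sub>R (M n) (p n) n (x n) (y n) (\<beta>0 n) (v n) L' C\<^sub>b B D" if n: "n \<ge> 1" for n
  proof unfold_locales
    show "AE \<omega> in M n. \<forall>i<n. linf_norm (x n i \<omega>) \<le> L'"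
      using x_bounded[OF n] by eventually_elim (auto simp: L'_def intro: order_trans)
  qed (use n data beta0 p1 L' beta0_bounded D C\<^sub>b noise_subgaussian proxy_bounded cond_mean cond_var in auto)
  have Th': "the (mat_inverse (information_mat b (M n) (p n) (x n 0) (\<beta>0 n))) = Th n" for n
    by (simp add: Th Sig)
  have spec: "c1 \<le> sigma_min (information_mat b (M n) (p n) (x n 0) (\<beta>0 n))" if "n \<ge> 1" for n
    using Sig_spectrum[OF that] by (simp add: Sig)
  define h where "h = (\<lambda>n. sqrt (ln (p n) / n))"
  define hs where "hs = (\<lambda>n. sqrt (ln (real (p n) / real (s0 n)) / n))"
  define q where "q = (\<lambda>n. (real (s0 n))\<^sup>2 * (ln (p n) * sqrt (ln (p n))) / sqrt n)"
  define N where "N = (\<lambda>n. op1_norm (Th n))"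
  define r where "r = (\<lambda>n. Max ((\<lambda>j. card {i. i < p n \<and> Th n $$ (i, j) \<noteq> 0}) ` {..<p n}))"
  have pn: "\<forall>\<^sub>F n in sequentially. real n \<le> real (p n)"
    using landau_o.smallD[OF n_small, of 1] by simp
  have p_top: "filterlim (\<lambda>n. real (p n)) at_top sequentially"
    by (rule filterlim_at_top_mono[OF filterlim_real_sequentially pn])
  have q0: "q \<longlonglongrightarrow> 0"
    unfolding q_def by (rule sparsity_rate_tendsto_0[OF s0_pos p_top s0_small])
  have q_small: "\<forall>\<^sub>F n in sequentially. c * q n \<le> d" if "d > 0" for c d :: real
  proof -
    have "(\<lambda>n. c * q n) \<longlonglongrightarrow> c * 0" by (intro tendsto_mult tendsto_const q0)
    then have "\<forall>\<^sub>F n in sequentially. c * q n < d" using that by (intro order_tendstoD(2)) auto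
    then show ?thesis by eventually_elim simp
  qed
  have lnp: "\<forall>\<^sub>F n in sequentially. 1 \<le> ln (real (p n))"
    using filterlim_compose[OF ln_at_top p_top] by (simp add: filterlim_at_top)
  have cutoff: "\<forall>\<^sub>F n in sequentially. sqrt (2 * ln (real (p n))) \<le> gmt_cutoff (p n) + 1"
    using eventually_compose_filterlim[OF gmt_cutoff_asymptotic p_top] by (simp add: gmt_cutoff_def)
  have s0_ev: "\<forall>\<^sub>F n in sequentially. real (s0 n) \<le> norm (real n powr (1 / 4) / ln (real (p n)))"
    using landau_o.smallD[OF s0_small, of 1] by simp
  \<comment> \<open>The Lasso is tuned with \<open>ln (p / s0)\<close>, while the union bounds
    involve \<open>ln p\<close>. Eventually \<open>s0 \<le> sqrt n \<le> sqrt p\<close>, so the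
    logarithms differ by a factor of at most 2; it is rounded up to 4 to have a simple root.\<close>
  have rates: "\<forall>\<^sub>F n in sequentially. h n \<le> 2 * hs n \<and> hs n \<le> h n"
    using s0_ev lnp pn eventually_ge_at_top[of 1]
  proof eventually_elim
    case (elim n)
    have n: "n \<ge> 1" by (rule elim)
    have s1: "1 \<le> real (s0 n)" using s0_pos[OF n] by simp
    have "real (s0 n) \<le> real n powr (1 / 4) / ln (real (p n))" using elim by simp
    also have "\<dots> \<le> real n powr (1 / 4) / 1"
      by (rule divide_left_mono[OF elim(2)]) (simp, use elim(2) in linarith)
    also have "\<dots> \<le> real n powr (1 / 2)" using n by (simp add: powr_mono)
    also have "\<dots> \<le> real (p n) powr (1 / 2)" using elim by (intro powr_mono2) auto
    finally have "ln (real (s0 n)) \<le> ln (real (p n) powr (1 / 2))" using s1 by (intro ln_mono) auto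
    also have "\<dots> = ln (real (p n)) / 2" using p1[OF n] by (simp add: ln_powr)
    finally have half: "ln (real (p n)) / 2 \<le> ln (real (p n) / real (s0 n))"
      using s1 p1[OF n] by (simp add: ln_div)
    have le: "ln (real (p n) / real (s0 n)) \<le> ln (real (p n))"
      using s1 p1[OF n] by (simp add: ln_div)
    have "h n \<le> sqrt (2\<^sup>2 * (ln (real (p n) / real (s0 n)) / n))"
    proof -
      have "ln (real (p n)) \<le> 4 * ln (real (p n) / real (s0 n))" using half elim(2) by linarith
      then have "ln (real (p n)) / n \<le> 4 * ln (real (p n) / real (s0 n)) / n" by (rule divide_right_mono) simp
      then show ?thesis unfolding h_def by (intro real_sqrt_le_mono) simp
    qed
    also have "\<dots> = 2 * hs n" unfolding hs_def real_sqrt_mult by simp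
    finally show ?case using le by (simp add: h_def hs_def divide_right_mono)
  qed
  have r1: "1 \<le> r n" "\<And>j. j < p n \<Longrightarrow> card {i. i < p n \<and> Th n $$ (i, j) \<noteq> 0} \<le> r n" if n: "n \<ge> 1" for n
  proof -
    show le: "card {i. i < p n \<and> Th n $$ (i, j) \<noteq> 0} \<le> r n" if "j < p n" for j
      unfolding r_def using that by (intro Max_ge) auto
    \<comment> \<open>A positive diagonal entry puts a nonzero into column 0, so that
      \<open>r n \<ge> 1\<close> and \<open>N\<^sup>2 * r\<close> dominates
      \<open>N\<^sup>2\<close>.\<close>
    have "0 < p n" using p1[OF n] by simp
    then have "Th n $$ (0, 0) \<noteq> 0"
      using glm_data.Th_diag_lower(2)[OF G[OF n] c1 spec[OF n], of 0] by (simp add: Th')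
    then have "card {i. i < p n \<and> Th n $$ (i, 0) \<noteq> 0} > 0" using \<open>0 < p n\<close> by (auto simp: card_gt_0_iff)
    then show "1 \<le> r n" using le[OF \<open>0 < p n\<close>] by linarith
  qed
  have N0: "0 \<le> N n" if n: "n \<ge> 1" for n
  proof -
    have "0 < p n" using p1[OF n] by simp
    from glm_data.Th_row_l1[OF G[OF n] c1 spec[OF n] this]
    have "(\<Sum>k<p n. \<bar>Th n $$ (0, k)\<bar>) \<le> N n" by (simp add: Th' N_def)
    then show ?thesis by (rule order_trans[rotated]) (simp add: sum_nonneg)
  qed
  obtain cs where cs: "cs > 0" "\<forall>\<^sub>F n in sequentially. (N n)\<^sup>2 * r n \<le> cs * sqrt (ln (p n))"
  proof -
    from landau_o.bigE[OF Th_sparse] obtain cs where "cs > 0"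
      "\<forall>\<^sub>F n in sequentially. norm ((N n)\<^sup>2 * r n) \<le> cs * norm (sqrt (ln (p n)))"
      unfolding N_def r_def by blast
    moreover from this(2) lnp have "\<forall>\<^sub>F n in sequentially. (N n)\<^sup>2 * r n \<le> cs * sqrt (ln (p n))"
      by eventually_elim simp
    ultimately show ?thesis using that by blast
  qed
  define u where "u = (\<lambda>n. sqrt (2 * ln (2 * real (p n) / (\<alpha> * real (s0 n)))))"
  \<comment> \<open>From \<open>ln (2 * p / (\<alpha> * s0)) \<le> ln (2 / \<alpha>) + ln p\<close>,
    where the constant is absorbed because \<open>ln p \<ge> 1\<close>.\<close>
  define cu where "cu = sqrt (2 * (1 + ln (2 / \<alpha>)))"
  have la: "0 < ln (2 / \<alpha>)" using alpha by simp
  have cu0: "0 < cu" using la by (simp add: cu_def)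
  have u_bound: "\<forall>\<^sub>F n in sequentially. 0 \<le> u n \<and> u n \<le> cu * sqrt (ln (p n))"
    using lnp eventually_ge_at_top[of 1]
  proof eventually_elim
    case (elim n)
    have s1: "1 \<le> real (s0 n)" using s0_pos[OF elim(2)] by simp
    have pos: "0 < real (p n)" using p1[OF elim(2)] by simp
    have "card (support (p n) (\<beta>0 n)) \<le> card {..<p n}" by (intro card_mono) (auto simp: support_def)
    then have "real (s0 n) \<le> real (p n)" by (simp add: s0 S)
    then have "\<alpha> * real (s0 n) \<le> 1 * real (p n)" using alpha by (intro mult_mono) auto
    then have "1 \<le> 2 * real (p n) / (\<alpha> * real (s0 n))" using alpha s1 pos by (simp add: pos_le_divide_eq)
    then have u0: "0 \<le> u n" by (simp add: u_def)
    have "2 * real (p n) / (\<alpha> * real (s0 n)) \<le> 2 * real (p n) / (\<alpha> * 1)"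
      using s1 alpha pos by (intro divide_left_mono mult_left_mono) auto
    then have "ln (2 * real (p n) / (\<alpha> * real (s0 n))) \<le> ln (2 / \<alpha> * real (p n))"
      using s1 alpha pos by simp
    also have "\<dots> = ln (2 / \<alpha>) * 1 + ln (real (p n))" using alpha pos by (subst ln_mult) auto
    also have "\<dots> \<le> ln (2 / \<alpha>) * ln (real (p n)) + ln (real (p n))"
      using la elim(1) by (intro add_mono mult_left_mono) auto
    finally have "u n \<le> sqrt (2 * (1 + ln (2 / \<alpha>)) * ln (real (p n)))"
      unfolding u_def by (intro real_sqrt_le_mono) (simp add: algebra_simps)
    also have "\<dots> = cu * sqrt (ln (p n))" by (simp add: cu_def real_sqrt_mult)
    finally show ?case using u0 by simp
  qed
  \<comment> \<open>The excess of the weakest signal, measured against the largest variance, over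
    the detection boundary: one margin that serves all of \<open>S n\<close>.\<close>
  define w where "w = (\<lambda>n. sqrt n * Min ((\<lambda>j. \<bar>\<beta>0 n $ j\<bar>) ` S n)
      / sqrt (Max ((\<lambda>j. Th n $$ (j, j)) ` {..<p n})) - u n)"
  have w_top: "filterlim w at_top sequentially" using beta_min by (simp add: w_def u_def)
  have signal_w: "u n + w n \<le> sqrt n * \<bar>\<beta>0 n $ j\<bar> / sqrt (Th n $$ (j, j))" if n: "n \<ge> 1" and j: "j \<in> S n" for n j
  proof -
    have jp: "j < p n" using j by (simp add: S support_def)
    have Tj: "0 < Th n $$ (j, j)"
      using glm_data.Th_diag_lower(2)[OF G[OF n] c1 spec[OF n] jp] by (simp add: Th')
    have "Min ((\<lambda>j. \<bar>\<beta>0 n $ j\<bar>) ` S n) \<le> \<bar>\<beta>0 n $ j\<bar>"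
      using j by (intro Min_le) (auto simp: S support_def)
    moreover have "Th n $$ (j, j) \<le> Max ((\<lambda>j. Th n $$ (j, j)) ` {..<p n})"
      using jp by (intro Max_ge) auto
    ultimately have "sqrt n * Min ((\<lambda>j. \<bar>\<beta>0 n $ j\<bar>) ` S n) / sqrt (Max ((\<lambda>j. Th n $$ (j, j)) ` {..<p n}))
        \<le> sqrt n * \<bar>\<beta>0 n $ j\<bar> / sqrt (Th n $$ (j, j))"
      using Tj by (intro frac_le mult_left_mono) auto
    then show ?thesis by (simp add: w_def)
  qed
  \<comment> \<open>Half of \<open>lam\<close> has to dominate the score bound
    \<open>2 * L' * C\<^sub>b * h\<close>, and \<open>h \<le> 2 * hs\<close>; together this asks for
    \<open>8 * (L' * C\<^sub>b) * hs \<le> lam\<close>.\<close>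
  define K where "K = 8 * (L' * C\<^sub>b)"
  have K: "K > 0" using L' C\<^sub>b by (simp add: K_def)
  show ?thesis
  proof (rule exI[of _ K], intro conjI K allI impI, goal_cases)
    case (1 lam)
    note lam_Theta = 1(1) and lam_ge = 1(2)
    obtain cl where cl: "cl > 0" "\<forall>\<^sub>F n in sequentially. norm (lam n) \<le> cl * norm (hs n)"
      using landau_o.bigE[OF bigthetaD1[OF lam_Theta]] unfolding hs_def by blast
    define ct where "ct = 100 * cl / c1"
    have ct0: "0 < ct" using cl c1 by (simp add: ct_def)
    \<comment> \<open>The summands account for the deviation of the sample information at the truth
      and for its change from there to the Lasso estimate. The second involves \<open>cl\<close>,
      the upper constant of \<open>lam\<close>, which is why \<open>K'\<close> is quantified after
      \<open>lam\<close>.\<close>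
    define K' where "K' = 4 * (L'\<^sup>2 * D) + L'\<^sup>2 * (C\<^sub>R * (L' * ct))"
    have "0 < 4 * (L'\<^sup>2 * D)" using L' D by simp
    then have K': "K' > 0" unfolding K'_def using L' loss.C_nonneg ct0 by (intro add_pos_nonneg) auto
    show ?case
    proof (rule exI[of _ K'], intro conjI K' allI impI, goal_cases)
      case (1 mu \<beta>h Thh E)
      note mu_Theta = 1(1) and mu_ge = 1(2) and car = 1(3) and meas1 = 1(4) and meas2 = 1(5)
        and E_sets = 1(6) and E_prob = 1(7) and solved = 1(8)
      define P where "P = (\<lambda>n. directional_power (M n) \<alpha> (p n) (\<beta>0 n)
                  (\<lambda>\<omega>. test_stat b (p n) n (\<lambda>i. x n i \<omega>) (\<lambda>i. y n i \<omega>) (\<beta>h n \<omega>) (Thh n \<omega>)))"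
      obtain cm where cm: "cm > 0" "\<forall>\<^sub>F n in sequentially. norm (mu n) \<le> cm * norm (N n * real (s0 n) * h n)"
        using landau_o.bigE[OF bigthetaD1[OF mu_Theta]] unfolding h_def N_def by blast
      have L2D: "0 < sqrt (1 / (L'\<^sup>2 * D))" using L' D by simp
      \<comment> \<open>For each fixed \<open>Km\<close> all side conditions hold from some
        \<open>n\<close> on; \<open>Km\<close> affects only the requirement that the margin
        \<open>w n\<close> be large.\<close>
      have bounds: "\<forall>\<^sub>F n in sequentially. P n \<le> 1 \<and> measure (M n) (E n) - 4 / p n - 3 / Km\<^sup>2 \<le> P n"
        if Km: "Km > 0" for Km :: real
      proof -
        have w_large: "\<forall>\<^sub>F n in sequentially. Km + 9 \<le> w n"
          using w_top by (simp add: filterlim_at_top)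
        have q5: "\<forall>\<^sub>F n in sequentially. 2 * (L'\<^sup>2 * D) * cm * cs * q n \<le> 1 / 2" by (rule q_small) simp
        have q6: "\<forall>\<^sub>F n in sequentially. 2 * (L'\<^sup>2 * D) * cm * cs * cu * q n \<le> 1" by (rule q_small) simp
        from eventually_ge_at_top[of 1] lnp cutoff rates cs(2) u_bound w_large lam_ge cl(2) mu_ge cm(2)
          q_small[OF R, of "L' * ct"] q_small[OF c1, of "256 * (L'\<^sup>2 * D)"]
          q_small[OF c1, of "64 * C\<^sub>R * L' ^ 3 * ct"]
          q_small[OF L2D, of "cm * ct * (1 + cs) + L' * C\<^sub>R * L'\<^sup>2 * ct\<^sup>2 * (1 + cs) + 8 * L' * C\<^sub>b * cm * cs"]
          q5 q6
        show ?thesis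
        proof eventually_elim
          case (elim n)
          have n: "n \<ge> 1" by (rule elim)
          define t where "t = 100 * lam n * s0 n / c1"
          have s1: "1 \<le> s0 n" by (rule s0_pos[OF n])
          have rate: "glm_data.rate (p n) n = h n"
            by (simp add: glm_data.rate_def[OF G[OF n]] h_def)
          have h0: "0 < h n" using elim(2) n by (simp add: h_def)
          have hs0: "0 < hs n" using elim(4) h0 by linarith
          have lam_lower: "K * hs n \<le> lam n" using elim(8) by (simp add: hs_def)
          then have lam0: "0 < lam n" using K hs0 by (meson mult_pos_pos less_le_trans)
          have lam_upper: "lam n \<le> cl * h n"
          proof -
            have "lam n \<le> cl * hs n" using elim(9) lam0 hs0 by simp
            also have "\<dots> \<le> cl * h n" using elim(4) cl by (intro mult_left_mono) auto
            finally show ?thesis .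
          qed
          have lam4: "4 * (L' * C\<^sub>b) * h n \<le> lam n"
          proof -
            have "4 * (L' * C\<^sub>b) * h n \<le> 4 * (L' * C\<^sub>b) * (2 * hs n)"
              using elim(4) L' C\<^sub>b by (intro mult_left_mono) auto
            also have "\<dots> = K * hs n" by (simp add: K_def)
            also note lam_lower
            finally show ?thesis .
          qed
          have Nsh0: "0 \<le> N n * real (s0 n) * h n" using N0[OF n] h0 by simp
          have mu_lower: "K' * (N n * real (s0 n) * h n) \<le> mu n" using elim(10) by (simp add: N_def h_def)
          then have mu0: "0 \<le> mu n" using K' Nsh0 by (meson mult_nonneg_nonneg less_imp_le order_trans)
          have mu_upper: "mu n \<le> cm * (N n * real (s0 n) * h n)" using elim(11) Nsh0 mu0 by simp
          have n0: "0 < n" using n by simp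
          have hn: "h n = sqrt (ln (real (p n)) / real n)" by (simp add: h_def)
          have qn: "q n = (real (s0 n))\<^sup>2 * (ln (real (p n)) * sqrt (ln (real (p n)))) / sqrt (real n)"
            by (simp add: q_def)
          note rc = rate_conditions[OF n0 elim(2) s1 r1(1)[OF n] hn qn less_imp_le[OF lam0] lam_upper
              t_def c1 N0[OF n] elim(5) mu0 mu_upper elim(6)[THEN conjunct1] elim(6)[THEN conjunct2]
              L' D(1) loss.C_nonneg C\<^sub>b cl(1) cm(1) cs(1) cu0 ct_def
              elim(12) elim(13) elim(14) elim(15) elim(16) elim(17)]
          have mu_ok: "(4 * (L'\<^sup>2 * D) * h n + L'\<^sup>2 * (C\<^sub>R * (L' * t))) * N n \<le> mu n"
          proof -
            have "4 * (L'\<^sup>2 * D) * h n \<le> 4 * (L'\<^sup>2 * D) * (s0 n * h n)"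
              using s1 h0 D by (intro mult_left_mono) auto
            moreover have "L'\<^sup>2 * (C\<^sub>R * (L' * t)) \<le> L'\<^sup>2 * (C\<^sub>R * (L' * (ct * (s0 n * h n))))"
              using rc(1) L' loss.C_nonneg by (intro mult_left_mono) auto
            ultimately have "4 * (L'\<^sup>2 * D) * h n + L'\<^sup>2 * (C\<^sub>R * (L' * t)) \<le> K' * (s0 n * h n)"
              by (simp add: K'_def distrib_right mult.assoc)
            then have "(4 * (L'\<^sup>2 * D) * h n + L'\<^sup>2 * (C\<^sub>R * (L' * t))) * N n \<le> K' * (s0 n * h n) * N n"
              using N0[OF n] by (rule mult_right_mono)
            also have "\<dots> = K' * (N n * real (s0 n) * h n)" by (simp only: mult_ac)
            also note mu_lower
            finally show ?thesis .
          qed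
          have N_eq: "op1_norm (Th n) = N n" by (simp add: N_def)
          have seq: "s0 n = card (support (p n) (\<beta>0 n))" by (simp add: s0 S)
          have ueq: "u n = sqrt (2 * ln (2 * real (p n) / (\<alpha> * real (s0 n))))" by (simp add: u_def)
          have car': "\<beta>h n \<omega> \<in> carrier_vec (p n) \<and> Thh n \<omega> \<in> carrier_mat (p n) (p n)"
            if "\<omega> \<in> space (M n)" for \<omega> using car n that by blast
          have meas1': "(\<lambda>\<omega>. \<beta>h n \<omega> $ j) \<in> borel_measurable (M n)" if "j < p n" for j
            using meas1 n that by blast
          have meas2': "(\<lambda>\<omega>. Thh n \<omega> $$ (j, k)) \<in> borel_measurable (M n)" if "j < p n" "k < p n" for j k
            using meas2 n that by blast
          have E_sets': "E n \<in> sets (M n)" using E_sets n by blast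
          have solved': "is_lasso b (p n) n (\<lambda>i. x n i \<omega>) (\<lambda>i. y n i \<omega>) (lam n) (\<beta>h n \<omega>) \<and>
              is_clime (p n) (sample_information_mat b (p n) n (\<lambda>i. x n i \<omega>) (\<beta>h n \<omega>)) (mu n) (Thh n \<omega>)"
            if "\<omega> \<in> E n" for \<omega> using solved n that by blast
          have sig: "u n + w n \<le> sqrt n * \<bar>\<beta>0 n $ j\<bar> / sqrt (Th n $$ (j, j))"
            if "j \<in> support (p n) (\<beta>0 n)" for j using signal_w[OF n] that by (simp add: S)
          note final = glm_data.directional_power_fixed_n[OF G[OF n] c1 spec[OF n], unfolded Th' rate N_eq,
              OF car' meas1' meas2' E_sets' solved' alpha seq s1 elim(3) elim(2) lam0 lam4 t_def rc(2) rc(3) rc(4)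
                mu_ok r1(2)[OF n] rc(5) ueq rc(6) rc(7) elim(7) Km sig]
          show ?case using final unfolding P_def by blast
        qed
      qed
      have "P \<longlonglongrightarrow> 1"
      proof (rule tendstoI)
        fix \<epsilon> :: real assume \<epsilon>: "0 < \<epsilon>"
        \<comment> \<open>The three losses, from the complement of \<open>E n\<close>, from
          \<open>4 / p n\<close> and from Chebyshev's inequality, get \<open>\<epsilon> / 3\<close>
          each; this choice makes the last one exactly that.\<close>
        define Km where "Km = 3 / sqrt \<epsilon>"
        have Km: "Km > 0" "3 / Km\<^sup>2 = \<epsilon> / 3" using \<epsilon> by (simp_all add: Km_def power_divide)
        have "((\<lambda>x::real. 4 / x) \<longlongrightarrow> 0) at_top" by real_asymp
        from filterlim_compose[OF this p_top] have "(\<lambda>n. 4 / real (p n)) \<longlonglongrightarrow> 0" .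
        then have p_ev: "\<forall>\<^sub>F n in sequentially. 4 / real (p n) < \<epsilon> / 3"
          using \<epsilon> by (intro order_tendstoD(2)) auto
        have E_ev: "\<forall>\<^sub>F n in sequentially. 1 - \<epsilon> / 3 < measure (M n) (E n)"
          using E_prob \<epsilon> by (intro order_tendstoD(1)) auto
        show "\<forall>\<^sub>F n in sequentially. dist (P n) 1 < \<epsilon>"
          using bounds[OF Km(1)] p_ev E_ev
          by eventually_elim (use Km(2) \<epsilon> in \<open>auto simp: dist_real_def\<close>)
      qed
      then show ?case by (simp only: P_def)
    qed
  qed
qed

end
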